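(* Let $\Theta$ be a relational language and let $\sqsubset\,\notin\Theta$ be a binary relational symbol. Then the category $\mathbf{Rel}_{srq}(\Theta,\sqsubset)$, whose objects are all finite linearly ordered reflexive $\Theta$-structures and whose morphisms are the strong rigid quotient maps of structures, has the dual Ramsey property.
   Context: A linearly ordered reflexive $\Theta$-structure is $\mathcal A=(A,\Theta^{\mathcal A},\sqsubset^{\mathcal A})$ where $\sqsubset^{\mathcal A}$ is a (strict) linear order on $A$ and each $\theta\in\Theta$ of arity $r$ is interpreted by a relation $\theta^{\mathcal A}\subseteq A^r$ containing all constant tuples $(a,a,\ldots,a)$, $a\in A$. A homomorphism $f:(A,\Theta^{\mathcal A})\to(B,\Theta^{\mathcal B})$ is a map $f:A\to B$ with $(a_1,\ldots,a_r)\in\theta^{\mathcal A}\Rightarrow(f(a_1),\ldots,f(a_r))\in\theta^{\mathcal B}$ for all $\theta\in\Theta$; it induces $\hat f:\theta^{\mathcal A}\to\theta^{\mathcal B}$, $\hat f(a_1,\ldots,a_r)=(f(a_1),\ldots,f(a_r))$. Rigid surjection: a surjection $f:(X,<)\to(Y,<')$ between finite chains such that $\min f^{-1}(x)<\min f^{-1}(y)$ whenever $x<'y$. Order on sets: for a finite chain $(A,\sqsubset)$ and distinct $X,Y\subseteq A$ put $X\sqsubset_{alex}Y$ iff $X\subsetneq Y$, or $X,Y$ are incomparable under inclusion and $\max(X\setminus Y)\sqsubset\max(Y\setminus X)$. For the chain $\{1<2<\cdots<r\}$ this order on subsets is written $<_{alex}$. Order on total quasiorders: a total quasiorder on $I=\{1,\ldots,r\}$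 is a reflexive transitive relation $\sigma$ in which any two elements are comparable; $i\equiv_\sigma j$ iff $(i,j),(j,i)\in\sigma$. For distinct total quasiorders $\sigma,\tau$ on $I$ enumerate the classes as $I/{\equiv_\sigma}=\{S_1<_{alex}S_2<_{alex}\cdots<_{alex}S_k\}$ and $I/{\equiv_\tau}=\{T_1<_{alex}T_2<_{alex}\cdots<_{alex}T_\ell\}$. Put $\sigma\triangleleft\tau$ if $k<\ell$, or $k=\ell$ and $(S_1,\ldots,S_k)$ precedes $(T_1,\ldots,T_k)$ anti-lexicographically, i.e. there is an $s$ with $S_s<_{alex}T_s$ and $S_j=T_j$ for all $j>s$. Order on tuples: for a finite chain $(A,\sqsubset)$ and $\bar a=(a_1,\ldots,a_r)\in A^r$ let $\mathrm{tp}(\bar a)=\{(i,j):a_i\sqsubseteq a_j\}$, a total quasiorder on $\{1,\ldots,r\}$. The special anti-lexicographic order $\sqsubset_{sal}$ on $A^r$ is defined as follows: if $\mathrm{tp}(\bar a)\triangleleft\mathrm{tp}(\bar b)$ then $\bar a\sqsubset_{sal}\bar b$; if $\mathrm{tp}(\bar a)=\mathrm{tp}(\bar b)$ and $\{a_1,\ldots,a_r\}\ne\{b_1,\ldots,b_r\}$ then $\bar a\sqsubset_{sal}\bar b$ iff $\{a_1,\ldots,a_r\}\sqsubset_{alex}\{b_1,\ldots,b_r\}$. (For $r=1$ this is $\sqsubset$.) A strong rigid quotient map of structures from $\mathcal A$ to $\mathcal B$ is a homomorphism $f:(A,\Theta^{\mathcal A})\to(B,\Theta^{\mathcal B})$ which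 is a rigid surjection $(A,\sqsubset^{\mathcal A})\to(B,\sqsubset^{\mathcal B})$ and such that for every $\theta\in\Theta$: (i) $\hat f:(\theta^{\mathcal A},\sqsubset^{\mathcal A}_{sal})\to(\theta^{\mathcal B},\sqsubset^{\mathcal B}_{sal})$ is a rigid surjection; (ii) for every $(x_1,\ldots,x_r)\in\theta^{\mathcal A}$, if the restriction of $f$ to $\{x_1,\ldots,x_r\}$ is not constant then $x_i\sqsubset^{\mathcal A}x_j\Rightarrow f(x_i)\sqsubset^{\mathcal B}f(x_j)$ for all $i,j$. A category $\mathbf C$ has the dual Ramsey property if for every integer $k\ge2$ and all objects $\mathcal A,\mathcal B$ with $\hom_{\mathbf C}(\mathcal B,\mathcal A)\neq\varnothing$ there is an object $\mathcal C$ such that for every coloring $\chi:\hom_{\mathbf C}(\mathcal C,\mathcal A)\to\{1,\ldots,k\}$ there is $w\in\hom_{\mathbf C}(\mathcal C,\mathcal B)$ such that $\chi$ is constant on $\{f\cdot w: f\in\hom_{\mathbf C}(\mathcal B,\mathcal A)\}$. *)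

theory Defs
  imports Main "HOL-Library.FuncSet"
begin

section \<open>Categories and the dual Ramsey property\<close>

text \<open>\<open>Cmp C X Y Z g f\<close> is the composite of \<open>f \<in> Hom C X Y\<close> with \<open>g \<in> Hom C Y Z\<close>.\<close>

record ('o, 'm) category =
  Obj :: "'o set"
  Hom :: "'o \<Rightarrow> 'o \<Rightarrow> 'm set"
  Cmp :: "'o \<Rightarrow> 'o \<Rightarrow> 'o \<Rightarrow> 'm \<Rightarrow> 'm \<Rightarrow> 'm"
  Ident :: "'o \<Rightarrow> 'm"

definition is_category :: "('o, 'm) category \<Rightarrow> bool" where
  "is_category C \<longleftrightarrow>
     (\<forall>X\<in>Obj C. Ident C X \<in> Hom C X X) \<and>
     (\<forall>X\<in>Obj C. \<forall>Y\<in>Obj C. \<forall>Z\<in>Obj C. \<forall>f\<in>Hom C X Y. \<forall>g\<in>Hom C Y Z.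
        Cmp C X Y Z g f \<in> Hom C X Z) \<and>
     (\<forall>X\<in>Obj C. \<forall>Y\<in>Obj C. \<forall>f\<in>Hom C X Y.
        Cmp C X X Y f (Ident C X) = f \<and> Cmp C X Y Y (Ident C Y) f = f) \<and>
     (\<forall>W\<in>Obj C. \<forall>X\<in>Obj C. \<forall>Y\<in>Obj C. \<forall>Z\<in>Obj C.
        \<forall>f\<in>Hom C W X. \<forall>g\<in>Hom C X Y. \<forall>h\<in>Hom C Y Z.
          Cmp C W Y Z h (Cmp C W X Y g f) = Cmp C W X Z (Cmp C X Y Z h g) f)"

definition dual_ramsey_property :: "('o, 'm) category \<Rightarrow> bool" where
  "dual_ramsey_property C \<longleftrightarrow>
     (\<forall>k::nat. k \<ge> 2 \<longrightarrow> (\<forall>A\<in>Obj C. \<forall>B\<in>Obj C. Hom C B A \<noteq> {} \<longrightarrow>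
       (\<exists>D\<in>Obj C. \<forall>\<chi> \<in> Hom C D A \<rightarrow> {1..k}.
          \<exists>w\<in>Hom C D B. \<exists>c. \<forall>f\<in>Hom C B A. \<chi> (Cmp C D B A f w) = c)))"


section \<open>Finite chains and rigid surjections\<close>

text \<open>All orders below are strict and given as relations; a chain on \<open>A\<close> is a relation
  \<open>L \<subseteq> A \<times> A\<close> with \<open>strict_linear_order_on A L\<close>.\<close>

definition rel_min :: "'a rel \<Rightarrow> 'a set \<Rightarrow> 'a" where
  "rel_min L S = (THE m. m \<in> S \<and> (\<forall>x\<in>S. x \<noteq> m \<longrightarrow> (m, x) \<in> L))"

definition rel_max :: "'a rel \<Rightarrow> 'a set \<Rightarrow> 'a" where
  "rel_max L S = rel_min (L\<inverse>) S"

definition fibre :: "'a set \<Rightarrow> ('a \<Rightarrow> 'b) \<Rightarrow> 'b \<Rightarrow> 'a set" where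
  "fibre X f y = {a\<in>X. f a = y}"

definition rigid_surj :: "'a set \<Rightarrow> 'a rel \<Rightarrow> 'b set \<Rightarrow> 'b rel \<Rightarrow> ('a \<Rightarrow> 'b) \<Rightarrow> bool" where
  "rigid_surj X L Y M f \<longleftrightarrow> f ` X = Y \<and>
     (\<forall>x\<in>Y. \<forall>y\<in>Y. (x, y) \<in> M \<longrightarrow> (rel_min L (fibre X f x), rel_min L (fibre X f y)) \<in> L)"


section \<open>The special anti-lexicographic order\<close>

definition alex :: "'a set \<Rightarrow> 'a rel \<Rightarrow> 'a set rel" where
  "alex A L = {(X, Y). X \<subseteq> A \<and> Y \<subseteq> A \<and>
     (X \<subset> Y \<or> \<not> X \<subseteq> Y \<and> \<not> Y \<subseteq> X \<and> (rel_max L (X - Y), rel_max L (Y - X)) \<in> L)}"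

text \<open>Index sets are \<open>{..<r}\<close> rather than \<open>{1..r}\<close>, to agree with list indexing.\<close>

definition idx_alex :: "nat \<Rightarrow> nat set rel" where
  "idx_alex r = alex {..<r} {(i, j). i < j}"

definition total_quasiorder :: "nat \<Rightarrow> nat rel \<Rightarrow> bool" where
  "total_quasiorder r \<sigma> \<longleftrightarrow> preorder_on {..<r} \<sigma> \<and> total_on {..<r} \<sigma>"

definition qo_classes :: "nat \<Rightarrow> nat rel \<Rightarrow> nat set set" where
  "qo_classes r \<sigma> = {..<r} // (\<sigma> \<inter> \<sigma>\<inverse>)"

definition class_enum :: "nat \<Rightarrow> nat rel \<Rightarrow> nat set list \<Rightarrow> bool" where
  "class_enum r \<sigma> Ss \<longleftrightarrow>
     set Ss = qo_classes r \<sigma> \<and> sorted_wrt (\<lambda>S T. (S, T) \<in> idx_alex r) Ss"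

text \<open>The classes are enumerated by \<open>idx_alex\<close>, not by \<open>\<sigma>\<close> itself, so two different
  quasiorders with the same classes are not comparable.\<close>

definition qo_less :: "nat \<Rightarrow> nat rel rel" where
  "qo_less r = {(\<sigma>, \<tau>). total_quasiorder r \<sigma> \<and> total_quasiorder r \<tau> \<and>
     (\<exists>Ss Ts. class_enum r \<sigma> Ss \<and> class_enum r \<tau> Ts \<and>
        (length Ss < length Ts \<or>
         length Ss = length Ts \<and>
           (\<exists>s<length Ss. (Ss ! s, Ts ! s) \<in> idx_alex r \<and>
              (\<forall>j. s < j \<and> j < length Ss \<longrightarrow> Ss ! j = Ts ! j))))}"

definition tuples :: "'a set \<Rightarrow> nat \<Rightarrow> 'a list set" where
  "tuples A r = {xs. length xs = r \<and> set xs \<subseteq> A}"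

definition tp :: "'a rel \<Rightarrow> 'a list \<Rightarrow> nat rel" where
  "tp L a = {(i, j). i < length a \<and> j < length a \<and> (a ! i = a ! j \<or> (a ! i, a ! j) \<in> L)}"

text \<open>By the remark on \<open>qo_less\<close>, \<open>sal\<close> is a strict partial order, in general not linear.
  On the tuples of a structure this is harmless for the morphisms below: a non-constant tuple
  has all its preimages of its own type, and the constant tuples come first, so every fibre
  still has a least element (lemma \<open>srq_fibre_min\<close>).\<close>

definition sal :: "'a set \<Rightarrow> 'a rel \<Rightarrow> nat \<Rightarrow> 'a list rel" where
  "sal A L r = {(a, b). a \<in> tuples A r \<and> b \<in> tuples A r \<and>
     ((tp L a, tp L b) \<in> qo_less r \<or>
      tp L a = tp L b \<and> set a \<noteq> set b \<and> (set a, set b) \<in> alex A L)}"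


section \<open>Linearly ordered reflexive structures and strong rigid quotient maps\<close>

text \<open>A relational language is a set \<open>\<Theta>\<close> of symbols with an arity function. The linear order is
  a separate component of a structure, so it is never the interpretation of a symbol in \<open>\<Theta>\<close>.\<close>

record ('a, 's) lo_structure =
  universe :: "'a set"
  interp :: "'s \<Rightarrow> 'a list set"
  lin :: "'a rel"

text \<open>Symbols outside \<open>\<Theta>\<close> get the empty interpretation, so that a structure carries no
  information beyond \<open>\<Theta>\<close>.\<close>

definition fin_lo_refl_structure ::
    "'s set \<Rightarrow> ('s \<Rightarrow> nat) \<Rightarrow> ('a, 's) lo_structure \<Rightarrow> bool" where
  "fin_lo_refl_structure \<Theta> ar A \<longleftrightarrow>
     finite (universe A) \<and>
     lin A \<subseteq> universe A \<times> universe A \<and> strict_linear_order_on (universe A) (lin A) \<and>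
     (\<forall>\<theta>\<in>\<Theta>. interp A \<theta> \<subseteq> tuples (universe A) (ar \<theta>) \<and>
        (\<forall>a\<in>universe A. replicate (ar \<theta>) a \<in> interp A \<theta>)) \<and>
     (\<forall>\<theta>. \<theta> \<notin> \<Theta> \<longrightarrow> interp A \<theta> = {})"

definition homomorphism ::
    "'s set \<Rightarrow> ('a, 's) lo_structure \<Rightarrow> ('b, 's) lo_structure \<Rightarrow> ('a \<Rightarrow> 'b) \<Rightarrow> bool" where
  "homomorphism \<Theta> A B f \<longleftrightarrow> f \<in> universe A \<rightarrow>\<^sub>E universe B \<and>
     (\<forall>\<theta>\<in>\<Theta>. \<forall>a\<in>interp A \<theta>. map f a \<in> interp B \<theta>)"

definition strong_rigid_quotient ::
    "'s set \<Rightarrow> ('s \<Rightarrow> nat) \<Rightarrow> ('a, 's) lo_structure \<Rightarrow> ('b, 's) lo_structure \<Rightarrow>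
     ('a \<Rightarrow> 'b) \<Rightarrow> bool" where
  "strong_rigid_quotient \<Theta> ar A B f \<longleftrightarrow>
     homomorphism \<Theta> A B f \<and>
     rigid_surj (universe A) (lin A) (universe B) (lin B) f \<and>
     (\<forall>\<theta>\<in>\<Theta>.
        rigid_surj (interp A \<theta>) (sal (universe A) (lin A) (ar \<theta>))
                   (interp B \<theta>) (sal (universe B) (lin B) (ar \<theta>)) (map f) \<and>
        (\<forall>x\<in>interp A \<theta>. \<not> (\<exists>c. \<forall>u\<in>set x. f u = c) \<longrightarrow>
           (\<forall>i<length x. \<forall>j<length x.
              (x ! i, x ! j) \<in> lin A \<longrightarrow> (f (x ! i), f (x ! j)) \<in> lin B)))"

text \<open>Elements of structures are drawn from a type \<open>'a\<close>; if \<open>'a\<close> is infinite, every finite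
  structure is isomorphic to one of the objects.\<close>

definition Rel_srq ::
    "'s set \<Rightarrow> ('s \<Rightarrow> nat) \<Rightarrow> (('a, 's) lo_structure, 'a \<Rightarrow> 'a) category" where
  "Rel_srq \<Theta> ar =
     \<lparr>Obj = {A. fin_lo_refl_structure \<Theta> ar A},
      Hom = (\<lambda>A B. {f. strong_rigid_quotient \<Theta> ar A B f}),
      Cmp = (\<lambda>A B C g f. compose (universe A) g f),
      Ident = (\<lambda>A. \<lambda>x\<in>universe A. x)\<rparr>"

section \<open>The strong rigid quotient maps form a category\<close>

lemma rel_min_eq:
  assumes "trans L" "irrefl L" "m \<in> S" "\<And>x. x \<in> S \<Longrightarrow> x \<noteq> m \<Longrightarrow> (m, x) \<in> L"
  shows "rel_min L S = m"
  unfolding rel_min_def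
proof (rule the_equality)
  show "m \<in> S \<and> (\<forall>x\<in>S. x \<noteq> m \<longrightarrow> (m, x) \<in> L)" using assms by blast
next
  fix n assume n: "n \<in> S \<and> (\<forall>x\<in>S. x \<noteq> n \<longrightarrow> (n, x) \<in> L)"
  show "n = m"
  proof (rule ccontr)
    assume "n \<noteq> m"
    then have "(n, m) \<in> L" "(m, n) \<in> L" using n assms by auto
    then show False using assms(1,2) by (meson irreflD transD)
  qed
qed

lemma finite_has_min:
  assumes "trans L" "finite S" "S \<noteq> {}"
    and tot: "\<And>x y. x \<in> S \<Longrightarrow> y \<in> S \<Longrightarrow> x \<noteq> y \<Longrightarrow> (x, y) \<in> L \<or> (y, x) \<in> L"
  shows "\<exists>m\<in>S. \<forall>x\<in>S. x \<noteq> m \<longrightarrow> (m, x) \<in> L"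
  using assms(2,3) tot
proof (induction S rule: finite_ne_induct)
  case (singleton x) then show ?case by auto
next
  case (insert x F)
  then obtain m where m: "m \<in> F" "\<forall>y\<in>F. y \<noteq> m \<longrightarrow> (m, y) \<in> L" by (metis insertCI)
  then have "x \<noteq> m" using insert by auto
  then consider "(m, x) \<in> L" | "(x, m) \<in> L" using insert.prems m(1) by blast
  then show ?case
  proof cases
    case 1 then show ?thesis using m by auto
  next
    case 2
    then have "\<forall>y\<in>F. (x, y) \<in> L" using m assms(1) by (metis transD)
    then show ?thesis by auto
  qed
qed

definition fin_chain :: "'a set \<Rightarrow> 'a rel \<Rightarrow> bool" where
  "fin_chain A L \<longleftrightarrow> finite A \<and> L \<subseteq> A \<times> A \<and> strict_linear_order_on A L"

lemma fin_chainD: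
  assumes "fin_chain A L"
  shows "finite A" "L \<subseteq> A \<times> A" "trans L" "irrefl L" "total_on A L"
  using assms by (auto simp: fin_chain_def strict_linear_order_on_def)

lemma fin_chain_min:
  assumes "fin_chain A L" "S \<subseteq> A" "S \<noteq> {}"
  shows "\<exists>m\<in>S. \<forall>x\<in>S. x \<noteq> m \<longrightarrow> (m, x) \<in> L"
  using fin_chainD[OF assms(1)] assms(2,3)
  by (intro finite_has_min) (auto simp: total_on_def finite_subset)

lemma rel_max:
  assumes "fin_chain A L" "S \<subseteq> A" "S \<noteq> {}"
  shows "rel_max L S \<in> S \<and> (\<forall>x\<in>S. x \<noteq> rel_max L S \<longrightarrow> (x, rel_max L S) \<in> L)"
proof -
  have c: "fin_chain A (L\<inverse>)"
    using fin_chainD[OF assms(1)]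
    by (auto simp: fin_chain_def strict_linear_order_on_def total_on_def irrefl_def)
  obtain m where m: "m \<in> S" "\<forall>x\<in>S. x \<noteq> m \<longrightarrow> (m, x) \<in> L\<inverse>"
    using fin_chain_min[OF c assms(2,3)] by blast
  have "rel_max L S = m" unfolding rel_max_def
    using rel_min_eq[OF fin_chainD(3,4)[OF c] m(1)] m(2) by blast
  then show ?thesis using m by auto
qed

lemma alex_iff:
  assumes "fin_chain A L"
  shows "(X, Y) \<in> alex A L \<longleftrightarrow> X \<subseteq> A \<and> Y \<subseteq> A \<and>
    (\<exists>m\<in>Y - X. \<forall>x\<in>A. (m, x) \<in> L \<longrightarrow> (x \<in> X \<longleftrightarrow> x \<in> Y))" (is "?l \<longleftrightarrow> ?r")
proof
  note L = fin_chainD[OF assms]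
  assume l: ?l
  then have sub: "X \<subseteq> A" "Y \<subseteq> A" by (auto simp: alex_def)
  have ne: "Y - X \<noteq> {}" using l by (auto simp: alex_def)
  let ?m = "rel_max L (Y - X)"
  have m: "?m \<in> Y - X" "\<And>x. x \<in> Y - X \<Longrightarrow> x \<noteq> ?m \<Longrightarrow> (x, ?m) \<in> L"
    using rel_max[OF assms _ ne] sub by auto
  have "x \<in> X \<longleftrightarrow> x \<in> Y" if "(?m, x) \<in> L" for x
  proof
    show "x \<in> X" if "x \<in> Y"
      using m that \<open>(?m, x) \<in> L\<close> L(3,4) by (metis DiffI irreflD transD)
    show "x \<in> Y" if "x \<in> X"
    proof (rule ccontr)
      assume "x \<notin> Y"
      then have x: "x \<in> X - Y" using that by auto
      then have lt: "(rel_max L (X - Y), ?m) \<in> L" using l by (auto simp: alex_def)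
      have "x = rel_max L (X - Y) \<or> (x, rel_max L (X - Y)) \<in> L"
        using rel_max[OF assms, of "X - Y"] x sub by blast
      then have "(x, ?m) \<in> L" using lt L(3) by (metis transD)
      then show False using \<open>(?m, x) \<in> L\<close> L(3,4) by (metis irreflD transD)
    qed
  qed
  then show ?r using sub m(1) by blast
next
  note L = fin_chainD[OF assms]
  assume ?r
  then obtain m where sub: "X \<subseteq> A" "Y \<subseteq> A" and m: "m \<in> Y" "m \<notin> X"
    and up: "\<And>x. x \<in> A \<Longrightarrow> (m, x) \<in> L \<Longrightarrow> x \<in> X \<longleftrightarrow> x \<in> Y" by blast
  show ?l
  proof (cases "X \<subseteq> Y")
    case True then show ?thesis using sub m by (auto simp: alex_def)
  next
    case False
    let ?p = "rel_max L (X - Y)" and ?q = "rel_max L (Y - X)"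
    have p: "?p \<in> X - Y" using rel_max[OF assms, of "X - Y"] False sub by blast
    have q: "?q \<in> Y - X" "m = ?q \<or> (m, ?q) \<in> L"
      using rel_max[OF assms, of "Y - X"] m sub by blast+
    have "?p \<noteq> m" "(m, ?p) \<notin> L" using p m up sub by blast+
    then have "(?p, m) \<in> L" using L(5) p m sub unfolding total_on_def by blast
    then have "(?p, ?q) \<in> L" using q(2) L(3) by (metis transD)
    then show ?thesis using False sub m by (auto simp: alex_def)
  qed
qed

lemma irrefl_alex: "fin_chain A L \<Longrightarrow> irrefl (alex A L)"
  by (auto simp: irrefl_def alex_def)

lemma trans_alex:
  assumes "fin_chain A L" shows "trans (alex A L)"
proof (rule transI)
  fix X Y Z assume a: "(X, Y) \<in> alex A L" "(Y, Z) \<in> alex A L"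
  note L = fin_chainD[OF assms]
  obtain m where m: "X \<subseteq> A" "Y \<subseteq> A" "m \<in> Y" "m \<notin> X"
    "\<And>x. x \<in> A \<Longrightarrow> (m, x) \<in> L \<Longrightarrow> x \<in> X \<longleftrightarrow> x \<in> Y"
    using a(1) unfolding alex_iff[OF assms] by blast
  obtain n where n: "Z \<subseteq> A" "n \<in> Z" "n \<notin> Y"
    "\<And>x. x \<in> A \<Longrightarrow> (n, x) \<in> L \<Longrightarrow> x \<in> Y \<longleftrightarrow> x \<in> Z"
    using a(2) unfolding alex_iff[OF assms] by blast
  have mA: "m \<in> A" "n \<in> A" using m n by auto
  have "m \<noteq> n" using m n by auto
  then consider "(m, n) \<in> L" | "(n, m) \<in> L" using L(5) mA unfolding total_on_def by blast
  then show "(X, Z) \<in> alex A L"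
  proof cases
    case 1
    then have "n \<notin> X" using m mA n by blast
    moreover have "x \<in> X \<longleftrightarrow> x \<in> Z" if "x \<in> A" "(n, x) \<in> L" for x
      using that m(5)[of x] n(4)[of x] 1 L(3) by (metis transD)
    ultimately show ?thesis unfolding alex_iff[OF assms] using m n by blast
  next
    case 2
    then have "m \<in> Z" using m mA n by blast
    moreover have "x \<in> X \<longleftrightarrow> x \<in> Z" if "x \<in> A" "(m, x) \<in> L" for x
      using that m(5)[of x] n(4)[of x] 2 L(3) by (metis transD)
    ultimately show ?thesis unfolding alex_iff[OF assms] using m n by blast
  qed
qed

lemma total_alex:
  assumes "fin_chain A L" "X \<subseteq> A" "Y \<subseteq> A" "X \<noteq> Y"
  shows "(X, Y) \<in> alex A L \<or> (Y, X) \<in> alex A L"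
proof (cases "X \<subseteq> Y \<or> Y \<subseteq> X")
  case True then show ?thesis using assms by (auto simp: alex_def)
next
  case False
  let ?p = "rel_max L (X - Y)" and ?q = "rel_max L (Y - X)"
  have p: "?p \<in> X - Y" using rel_max[OF assms(1), of "X - Y"] False assms by blast
  have q: "?q \<in> Y - X" using rel_max[OF assms(1), of "Y - X"] False assms by blast
  have "?p \<in> A" "?q \<in> A" "?p \<noteq> ?q" using p q assms by auto
  then have "(rel_max L (X - Y), rel_max L (Y - X)) \<in> L \<or>
      (rel_max L (Y - X), rel_max L (X - Y)) \<in> L"
    using fin_chainD(5)[OF assms(1)] unfolding total_on_def by blast
  then show ?thesis using False assms by (auto simp: alex_def)
qed

lemma fin_chain_idx: "fin_chain {..<r::nat} {(i, j). i < j \<and> j < r}"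
  by (auto simp: fin_chain_def strict_linear_order_on_def irrefl_def total_on_def intro!: transI)

lemma idx_alex_eq: "idx_alex r = alex {..<r} {(i, j). i < j \<and> j < r}"
proof -
  have eq: "rel_max {(i, j). i < j} S = rel_max {(i, j). i < j \<and> j < r} S" if "S \<subseteq> {..<r}" for S
    unfolding rel_max_def rel_min_def using that
    by (intro arg_cong[where f = The] ext) (auto simp: subset_eq)
  have mem: "rel_max {(i, j). i < j \<and> j < r} S < r" if "S \<subseteq> {..<r}" "S \<noteq> {}" for S
    using rel_max[OF fin_chain_idx that] that by auto
  have "(X, Y) \<in> idx_alex r \<longleftrightarrow> (X, Y) \<in> alex {..<r} {(i, j). i < j \<and> j < r}" for X Y
  proof (cases "X \<subseteq> {..<r} \<and> Y \<subseteq> {..<r}")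
    case True
    then have "X - Y \<subseteq> {..<r}" "Y - X \<subseteq> {..<r}" by auto
    then show ?thesis using True mem[of "Y - X"]
      by (auto simp: idx_alex_def alex_def eq)
  qed (auto simp: idx_alex_def alex_def)
  then show ?thesis by auto
qed

lemma irrefl_idx_alex: "irrefl (idx_alex r)"
  unfolding idx_alex_eq by (rule irrefl_alex[OF fin_chain_idx])

lemma trans_idx_alex: "trans (idx_alex r)"
  unfolding idx_alex_eq by (rule trans_alex[OF fin_chain_idx])

lemma total_idx_alex:
  "X \<subseteq> {..<r} \<Longrightarrow> Y \<subseteq> {..<r} \<Longrightarrow> X \<noteq> Y \<Longrightarrow> (X, Y) \<in> idx_alex r \<or> (Y, X) \<in> idx_alex r"
  unfolding idx_alex_eq by (rule total_alex[OF fin_chain_idx])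

lemma sorted_wrt_unique:
  assumes P: "\<And>x y. P x y \<Longrightarrow> \<not> P y x"
  shows "sorted_wrt P xs \<Longrightarrow> sorted_wrt P ys \<Longrightarrow> set xs = set ys \<Longrightarrow> xs = ys"
proof (induction xs arbitrary: ys)
  case Nil then show ?case by auto
next
  case (Cons x xs)
  then obtain y ys' where ys: "ys = y # ys'" by (cases ys) auto
  have ir: "\<not> P z z" for z using P by blast
  have 1: "\<forall>z\<in>set xs. P x z" "\<forall>z\<in>set ys'. P y z" using Cons.prems ys by auto
  have 2: "x \<in> insert y (set ys')" "y \<in> insert x (set xs)" using Cons.prems ys by auto
  have "x = y"
  proof (rule ccontr)
    assume "x \<noteq> y"
    then have "P y x" "P x y" using 1 2 by auto
    then show False using P by blast
  qed
  moreover have "x \<notin> set xs" "y \<notin> set ys'" using 1 ir by blast+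
  ultimately have "set xs = set ys'" using Cons.prems ys by auto
  then show ?case using Cons ys \<open>x = y\<close> by auto
qed

lemma asym_idx_alex: "(S, T) \<in> idx_alex r \<Longrightarrow> (T, S) \<notin> idx_alex r"
  using irreflD[OF irrefl_idx_alex] transD[OF trans_idx_alex] by blast

lemma class_enum_unique:
  assumes "class_enum r \<sigma> Ss" "class_enum r \<sigma> Ts"
  shows "Ss = Ts"
  using assms unfolding class_enum_def
  by (intro sorted_wrt_unique[where P = "\<lambda>S T. (S, T) \<in> idx_alex r"])
    (auto dest: asym_idx_alex)

lemma class_enum_exists:
  assumes "\<sigma> \<subseteq> {..<r} \<times> {..<r}"
  shows "\<exists>Ss. class_enum r \<sigma> Ss"
proof -
  have ex: "\<exists>Ss. set Ss = K \<and> sorted_wrt (\<lambda>S T. (S, T) \<in> idx_alex r) Ss"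
    if "finite K" "K \<subseteq> Pow {..<r}" for K
    using that
  proof (induction "card K" arbitrary: K)
    case 0 then show ?case by auto
  next
    case (Suc n)
    have "K \<noteq> {}" using Suc.hyps(2) by auto
    have "\<exists>m\<in>K. \<forall>x\<in>K. x \<noteq> m \<longrightarrow> (m, x) \<in> idx_alex r"
    proof (rule finite_has_min[OF trans_idx_alex Suc.prems(1) \<open>K \<noteq> {}\<close>])
      fix X Y assume "X \<in> K" "Y \<in> K" "X \<noteq> Y"
      then show "(X, Y) \<in> idx_alex r \<or> (Y, X) \<in> idx_alex r"
        using Suc.prems(2) by (intro total_idx_alex) auto
    qed
    then obtain m where m: "m \<in> K" "\<forall>x\<in>K. x \<noteq> m \<longrightarrow> (m, x) \<in> idx_alex r" by blast
    have "n = card (K - {m})" using Suc.hyps(2) m by simp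
    then obtain Ss where Ss: "set Ss = K - {m}" "sorted_wrt (\<lambda>S T. (S, T) \<in> idx_alex r) Ss"
      using Suc.hyps(1)[of "K - {m}"] Suc.prems by auto
    then show ?case using m by (intro exI[of _ "m # Ss"]) auto
  qed
  have "finite (qo_classes r \<sigma>)" "qo_classes r \<sigma> \<subseteq> Pow {..<r}"
    using assms unfolding qo_classes_def quotient_def by auto
  then show ?thesis using ex unfolding class_enum_def by blast
qed

lemma class_enum_length:
  assumes "class_enum r \<sigma> Ss" shows "length Ss = card (qo_classes r \<sigma>)"
proof -
  have "sorted_wrt (\<lambda>S T. (S, T) \<in> idx_alex r) xs \<Longrightarrow> distinct xs" for xs
    using asym_idx_alex by (induction xs) auto
  then show ?thesis using assms unfolding class_enum_def by (metis distinct_card)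
qed

lemma irrefl_qo_less: "irrefl (qo_less r)"
  unfolding irrefl_def
proof (intro allI notI)
  fix \<sigma> assume "(\<sigma>, \<sigma>) \<in> qo_less r"
  then obtain Ss Ts where "class_enum r \<sigma> Ss" "class_enum r \<sigma> Ts"
    "length Ss < length Ts \<or> (\<exists>s<length Ss. (Ss ! s, Ts ! s) \<in> idx_alex r)"
    unfolding qo_less_def by blast
  then show False using class_enum_unique[of r \<sigma> Ss Ts] irreflD[OF irrefl_idx_alex] by auto
qed

lemma trans_qo_less: "trans (qo_less r)"
proof (rule transI)
  fix \<sigma> \<tau> \<upsilon> assume a: "(\<sigma>, \<tau>) \<in> qo_less r" "(\<tau>, \<upsilon>) \<in> qo_less r"
  define P where "P Ss Ts s \<longleftrightarrow> s < length Ss \<and> length Ss = length Ts \<and> (Ss ! s, Ts ! s) \<in> idx_alex r \<and>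
    (\<forall>j. s < j \<and> j < length Ss \<longrightarrow> Ss ! j = Ts ! j)" for Ss Ts and s
  have iff: "(\<alpha>, \<beta>) \<in> qo_less r \<longleftrightarrow> total_quasiorder r \<alpha> \<and> total_quasiorder r \<beta> \<and>
     (\<exists>Ss Ts. class_enum r \<alpha> Ss \<and> class_enum r \<beta> Ts \<and> (length Ss < length Ts \<or> (\<exists>s. P Ss Ts s)))"
    for \<alpha> \<beta> unfolding qo_less_def P_def by auto
  obtain Ss Ts where 1: "class_enum r \<sigma> Ss" "class_enum r \<tau> Ts"
    "length Ss < length Ts \<or> (\<exists>s. P Ss Ts s)" using a(1) unfolding iff by blast
  obtain Ts' Us where 2: "class_enum r \<tau> Ts'" "class_enum r \<upsilon> Us"
    "length Ts' < length Us \<or> (\<exists>s. P Ts' Us s)" using a(2) unfolding iff by blast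
  have eq: "Ts' = Ts" using class_enum_unique 1 2 by blast
  have "length Ss < length Us \<or> (\<exists>s. P Ss Us s)"
  proof (cases "length Ss < length Ts \<or> length Ts < length Us")
    case True
    then show ?thesis using 1(3) 2(3) unfolding eq P_def by auto
  next
    case False
    then obtain s t where st: "P Ss Ts s" "P Ts Us t" using 1(3) 2(3) unfolding eq by blast
    consider "s < t" | "s = t" | "t < s" by linarith
    then have "P Ss Us (max s t)"
    proof cases
      case 1 then show ?thesis using st unfolding P_def by (auto simp: max_def)
    next
      case 2
      then show ?thesis using st transD[OF trans_idx_alex, of "Ss ! s" "Ts ! s" r "Us ! s"]
        unfolding P_def by (auto simp: max_def)
    next
      case 3 then show ?thesis using st unfolding P_def by (auto simp: max_def)
    qed
    then show ?thesis by blast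
  qed
  then show "(\<sigma>, \<upsilon>) \<in> qo_less r" using a 1 2 unfolding iff by blast
qed

lemma trans_sal: "fin_chain A L \<Longrightarrow> trans (sal A L r)"
proof (rule transI)
  fix a b c assume L: "fin_chain A L" and ab: "(a, b) \<in> sal A L r" "(b, c) \<in> sal A L r"
  show "(a, c) \<in> sal A L r"
  proof (cases "tp L a = tp L b \<and> tp L b = tp L c")
    case True
    then have "(set a, set c) \<in> alex A L"
      using ab transD[OF trans_alex[OF L]] irreflD[OF irrefl_qo_less] unfolding sal_def by auto
    then show ?thesis using ab True irreflD[OF irrefl_alex[OF L]] unfolding sal_def by auto
  next
    case False
    then have "(tp L a, tp L c) \<in> qo_less r"
      using ab transD[OF trans_qo_less] unfolding sal_def by auto
    then show ?thesis using ab unfolding sal_def by auto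
  qed
qed

lemma irrefl_sal: "irrefl (sal A L r)"
  using irreflD[OF irrefl_qo_less] by (auto simp: irrefl_def sal_def)

lemma total_quasiorder_tp:
  assumes "fin_chain A L" "a \<in> tuples A r"
  shows "total_quasiorder r (tp L a)"
proof -
  note L = fin_chainD[OF assms(1)]
  have [simp]: "length a = r" and A: "\<And>i. i < r \<Longrightarrow> a ! i \<in> A" using assms(2) by (auto simp: tuples_def)
  have "trans (tp L a)"
    using transD[OF L(3)] by (auto simp: tp_def intro!: transI)
  then show ?thesis using L(5) A
    by (auto simp: total_quasiorder_def preorder_on_def refl_on_def tp_def total_on_def)
qed

lemma qo_less_card:
  assumes "total_quasiorder r \<sigma>" "total_quasiorder r \<tau>"
    "card (qo_classes r \<sigma>) < card (qo_classes r \<tau>)"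
  shows "(\<sigma>, \<tau>) \<in> qo_less r"
proof -
  have "\<sigma> \<subseteq> {..<r} \<times> {..<r}" "\<tau> \<subseteq> {..<r} \<times> {..<r}"
    using assms by (auto simp: total_quasiorder_def preorder_on_def)
  then obtain Ss Ts where st: "class_enum r \<sigma> Ss" "class_enum r \<tau> Ts"
    using class_enum_exists by meson
  then have "length Ss < length Ts" using assms(3) class_enum_length by metis
  then show ?thesis using st assms unfolding qo_less_def by blast
qed

lemma sal_const_less:
  assumes L: "fin_chain A L" and b: "b \<in> tuples A r" and c: "c \<in> A" and n: "\<not> (\<exists>d. set b \<subseteq> {d})"
  shows "(replicate r c, b) \<in> sal A L r"
proof -
  have [simp]: "length b = r" using b by (auto simp: tuples_def)
  have "b \<noteq> []" using n by auto
  then have r: "0 < r" using \<open>length b = r\<close> length_greater_0_conv by blast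
  have ct: "replicate r c \<in> tuples A r" using c by (auto simp: tuples_def)
  have full: "tp L (replicate r c) = {..<r} \<times> {..<r}" by (auto simp: tp_def)
  have "qo_classes r (tp L (replicate r c)) = {{..<r}}"
    unfolding qo_classes_def full quotient_def using r by auto
  then have one: "card (qo_classes r (tp L (replicate r c))) = 1" by simp
  obtain j where j: "j < r" "b ! j \<noteq> b ! 0"
  proof -
    obtain y where "y \<in> set b" "y \<noteq> b ! 0" using n by blast
    then show ?thesis using that by (auto simp: in_set_conv_nth)
  qed
  let ?E = "tp L b \<inter> (tp L b)\<inverse>"
  have E: "(0, 0) \<in> ?E" "(j, 0) \<notin> ?E"
    using j r transD[OF fin_chainD(3)[OF L], of "b ! j" "b ! 0" "b ! j"] irreflD[OF fin_chainD(4)[OF L]]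
    by (auto simp: tp_def)
  have cl: "?E `` {0} \<in> qo_classes r (tp L b)" "?E `` {j} \<in> qo_classes r (tp L b)"
    unfolding qo_classes_def using r j by (auto intro!: quotientI)
  have "0 \<in> ?E `` {0}" "0 \<notin> ?E `` {j}" using E by auto
  then have ne: "?E `` {0} \<noteq> ?E `` {j}" by metis
  have "finite (qo_classes r (tp L b))" unfolding qo_classes_def quotient_def by auto
  then have "card {?E `` {0}, ?E `` {j}} \<le> card (qo_classes r (tp L b))"
    using cl by (intro card_mono) auto
  then have "1 < card (qo_classes r (tp L b))" using ne by simp
  then have "(tp L (replicate r c), tp L b) \<in> qo_less r"
    using one total_quasiorder_tp[OF L] ct b by (intro qo_less_card) auto
  then show ?thesis using ct b unfolding sal_def by auto
qed

lemma tp_set_inj: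
  assumes L: "fin_chain A L" and ab: "a \<in> tuples A r" "b \<in> tuples A r"
    and eq: "tp L a = tp L b" "set a = set b"
  shows "a = b"
proof (rule ccontr)
  note c = fin_chainD[OF L]
  have len: "length a = r" "length b = r" and sub: "set a \<subseteq> A" using ab by (auto simp: tuples_def)
  assume "a \<noteq> b"
  then obtain k where k: "k < r" "a ! k \<noteq> b ! k" using len by (auto simp: list_eq_iff_nth_eq)
  have less: "(a ! i, a ! j) \<in> L \<longleftrightarrow> (b ! i, b ! j) \<in> L" if "i < r" "j < r" for i j
  proof -
    have "(u ! i, u ! j) \<in> L \<longleftrightarrow> (j, i) \<notin> tp L u" if u: "u \<in> tuples A r" for u
    proof -
      note [simp] = \<open>i < r\<close> \<open>j < r\<close>
      have "length u = r" "u ! i \<in> A" "u ! j \<in> A"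
        using u by (simp_all add: tuples_def subset_eq)
      then have "(u ! i, u ! j) \<in> L \<longleftrightarrow> \<not> (u ! j = u ! i \<or> (u ! j, u ! i) \<in> L)"
      proof -
        have "u ! i = u ! j \<or> (u ! i, u ! j) \<in> L \<or> (u ! j, u ! i) \<in> L"
          using c(5) \<open>u ! i \<in> A\<close> \<open>u ! j \<in> A\<close> unfolding total_on_def by blast
        moreover have "(u ! i, u ! j) \<in> L \<Longrightarrow> (u ! j, u ! i) \<notin> L" "(u ! i, u ! i) \<notin> L"
          using irreflD[OF c(4)] transD[OF c(3), of "u ! i" "u ! j" "u ! i"] by auto
        ultimately show ?thesis by metis
      qed
      with \<open>length u = r\<close> show ?thesis using \<open>i < r\<close> \<open>j < r\<close> \<open>length u = r\<close> unfolding tp_def by blast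
    qed
    then have "(a ! i, a ! j) \<in> L \<longleftrightarrow> (j, i) \<notin> tp L a"
      "(b ! i, b ! j) \<in> L \<longleftrightarrow> (j, i) \<notin> tp L b" using ab by blast+
    then show ?thesis using eq by simp
  qed
  define D where "D = (\<lambda>i. a ! i) ` {i. i < r \<and> a ! i \<noteq> b ! i} \<union> (\<lambda>i. b ! i) ` {i. i < r \<and> a ! i \<noteq> b ! i}"
  have D: "a ! i \<in> D" "b ! i \<in> D" if "i < r" "a ! i \<noteq> b ! i" for i using that by (auto simp: D_def)
  have Dset: "D \<subseteq> set a" 
  proof -
    have "a ! i \<in> set a" "b ! i \<in> set a" if "i < r" for i
      using that len nth_mem[of i a] nth_mem[of i b] eq(2) by simp_all
    then show ?thesis unfolding D_def by blast
  qed
  have "D \<noteq> {}" using D k by blast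
  moreover have "D \<subseteq> A" using sub Dset by auto
  ultimately obtain x where x: "x \<in> D" and min: "\<And>y. y \<in> D \<Longrightarrow> y \<noteq> x \<Longrightarrow> (x, y) \<in> L"
    using fin_chain_min[OF L, of D] by blast
  have step: False if len': "length u = r" "length v = r" and e: "set v = set a"
    and l: "\<And>i j. i < r \<Longrightarrow> j < r \<Longrightarrow> (u ! i, u ! j) \<in> L \<longleftrightarrow> (v ! i, v ! j) \<in> L"
    and D: "\<And>i. i < r \<Longrightarrow> u ! i \<noteq> v ! i \<Longrightarrow> u ! i \<in> D \<and> v ! i \<in> D"
    and i: "i < r" "u ! i \<noteq> v ! i" "u ! i = x" for u v i
  proof -
    have lt: "(x, v ! i) \<in> L" using min[of "v ! i"] D[of i] i by blast
    have "x \<in> set v" using x e Dset by blast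
    then obtain j where j: "j < r" "v ! j = x" using len' by (metis in_set_conv_nth)
    have "(v ! j, v ! i) \<in> L" using lt j by simp
    then have "(u ! j, u ! i) \<in> L" using l[OF j(1) i(1)] by blast
    then have ux: "(u ! j, x) \<in> L" unfolding i(3) .
    then have ne: "u ! j \<noteq> x" using irreflD[OF c(4)] by blast
    then have "u ! j \<in> D" using D[OF j(1)] j(2) by blast
    then have "(x, u ! j) \<in> L" using min ne by blast
    then show False using ux transD[OF c(3)] irreflD[OF c(4)] by blast
  qed
  obtain i where i: "i < r" "a ! i \<noteq> b ! i" "a ! i = x \<or> b ! i = x" using x by (auto simp: D_def)
  from i(3) show False
  proof
    assume "a ! i = x"
    with step[of a b i] show False using len eq(2) less D i(1,2) by blast
  next
    assume "b ! i = x"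
    then show False
      using step[of b a i, OF len(2,1) refl less[symmetric] _ i(1) i(2)[symmetric]] D by metis
  qed
qed

lemma fin_chain_lin:
  "fin_lo_refl_structure \<Theta> ar A \<Longrightarrow> fin_chain (universe A) (lin A)"
  by (simp add: fin_lo_refl_structure_def fin_chain_def)

lemma interp_tuples:
  "fin_lo_refl_structure \<Theta> ar A \<Longrightarrow> \<theta> \<in> \<Theta> \<Longrightarrow> interp A \<theta> \<subseteq> tuples (universe A) (ar \<theta>)"
  by (simp add: fin_lo_refl_structure_def)

lemma srq_tp:
  assumes A: "fin_lo_refl_structure \<Theta> ar A" and B: "fin_lo_refl_structure \<Theta> ar B"
    and f: "strong_rigid_quotient \<Theta> ar A B f" and "\<theta> \<in> \<Theta>" "a \<in> interp A \<theta>"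
    and nc: "\<not> (\<exists>d. set (map f a) \<subseteq> {d})"
  shows "tp (lin A) a = tp (lin B) (map f a)"
proof -
  have mem: "\<And>i. i < length a \<Longrightarrow> a ! i \<in> universe A"
    using interp_tuples[OF A \<open>\<theta> \<in> \<Theta>\<close>] assms(5) by (auto simp: tuples_def subset_eq)
  have imp: "(a ! i, a ! j) \<in> lin A \<Longrightarrow> (f (a ! i), f (a ! j)) \<in> lin B"
    if "i < length a" "j < length a" for i j
  proof -
    have "\<not> (\<exists>c. \<forall>u\<in>set a. f u = c)" using nc by (metis imageE image_set singletonI subsetI)
    then show "(a ! i, a ! j) \<in> lin A \<Longrightarrow> ?thesis"
      using f assms(4,5) that unfolding strong_rigid_quotient_def by blast
  qed
  note cA = fin_chainD[OF fin_chain_lin[OF A]] and cB = fin_chainD[OF fin_chain_lin[OF B]]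
  have "(a ! i = a ! j \<or> (a ! i, a ! j) \<in> lin A) \<longleftrightarrow>
        (f (a ! i) = f (a ! j) \<or> (f (a ! i), f (a ! j)) \<in> lin B)"
    if ij: "i < length a" "j < length a" for i j
  proof
    assume "a ! i = a ! j \<or> (a ! i, a ! j) \<in> lin A"
    then show "f (a ! i) = f (a ! j) \<or> (f (a ! i), f (a ! j)) \<in> lin B" using imp[OF ij] by auto
  next
    assume r: "f (a ! i) = f (a ! j) \<or> (f (a ! i), f (a ! j)) \<in> lin B"
    show "a ! i = a ! j \<or> (a ! i, a ! j) \<in> lin A"
    proof (rule ccontr)
      assume "\<not> ?thesis"
      then have "(a ! j, a ! i) \<in> lin A" using cA(5) mem ij unfolding total_on_def by blast
      then have "(f (a ! j), f (a ! i)) \<in> lin B" using imp ij by blast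
      then show False using r transD[OF cB(3)] irreflD[OF cB(4)] by metis
    qed
  qed
  then have "(i, j) \<in> tp (lin A) a \<longleftrightarrow> (i, j) \<in> tp (lin B) (map f a)" for i j
    by (simp add: tp_def cong: conj_cong)
  then show ?thesis by auto
qed

lemma fibre_min:
  assumes "fin_chain X L" "f ` X = Y" "y \<in> Y"
  shows "\<exists>m\<in>fibre X f y. \<forall>x\<in>fibre X f y. x \<noteq> m \<longrightarrow> (m, x) \<in> L"
  using assms by (intro fin_chain_min) (auto simp: fibre_def)

lemma srq_fibre_min:
  assumes A: "fin_lo_refl_structure \<Theta> ar A" and B: "fin_lo_refl_structure \<Theta> ar B"
    and f: "strong_rigid_quotient \<Theta> ar A B f" and t: "\<theta> \<in> \<Theta>" and b: "b \<in> interp B \<theta>"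
  shows "\<exists>m\<in>fibre (interp A \<theta>) (map f) b. \<forall>x\<in>fibre (interp A \<theta>) (map f) b.
    x \<noteq> m \<longrightarrow> (m, x) \<in> sal (universe A) (lin A) (ar \<theta>)" (is "\<exists>m\<in>?S. \<forall>x\<in>?S. _ \<longrightarrow> _ \<in> ?L")
proof -
  note cA = fin_chain_lin[OF A]
  let ?r = "ar \<theta>"
  have SA: "?S \<subseteq> tuples (universe A) ?r" using interp_tuples[OF A t] unfolding fibre_def by blast
  have bt: "b \<in> tuples (universe B) ?r" using interp_tuples[OF B t] b by auto
  have im: "map f ` interp A \<theta> = interp B \<theta>" and im1: "f ` universe A = universe B"
    using f t unfolding strong_rigid_quotient_def rigid_surj_def by auto
  have "b \<in> map f ` interp A \<theta>" unfolding im by (rule b)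
  then have ne: "?S \<noteq> {}" unfolding fibre_def by blast
  show ?thesis
  proof (cases "\<exists>d. set b \<subseteq> {d}")
    case False
    have tpS: "tp (lin A) x = tp (lin B) b" if "x \<in> ?S" for x
      using srq_tp[OF A B f t, of x] that False unfolding fibre_def by auto
    have "finite (tuples (universe A) ?r)"
      using finite_lists_length_eq[OF fin_chainD(1)[OF cA], of ?r] unfolding tuples_def
      by (simp add: conj_commute)
    then have "finite ?S" using SA finite_subset by blast
    then show ?thesis
    proof (rule finite_has_min[OF trans_sal[OF cA] _ ne])
      fix x y assume xy: "x \<in> ?S" "y \<in> ?S" "x \<noteq> y"
      have tp: "tp (lin A) x = tp (lin A) y" using tpS xy by simp
      have "set x \<noteq> set y" using tp_set_inj[OF cA _ _ tp] xy SA by blast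
      moreover have "set x \<subseteq> universe A" "set y \<subseteq> universe A" using xy SA by (auto simp: tuples_def)
      ultimately show "(x, y) \<in> ?L \<or> (y, x) \<in> ?L"
        using total_alex[OF cA, of "set x" "set y"] tp xy SA unfolding sal_def by auto
    qed
  next
    case True
    show ?thesis
    proof (cases "?r = 0")
      case True
      then have "?S \<subseteq> {[]}" using SA by (auto simp: tuples_def)
      then show ?thesis using ne by blast
    next
      case r: False
      obtain d where d: "b = replicate ?r d" "d \<in> universe B"
      proof -
        obtain d where "set b \<subseteq> {d}" using True by blast
        moreover have "length b = ?r" using bt by (simp add: tuples_def)
        ultimately have "b = replicate ?r d" by (intro replicate_eqI) auto
        moreover have "d \<in> set (replicate ?r d)" using r by simp
        then have "d \<in> set b" using calculation by simp
        then have "d \<in> universe B" using bt unfolding tuples_def by blast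
        ultimately show ?thesis using that by blast
      qed
      obtain c where c: "c \<in> fibre (universe A) f d"
        "\<And>x. x \<in> fibre (universe A) f d \<Longrightarrow> x \<noteq> c \<Longrightarrow> (c, x) \<in> lin A"
        using fibre_min[OF cA im1 d(2)] by blast
      let ?m = "replicate ?r c"
      have cU: "c \<in> universe A" "f c = d" using c by (auto simp: fibre_def)
      have mS: "?m \<in> ?S" using A t cU d unfolding fin_lo_refl_structure_def fibre_def by auto
      have "(?m, x) \<in> ?L" if x: "x \<in> ?S" "x \<noteq> ?m" for x
      proof (cases "\<exists>e. set x \<subseteq> {e}")
        case False
        then show ?thesis using sal_const_less[OF cA _ cU(1)] x SA by blast
      next
        case True
        then obtain e where e: "set x \<subseteq> {e}" by blast
        have lx: "length x = ?r" using x SA by (auto simp: tuples_def)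
        have xe: "x = replicate ?r e" using e lx by (intro replicate_eqI) auto
        have "set x = set (replicate ?r e)" using xe by (rule arg_cong)
        then have "set x = {e}" using r by simp
        then have "e \<in> universe A" using x(1) SA by (auto simp: tuples_def)
        moreover have "f e = d"
        proof -
          have "map f x = b" using x(1) by (simp add: fibre_def)
          then have "replicate ?r (f e) = replicate ?r d" unfolding xe using d(1) by simp
          then show ?thesis using r by simp
        qed
        moreover have ne: "c \<noteq> e" using x(2) xe by blast
        ultimately have ce: "(c, e) \<in> lin A" "c \<noteq> e" using c(2)[of e] by (simp_all add: fibre_def)
        have nce: "(e, c) \<notin> lin A" "(e, e) \<notin> lin A"
          using ce(1) transD[OF fin_chainD(3)[OF cA]] irreflD[OF fin_chainD(4)[OF cA]] by blast+
        have "set (replicate ?r e) = {e}" using r by simp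
        then have s: "set ?m = {c}" "set x = {e}" using r xe by simp_all
        have al: "({c}, {e}) \<in> alex (universe A) (lin A)"
          unfolding alex_iff[OF cA] using cU(1) \<open>e \<in> universe A\<close> ce(2) nce by blast
        have "tp (lin A) ?m = tp (lin A) x" unfolding xe by (auto simp: tp_def)
        moreover have "?m \<in> tuples (universe A) ?r" "x \<in> tuples (universe A) ?r" using mS x(1) SA by blast+
        ultimately show ?thesis using ce(2) al s unfolding sal_def by simp
      qed
      then show ?thesis using mS by blast
    qed
  qed
qed

lemma rigid_surj_cong:
  assumes "\<And>x. x \<in> X \<Longrightarrow> f x = g x"
  shows "rigid_surj X L Y M f \<longleftrightarrow> rigid_surj X L Y M g"
proof -
  have "fibre X f y = fibre X g y" for y using assms by (auto simp: fibre_def)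
  moreover have "f ` X = g ` X" using assms by auto
  ultimately show ?thesis unfolding rigid_surj_def by simp
qed

lemma rigid_surj_id:
  assumes "trans L" "irrefl L"
  shows "rigid_surj X L X L (\<lambda>x. x)"
proof -
  have "rel_min L (fibre X (\<lambda>x. x) y) = y" if "y \<in> X" for y
    using that by (intro rel_min_eq[OF assms]) (auto simp: fibre_def)
  then show ?thesis by (auto simp: rigid_surj_def)
qed

lemma rigid_surj_comp:
  assumes L: "trans L" "irrefl L" and M: "trans M" "irrefl M"
    and f: "rigid_surj X L Y M f" and g: "rigid_surj Y M Z N g"
    and minf: "\<And>y. y \<in> Y \<Longrightarrow> \<exists>m\<in>fibre X f y. \<forall>x\<in>fibre X f y. x \<noteq> m \<longrightarrow> (m, x) \<in> L"
    and ming: "\<And>z. z \<in> Z \<Longrightarrow> \<exists>m\<in>fibre Y g z. \<forall>x\<in>fibre Y g z. x \<noteq> m \<longrightarrow> (m, x) \<in> M"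
  shows "rigid_surj X L Z N (\<lambda>x. g (f x))"
proof -
  have fX: "f ` X = Y" and gY: "g ` Y = Z" using f g by (auto simp: rigid_surj_def)
  have F: "rel_min L (fibre X f y) \<in> fibre X f y"
    "\<And>x. x \<in> fibre X f y \<Longrightarrow> x \<noteq> rel_min L (fibre X f y) \<Longrightarrow> (rel_min L (fibre X f y), x) \<in> L"
    if y: "y \<in> Y" for y
  proof -
    obtain m where m: "m \<in> fibre X f y" "\<forall>x\<in>fibre X f y. x \<noteq> m \<longrightarrow> (m, x) \<in> L" using minf[OF y] by blast
    then have "rel_min L (fibre X f y) = m" using rel_min_eq[OF L] by blast
    then show "rel_min L (fibre X f y) \<in> fibre X f y"
    "\<And>x. x \<in> fibre X f y \<Longrightarrow> x \<noteq> rel_min L (fibre X f y) \<Longrightarrow> (rel_min L (fibre X f y), x) \<in> L"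
      using m by auto
  qed
  have G: "rel_min M (fibre Y g z) \<in> fibre Y g z"
    "\<And>x. x \<in> fibre Y g z \<Longrightarrow> x \<noteq> rel_min M (fibre Y g z) \<Longrightarrow> (rel_min M (fibre Y g z), x) \<in> M"
    if z: "z \<in> Z" for z
  proof -
    obtain m where m: "m \<in> fibre Y g z" "\<forall>x\<in>fibre Y g z. x \<noteq> m \<longrightarrow> (m, x) \<in> M" using ming[OF z] by blast
    then have "rel_min M (fibre Y g z) = m" using rel_min_eq[OF M] by blast
    then show "rel_min M (fibre Y g z) \<in> fibre Y g z"
    "\<And>x. x \<in> fibre Y g z \<Longrightarrow> x \<noteq> rel_min M (fibre Y g z) \<Longrightarrow> (rel_min M (fibre Y g z), x) \<in> M"
      using m by auto
  qed
  have eq: "rel_min L (fibre X (\<lambda>x. g (f x)) z) = rel_min L (fibre X f (rel_min M (fibre Y g z)))"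
    if z: "z \<in> Z" for z
  proof (rule rel_min_eq[OF L])
    let ?n = "rel_min M (fibre Y g z)"
    let ?m = "rel_min L (fibre X f ?n)"
    have n: "?n \<in> Y" "g ?n = z" using G(1)[OF z] by (auto simp: fibre_def)
    show "?m \<in> fibre X (\<lambda>x. g (f x)) z" using F(1)[OF n(1)] n by (auto simp: fibre_def)
    fix x assume x: "x \<in> fibre X (\<lambda>x. g (f x)) z" "x \<noteq> ?m"
    have fx: "f x \<in> fibre Y g z" "f x \<in> Y" and x': "x \<in> fibre X f (f x)"
      using x fX by (auto simp: fibre_def)
    show "(?m, x) \<in> L"
    proof (cases "f x = ?n")
      case True then show ?thesis using F(2)[OF n(1)] x x' by simp
    next
      case False
      then have "(?n, f x) \<in> M" using G(2)[OF z fx(1)] by simp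
      then have "(?m, rel_min L (fibre X f (f x))) \<in> L" using f n fx unfolding rigid_surj_def by blast
      then show ?thesis using F(2)[OF fx(2) x'] transD[OF L(1)] by metis
    qed
  qed
  show ?thesis unfolding rigid_surj_def
  proof (intro conjI ballI impI)
    show "(\<lambda>x. g (f x)) ` X = Z" using fX gY by auto
    fix x y assume xy: "x \<in> Z" "y \<in> Z" "(x, y) \<in> N"
    then have "(rel_min M (fibre Y g x), rel_min M (fibre Y g y)) \<in> M"
      using g unfolding rigid_surj_def by blast
    moreover have "rel_min M (fibre Y g x) \<in> Y" "rel_min M (fibre Y g y) \<in> Y"
      using G(1) xy by (auto simp: fibre_def)
    ultimately show "(rel_min L (fibre X (\<lambda>x. g (f x)) x), rel_min L (fibre X (\<lambda>x. g (f x)) y)) \<in> L"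
      using f unfolding rigid_surj_def eq[OF xy(1)] eq[OF xy(2)] by blast
  qed
qed

lemma srq_ident:
  assumes A: "fin_lo_refl_structure \<Theta> ar A"
  shows "strong_rigid_quotient \<Theta> ar A A (\<lambda>x\<in>universe A. x)"
proof -
  note c = fin_chain_lin[OF A]
  have m: "map (\<lambda>x\<in>universe A. x) a = a" if "\<theta> \<in> \<Theta>" "a \<in> interp A \<theta>" for \<theta> a
    using interp_tuples[OF A that(1)] that(2) by (auto simp: tuples_def subset_eq intro!: map_idI)
  have "rigid_surj (universe A) (lin A) (universe A) (lin A) (\<lambda>x\<in>universe A. x)"
    using rigid_surj_id[OF fin_chainD(3,4)[OF c]] by (subst rigid_surj_cong[where g = "\<lambda>x. x"]) auto
  moreover have "rigid_surj (interp A \<theta>) (sal (universe A) (lin A) (ar \<theta>))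
      (interp A \<theta>) (sal (universe A) (lin A) (ar \<theta>)) (map (\<lambda>x\<in>universe A. x))" if "\<theta> \<in> \<Theta>" for \<theta>
    using rigid_surj_id[OF trans_sal[OF c] irrefl_sal] m[OF that]
    by (subst rigid_surj_cong[where g = "\<lambda>x. x"]) auto
  moreover have "homomorphism \<Theta> A A (\<lambda>x\<in>universe A. x)"
    using m by (auto simp: homomorphism_def)
  moreover have "((\<lambda>x\<in>universe A. x) u, (\<lambda>x\<in>universe A. x) v) \<in> lin A" if "(u, v) \<in> lin A" for u v
    using that fin_chainD(2)[OF c] by auto
  ultimately show ?thesis unfolding strong_rigid_quotient_def by blast
qed

lemma srq_compose:
  assumes A: "fin_lo_refl_structure \<Theta> ar A" and B: "fin_lo_refl_structure \<Theta> ar B"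
    and C: "fin_lo_refl_structure \<Theta> ar C"
    and f: "strong_rigid_quotient \<Theta> ar A B f" and g: "strong_rigid_quotient \<Theta> ar B C g"
  shows "strong_rigid_quotient \<Theta> ar A C (compose (universe A) g f)"
proof -
  let ?h = "compose (universe A) g f"
  note cA = fin_chain_lin[OF A] and cB = fin_chain_lin[OF B]
  have hf: "f \<in> universe A \<rightarrow>\<^sub>E universe B" "\<And>\<theta> a. \<theta> \<in> \<Theta> \<Longrightarrow> a \<in> interp A \<theta> \<Longrightarrow> map f a \<in> interp B \<theta>"
    and hg: "g \<in> universe B \<rightarrow>\<^sub>E universe C" "\<And>\<theta> a. \<theta> \<in> \<Theta> \<Longrightarrow> a \<in> interp B \<theta> \<Longrightarrow> map g a \<in> interp C \<theta>"
    using f g by (auto simp: strong_rigid_quotient_def homomorphism_def)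
  have rf: "rigid_surj (universe A) (lin A) (universe B) (lin B) f"
    "\<And>\<theta>. \<theta> \<in> \<Theta> \<Longrightarrow> rigid_surj (interp A \<theta>) (sal (universe A) (lin A) (ar \<theta>))
                   (interp B \<theta>) (sal (universe B) (lin B) (ar \<theta>)) (map f)"
    and rg: "rigid_surj (universe B) (lin B) (universe C) (lin C) g"
    "\<And>\<theta>. \<theta> \<in> \<Theta> \<Longrightarrow> rigid_surj (interp B \<theta>) (sal (universe B) (lin B) (ar \<theta>))
                   (interp C \<theta>) (sal (universe C) (lin C) (ar \<theta>)) (map g)"
    using f g by (auto simp: strong_rigid_quotient_def)
  have el: "?h u = g (f u)" if "u \<in> universe A" for u using that by (simp add: compose_def)
  have sub: "set a \<subseteq> universe A" if "\<theta> \<in> \<Theta>" "a \<in> interp A \<theta>" for \<theta> a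
    using interp_tuples[OF A that(1)] that(2) by (auto simp: tuples_def)
  have m: "map ?h a = map g (map f a)" if "\<theta> \<in> \<Theta>" "a \<in> interp A \<theta>" for \<theta> a
    using el sub[OF that] by auto
  have "homomorphism \<Theta> A C ?h" unfolding homomorphism_def
  proof (intro conjI ballI)
    show "?h \<in> universe A \<rightarrow>\<^sub>E universe C" using hf(1) hg(1) by (auto simp: compose_def)
    show "map ?h a \<in> interp C \<theta>" if "\<theta> \<in> \<Theta>" "a \<in> interp A \<theta>" for \<theta> a
      unfolding m[OF that] using that hf(2) hg(2) by blast
  qed
  moreover have "rigid_surj (universe A) (lin A) (universe C) (lin C) (\<lambda>u. g (f u))"
    using fibre_min[OF cA] fibre_min[OF cB] rf(1) rg(1)
    by (intro rigid_surj_comp[OF fin_chainD(3,4)[OF cA] fin_chainD(3,4)[OF cB] rf(1) rg(1)])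
      (auto simp: rigid_surj_def)
  then have "rigid_surj (universe A) (lin A) (universe C) (lin C) ?h"
    using rigid_surj_cong[of "universe A" ?h "\<lambda>u. g (f u)"] el by blast
  moreover have "rigid_surj (interp A \<theta>) (sal (universe A) (lin A) (ar \<theta>))
      (interp C \<theta>) (sal (universe C) (lin C) (ar \<theta>)) (map ?h)" if t: "\<theta> \<in> \<Theta>" for \<theta>
  proof -
    have "rigid_surj (interp A \<theta>) (sal (universe A) (lin A) (ar \<theta>))
      (interp C \<theta>) (sal (universe C) (lin C) (ar \<theta>)) (\<lambda>a. map g (map f a))"
      using srq_fibre_min[OF A B f t] srq_fibre_min[OF B C g t]
      by (intro rigid_surj_comp[OF trans_sal[OF cA] irrefl_sal trans_sal[OF cB] irrefl_sal
            rf(2)[OF t] rg(2)[OF t]])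
    then show ?thesis
      using rigid_surj_cong[of "interp A \<theta>" "map ?h" "\<lambda>a. map g (map f a)"] m[OF t] by blast
  qed
  moreover have "(?h (x ! i), ?h (x ! j)) \<in> lin C"
    if t: "\<theta> \<in> \<Theta>" and x: "x \<in> interp A \<theta>" and n: "\<not> (\<exists>c. \<forall>u\<in>set x. ?h u = c)"
      and i: "i < length x" and j: "j < length x" and l: "(x ! i, x ! j) \<in> lin A" for \<theta> x i j
  proof -
    have n2: "\<not> (\<exists>c. \<forall>u\<in>set x. g (f u) = c)" using n el sub[OF t x] by (metis subsetD)
    then have n1: "\<not> (\<exists>c. \<forall>u\<in>set x. f u = c)" by metis
    have n3: "\<not> (\<exists>c. \<forall>v\<in>set (map f x). g v = c)" using n2 by simp
    have "(f (x ! i), f (x ! j)) \<in> lin B"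
      using f t x n1 i j l unfolding strong_rigid_quotient_def by blast
    then have "(map f x ! i, map f x ! j) \<in> lin B" "i < length (map f x)" "j < length (map f x)"
      using i j by auto
    then have "(g (map f x ! i), g (map f x ! j)) \<in> lin C"
      using g t hf(2)[OF t x] n3 unfolding strong_rigid_quotient_def by blast
    then show ?thesis using el sub[OF t x] i j by (auto simp: subset_eq)
  qed
  ultimately show ?thesis unfolding strong_rigid_quotient_def by blast
qed

theorem is_category_Rel_srq: "is_category (Rel_srq \<Theta> ar)"
proof -
  have fn: "f \<in> universe A \<rightarrow> universe B" "f \<in> extensional (universe A)"
    if "strong_rigid_quotient \<Theta> ar A B f" for A B :: "('a, 'b) lo_structure" and f
    using that by (auto simp: strong_rigid_quotient_def homomorphism_def PiE_def)
  show ?thesis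
    unfolding is_category_def Rel_srq_def
    using srq_ident srq_compose[of \<Theta> ar]
    by (auto simp: Id_compose[OF fn] compose_Id[OF fn] compose_assoc[OF fn(1)])
qed

end

theory Submission
  imports Defs
begin

text \<open>
  A non-constant tuple of a structure amounts to its pattern together with its set of entries, an
  edge. Attach to a structure \<open>A\<close> the finite chain of its points followed by its edges, where the
  edges are ordered by a label and then anti-lexicographically. A strong rigid quotient map
  \<open>f : B \<rightarrow> A\<close> sends cells (points and edges) to cells, an edge on which
  \<open>f\<close> is constant becoming a point, and is a rigid surjection between these chains. Conversely a rigid surjection \<open>v\<close> from \<open>{..<N}\<close> onto
  the cells of \<open>A\<close> gives a strong rigid quotient map \<open>C \<rightarrow> A\<close>, where \<open>C\<close> is a disjoint union of
  edges, one for each label and each \<open>n < N\<close>: the \<open>j\<close>-th vertex of the \<open>n\<close>-th edge with label \<open>m\<close>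
  goes to the \<open>j\<close>-th vertex of \<open>v n\<close> if \<open>v n\<close> is an edge with label \<open>m\<close>, and to the least vertex
  of \<open>v n\<close> otherwise. This is natural in \<open>A\<close>, so the claim reduces to the finite dual Ramsey
  theorem for rigid surjections. That is the Graham--Rothschild theorem, obtained here from the
  Hales--Jewett theorem, which in turn is proved by Shelah's method.
\<close>


section \<open>Restricted growth words\<close>

text \<open>\<open>C\<close> is fixed before the colouring, hence before \<open>v\<close>, so block
  \<open>n\<close> has to be ready for a cell \<open>v n\<close> with any label; this is why it
  contains an edge for every label. Collapsing the edges whose label does not match costs nothing:
  reflexivity puts constant tuples into every relation, and condition (ii) is silent where the map
  is constant. The collapse goes to the least vertex because that choice is natural: a morphism that
  does not collapse an edge is strictly increasing on it. Points come before edges just as constant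
  tuples come before the others in \<open>sal\<close>. The order of the labels themselves is
  arbitrary: an edge that is not collapsed keeps its label under a morphism, and tuples of different
  types are compared by their types alone, which realised tuples share with their images. The
  obstacle is that \<open>sal\<close> is not linear. Cells form a genuine chain, to which the Ramsey
  theorem applies, while rigidity on tuples needs least preimages, which are exhibited
  explicitly.\<close>

text \<open>
  Rigid surjections \<open>{..<N} \<rightarrow> {..<s}\<close> that fix the first \<open>a\<close> letters: those letters play the role
  of the constants of a parameter word, the other ones that of the parameters. The value \<open>0\<close>
  beyond \<open>N\<close> makes ordinary composition of functions the substitution of words.
\<close>

definition rgw :: "nat \<Rightarrow> nat \<Rightarrow> nat \<Rightarrow> (nat \<Rightarrow> nat) set" where
  "rgw a N s = {w. (\<forall>i<a. w i = i) \<and> (\<forall>i\<ge>N. w i = 0) \<and> w ` {..<N} = {..<s} \<and>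
     (\<forall>i. \<forall>y<w i. \<exists>j<i. w j = y)}"

lemma rgwI:
  assumes "\<And>i. i < a \<Longrightarrow> w i = i" "\<And>i. N \<le> i \<Longrightarrow> w i = 0" "\<And>i. i < N \<Longrightarrow> w i < s"
    and "\<And>y. y < s \<Longrightarrow> \<exists>i<N. w i = y" "\<And>i y. y < w i \<Longrightarrow> \<exists>j<i. w j = y"
  shows "w \<in> rgw a N s"
proof -
  have "w ` {..<N} \<subseteq> {..<s}" using assms(3) by auto
  moreover have "{..<s} \<subseteq> w ` {..<N}" using assms(4) by (metis imageI lessThan_iff subsetI)
  ultimately show ?thesis using assms(1,2,5) by (simp add: rgw_def subset_antisym)
qed

lemma rgwD:
  assumes "w \<in> rgw a N s"
  shows "\<And>i. i < a \<Longrightarrow> w i = i" "\<And>i. N \<le> i \<Longrightarrow> w i = 0" "\<And>i. i < N \<Longrightarrow> w i < s"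
    and "\<And>y. y < s \<Longrightarrow> \<exists>i<N. w i = y" "\<And>i y. y < w i \<Longrightarrow> \<exists>j<i. w j = y"
proof -
  have im: "w ` {..<N} = {..<s}" using assms by (simp add: rgw_def)
  show "w i < s" if "i < N" for i using that im by blast
  show "\<exists>i<N. w i = y" if "y < s" for y using that im by (metis imageE lessThan_iff)
qed (use assms in \<open>auto simp: rgw_def\<close>)

lemma rgw_zero: "w \<in> rgw a N s \<Longrightarrow> w 0 = 0"
  using rgwD(5)[of w a N s 0 0] by fastforce

lemma rgw_less: "w \<in> rgw a N s \<Longrightarrow> 0 < s \<Longrightarrow> w i < s"
  using rgwD(2,3)[of w a N s i] by (cases "i < N") auto

lemma rgw_le:
  assumes "w \<in> rgw a N s" shows "s \<le> N"
proof -
  have "card (w ` {..<N}) \<le> card {..<N}" by (rule card_image_le) simp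
  then show ?thesis using assms by (simp add: rgw_def)
qed

lemma rgw_anti: "a \<le> b \<Longrightarrow> rgw b N s \<subseteq> rgw a N s"
  by (auto simp: rgw_def)

text \<open>\<open>g \<circ> u\<close> is the word \<open>u\<close> with its letters replaced
  according to \<open>g\<close>. A letter below \<open>g (u i)\<close> occurs in \<open>g\<close> at
  a position below \<open>u i\<close>, and that position is in turn a letter of \<open>u\<close>
  before \<open>i\<close>.\<close>

lemma rgw_comp:
  assumes u: "u \<in> rgw a N t" and g: "g \<in> rgw a t s"
  shows "g \<circ> u \<in> rgw a N s"
proof -
  have "(g \<circ> u) ` {..<N} = g ` {..<t}" using u unfolding rgw_def image_comp[symmetric] by simp
  moreover have "\<exists>j<i. g (u j) = y" if y: "y < g (u i)" for i y
  proof -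
    obtain l where "l < u i" "g l = y" using rgwD(5)[OF g y] by blast
    then show ?thesis using rgwD(5)[OF u] by blast
  qed
  ultimately show ?thesis using u g rgw_zero[OF g] by (simp add: rgw_def)
qed

text \<open>No larger letter can precede the first occurrence of \<open>y\<close>, since it would
  require a still earlier \<open>y\<close>.\<close>

lemma rgw_first:
  assumes w: "w \<in> rgw a N s" and y: "y < s"
  obtains q where "q < N" "w q = y" "\<And>i. i < q \<Longrightarrow> w i < y"
proof -
  define q where "q = (LEAST i. w i = y)"
  obtain i where i: "i < N" "w i = y" using rgwD(4)[OF w y] by blast
  have "w q = y" unfolding q_def by (rule LeastI[of _ i]) (rule i)
  moreover have "q < N" using i Least_le[of "\<lambda>i. w i = y" i] unfolding q_def by linarith
  moreover have "w j < y" if "j < q" for j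
  proof (rule ccontr)
    assume "\<not> w j < y"
    then obtain l where "l \<le> j" "w l = y"
      using rgwD(5)[OF w, of y j] by (metis le_less linorder_less_linear)
    then show False using that not_less_Least[of l "\<lambda>i. w i = y"] unfolding q_def by simp
  qed
  ultimately show ?thesis using that by blast
qed

lemma rgw_before_first:
  assumes w: "w \<in> rgw a N s" and q: "\<And>i. i < q \<Longrightarrow> w i \<noteq> w q" and i: "i < q"
  shows "w i < w q"
proof (rule ccontr)
  assume "\<not> w i < w q"
  then have "w q < w i" using q[OF i] by linarith
  then obtain j where "j < i" "w j = w q" using rgwD(5)[OF w] by blast
  then show False using q i by force
qed

definition idw :: "nat \<Rightarrow> nat \<Rightarrow> nat" where
  "idw t i = (if i < t then i else 0)"

lemma idw_rgw: "a \<le> t \<Longrightarrow> idw t \<in> rgw a t t"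
proof (rule rgwI)
  show "\<exists>i<t. idw t i = y" if "y < t" for y using that by (intro exI[of _ y]) (simp add: idw_def)
  show "\<exists>j<i. idw t j = y" if "y < idw t i" for i y
    using that by (intro exI[of _ y]) (simp add: idw_def split: if_splits)
qed (simp_all add: idw_def)

lemma finite_rgw: "finite (rgw a N s)"
proof (rule finite_subset)
  show "rgw a N s \<subseteq> {w. \<forall>i. (i \<in> {..<N} \<longrightarrow> w i \<in> {..<s}) \<and> (i \<notin> {..<N} \<longrightarrow> w i = 0)}"
    by (auto simp: rgw_def)
qed (intro finite_set_of_finite_funs; simp)

text \<open>Numbering the finitely many functions from \<open>X\<close> to \<open>k\<close> colours
  packs a family of colourings into a single one, so that one application of a Ramsey statement
  serves all of them.\<close>

lemma colour_vector:
  assumes "finite X"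
  shows "\<exists>(e :: ('x \<Rightarrow> nat) \<Rightarrow> nat) K. (\<forall>\<phi>. (\<forall>x. \<phi> x < k) \<longrightarrow> e \<phi> < K) \<and>
    (\<forall>\<phi> \<psi>. (\<forall>x. \<phi> x < k) \<longrightarrow> (\<forall>x. \<psi> x < k) \<longrightarrow> e \<phi> = e \<psi> \<longrightarrow> (\<forall>x\<in>X. \<phi> x = \<psi> x))"
proof -
  let ?F = "X \<rightarrow>\<^sub>E {..<k}"
  have "finite ?F" using assms by (simp add: finite_PiE)
  then obtain h where h: "bij_betw h ?F {0..<card ?F}" using ex_bij_betw_finite_nat by blast
  have mem: "restrict \<phi> X \<in> ?F" if "\<forall>x. \<phi> x < k" for \<phi> :: "'x \<Rightarrow> nat" using that by auto
  let ?e = "\<lambda>\<phi>. h (restrict \<phi> X)"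
  have "\<forall>\<phi>. (\<forall>x. \<phi> x < k) \<longrightarrow> ?e \<phi> < card ?F" using mem bij_betwE[OF h] by fastforce
  moreover have "\<phi> x = \<psi> x" if "\<forall>x. \<phi> x < k" "\<forall>x. \<psi> x < k" "?e \<phi> = ?e \<psi>" "x \<in> X" for \<phi> \<psi> x
  proof -
    have "restrict \<phi> X = restrict \<psi> X"
      using inj_onD[OF bij_betw_imp_inj_on[OF h] that(3) mem mem] that(1,2) by blast
    then show "\<phi> x = \<psi> x" using \<open>x \<in> X\<close> by (metis restrict_apply')
  qed
  then have "\<forall>\<phi> \<psi>. (\<forall>x. \<phi> x < k) \<longrightarrow> (\<forall>x. \<psi> x < k) \<longrightarrow> ?e \<phi> = ?e \<psi> \<longrightarrow> (\<forall>x\<in>X. \<phi> x = \<psi> x)"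
    by (intro allI impI ballI)
  ultimately show ?thesis by (intro exI[of _ ?e] exI[of _ "card ?F"] conjI)
qed

text \<open>For \<open>s = a\<close> the words \<open>g\<close> have no parameters and this is the
  Hales-Jewett theorem over \<open>a\<close> letters in dimension \<open>t - a\<close>; for
  \<open>s > a\<close> it is the Graham-Rothschild theorem for \<open>s - a\<close> parameters.
  Colourings are bounded on all functions, which avoids membership conditions on their
  arguments.\<close>

definition word_ramsey :: "nat \<Rightarrow> nat \<Rightarrow> bool" where
  "word_ramsey a s \<longleftrightarrow> (\<forall>k t. a \<le> t \<longrightarrow> (\<exists>N. \<forall>\<chi>. (\<forall>w. \<chi> w < (k::nat)) \<longrightarrow>
     (\<exists>u\<in>rgw a N t. \<forall>g\<in>rgw a t s. \<forall>g'\<in>rgw a t s. \<chi> (g \<circ> u) = \<chi> (g' \<circ> u))))"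

lemma word_ramsey_simultaneous:
  assumes "word_ramsey a s" "a \<le> t" "finite X"
  shows "\<exists>N\<ge>t. \<forall>\<chi>. (\<forall>x w. \<chi> x w < (k::nat)) \<longrightarrow>
    (\<exists>u\<in>rgw a N t. \<forall>x\<in>X. \<forall>g\<in>rgw a t s. \<forall>g'\<in>rgw a t s. \<chi> x (g \<circ> u) = \<chi> x (g' \<circ> u))"
proof -
  obtain e :: "('a \<Rightarrow> nat) \<Rightarrow> nat" and K
    where e: "\<forall>\<phi>. (\<forall>x. \<phi> x < k) \<longrightarrow> e \<phi> < K"
    "\<forall>\<phi> \<psi>. (\<forall>x. \<phi> x < k) \<longrightarrow> (\<forall>x. \<psi> x < k) \<longrightarrow> e \<phi> = e \<psi> \<longrightarrow> (\<forall>x\<in>X. \<phi> x = \<psi> x)"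
    using colour_vector[OF assms(3), of k] by (elim exE conjE)
  \<comment> \<open>\<open>Suc K\<close> guarantees that a colour exists even if
    \<open>K = 0\<close>: the constant colouring then yields some \<open>u\<close>, whence
    \<open>t \<le> N\<close>.\<close>
  obtain N where N: "\<forall>\<chi>. (\<forall>w. \<chi> w < Suc K) \<longrightarrow>
     (\<exists>u\<in>rgw a N t. \<forall>g\<in>rgw a t s. \<forall>g'\<in>rgw a t s. \<chi> (g \<circ> u) = \<chi> (g' \<circ> u))"
    using assms(1)[unfolded word_ramsey_def, THEN spec[of _ "Suc K"], THEN spec[of _ t], THEN mp,
        OF assms(2)]
    by (rule exE)
  have "\<exists>u. u \<in> rgw a N t" using N[rule_format, of "\<lambda>_. 0"] by auto
  then have "t \<le> N" using rgw_le by blast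
  moreover have "\<exists>u\<in>rgw a N t. \<forall>x\<in>X. \<forall>g\<in>rgw a t s. \<forall>g'\<in>rgw a t s. \<chi> x (g \<circ> u) = \<chi> x (g' \<circ> u)"
    if \<chi>: "\<forall>x w. \<chi> x w < k" for \<chi>
  proof -
    have "e (\<lambda>x. \<chi> x w) < Suc K" for w by (intro less_SucI e(1)[rule_format] \<chi>[rule_format])
    then have "\<exists>u\<in>rgw a N t. \<forall>g\<in>rgw a t s. \<forall>g'\<in>rgw a t s.
        e (\<lambda>x. \<chi> x (g \<circ> u)) = e (\<lambda>x. \<chi> x (g' \<circ> u))"
      by (rule N[rule_format])
    then obtain u where u: "u \<in> rgw a N t" "\<And>g g'. g \<in> rgw a t s \<Longrightarrow> g' \<in> rgw a t s \<Longrightarrow>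
        e (\<lambda>x. \<chi> x (g \<circ> u)) = e (\<lambda>x. \<chi> x (g' \<circ> u))" by blast
    have "\<chi> x (g \<circ> u) = \<chi> x (g' \<circ> u)" if "x \<in> X" "g \<in> rgw a t s" "g' \<in> rgw a t s" for x g g'
      by (rule e(2)[rule_format, OF \<chi>[rule_format] \<chi>[rule_format] u(2)[OF that(2,3)] that(1)])
    then show ?thesis using u(1) by (intro bexI[of _ u] ballI)
  qed
  ultimately show ?thesis by blast
qed

text \<open>Inserts \<open>p - a\<close> fixed positions after the constants, shifting the parameters.\<close>

definition lift_letter :: "nat \<Rightarrow> nat \<Rightarrow> nat \<Rightarrow> nat" where
  "lift_letter a p l = (if l < a then l else l - a + p)"

definition lift_word :: "nat \<Rightarrow> nat \<Rightarrow> (nat \<Rightarrow> nat) \<Rightarrow> nat \<Rightarrow> nat" where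
  "lift_word a p u i = (if i < p then i else lift_letter a p (u (i - p + a)))"

lemma lift_word_rgw:
  assumes u: "u \<in> rgw a N t" and a: "0 < a" "a \<le> p" "a \<le> t"
  shows "lift_word a p u \<in> rgw p (N - a + p) (t - a + p)"
proof (rule rgwI)
  have tN: "t \<le> N" using rgw_le[OF u] .
  have t: "0 < t" using a by simp
  show "lift_word a p u i = i" if "i < p" for i using that by (simp add: lift_word_def)
  show "lift_word a p u i = 0" if "N - a + p \<le> i" for i
  proof -
    have "\<not> i < p" "N \<le> i - p + a" using that a tN by auto
    then show ?thesis using a(1) rgwD(2)[OF u, of "i - p + a"] by (simp add: lift_word_def
        lift_letter_def)
  qed
  show "lift_word a p u i < t - a + p" if "i < N - a + p" for i
    using rgw_less[OF u t, of "i - p + a"] a by (auto simp: lift_word_def lift_letter_def)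
  show "\<exists>i<N - a + p. lift_word a p u i = y" if y: "y < t - a + p" for y
  proof (cases "y < p")
    case True then show ?thesis using a tN by (intro exI[of _ y]) (auto simp: lift_word_def)
  next
    case False
    then have "y - p + a < t" using y a by linarith
    then obtain i where i: "i < N" "u i = y - p + a" using rgwD(4)[OF u] by blast
    have ai: "a \<le> i"
    proof (rule ccontr)
      assume "\<not> a \<le> i"
      then show False using rgwD(1)[OF u, of i] i(2) by linarith
    qed
    have e: "i - a + p - p + a = i" "\<not> i - a + p < p" using ai by auto
    have "lift_word a p u (i - a + p) = y"
      unfolding lift_word_def e(1) i(2) lift_letter_def using e(2) False by auto
    moreover have "i - a + p < N - a + p" using i(1) ai by linarith
    ultimately show ?thesis by blast
  qed
  show "\<exists>j<i. lift_word a p u j = y" if y: "y < lift_word a p u i" for i y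
  proof (cases "i < p \<or> y < p")
    case True
    then have "y < i" "y < p" using y by (auto simp: lift_word_def split: if_splits)
    then show ?thesis by (intro exI[of _ y]) (simp add: lift_word_def)
  next
    case False
    then have "y < lift_letter a p (u (i - p + a))" using y by (simp add: lift_word_def)
    then have "y - p + a < u (i - p + a)" using False a by (auto simp: lift_letter_def split:
        if_splits)
    then obtain j where j: "j < i - p + a" "u j = y - p + a" using rgwD(5)[OF u] by blast
    have aj: "a \<le> j"
    proof (rule ccontr)
      assume "\<not> a \<le> j"
      then show False using rgwD(1)[OF u, of j] j(2) by linarith
    qed
    have e: "j - a + p - p + a = j" "\<not> j - a + p < p" using aj by auto
    have "lift_word a p u (j - a + p) = y"
      unfolding lift_word_def e(1) j(2) lift_letter_def using e(2) False by auto
    moreover have "j - a + p < i" using j(1) aj False by linarith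
    ultimately show ?thesis by blast
  qed
qed

text \<open>Words without parameters: every letter below \<open>a\<close> stands at its own position
  at the beginning, so the growth condition is automatic.\<close>

lemma const_rgwI:
  assumes "a \<le> N" "\<And>i. i < a \<Longrightarrow> w i = i" "\<And>i. N \<le> i \<Longrightarrow> w i = 0" "\<And>i. w i < a"
  shows "w \<in> rgw a N a"
proof (rule rgwI)
  show "\<exists>i<N. w i = y" if "y < a" for y using that assms by (intro exI[of _ y]) auto
  show "\<exists>j<i. w j = y" if y: "y < w i" for i y
  proof -
    have "y < i" using y assms(2)[of i] assms(4)[of i] by (cases "i < a") auto
    moreover have "w y = y" using y assms(4)[of i] by (intro assms(2)) auto
    ultimately show ?thesis by blast
  qed
qed (use assms in auto)

section \<open>Shelah's proof of the Hales-Jewett theorem\<close>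

definition cut_word :: "nat \<Rightarrow> (nat \<Rightarrow> nat) \<Rightarrow> nat \<Rightarrow> nat" where
  "cut_word q g i = (if i < q then g i else 0)"

definition merge_last :: "nat \<Rightarrow> nat \<Rightarrow> nat" where
  "merge_last a x = (if x = a then a - 1 else x)"

definition append_word :: "nat \<Rightarrow> nat \<Rightarrow> (nat \<Rightarrow> nat) \<Rightarrow> (nat \<Rightarrow> nat) \<Rightarrow> nat \<Rightarrow> nat" where
  "append_word N m x f i = (if i < N then x i else if i < N + m then f (i - N) else 0)"

text \<open>A step word is \<open>a - 1\<close> up to some break and \<open>a\<close> from there on.
  Putting \<open>z = a\<close> gives the step word with break \<open>j\<close>, putting
  \<open>z = a - 1\<close> the one with break \<open>j'\<close>, so two of the points of this line
  are step words.\<close>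

definition shelah_line :: "nat \<Rightarrow> nat \<Rightarrow> nat \<Rightarrow> nat \<Rightarrow> nat \<Rightarrow> nat" where
  "shelah_line a j j' z i = (if i < j then a - 1 else if i < j' then z else a)"

text \<open>
  Each new dimension is a block of length \<open>m\<close>; by the pigeonhole principle two of the words
  \<open>shelah_line a j j 0\<close> with \<open>j \<le> m\<close> get the same colours in all contexts, so along the line
  between them the letters \<open>a - 1\<close> and \<open>a\<close> become indistinguishable.
\<close>

lemma shelah_cube:
  assumes a: "0 < a"
  shows "\<exists>N. \<forall>\<chi>. (\<forall>w. \<chi> w < (k::nat)) \<longrightarrow> (\<exists>u\<in>rgw (Suc a) N (Suc a + d).
    \<forall>g\<in>rgw (Suc a) (Suc a + d) (Suc a). \<forall>g'\<in>rgw (Suc a) (Suc a + d) (Suc a).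
      (\<forall>i\<ge>Suc a. merge_last a (g i) = merge_last a (g' i)) \<longrightarrow> \<chi> (g \<circ> u) = \<chi> (g' \<circ> u))"
proof (induction d arbitrary: k)
  case 0
  have "g = g'" if "g \<in> rgw (Suc a) (Suc a) (Suc a)" "g' \<in> rgw (Suc a) (Suc a) (Suc a)" for g g'
  proof
    fix i show "g i = g' i"
      using rgwD(1,2)[OF that(1), of i] rgwD(1,2)[OF that(2), of i] by (cases "i < Suc a") auto
  qed
  then have "\<forall>g\<in>rgw (Suc a) (Suc a + 0) (Suc a). \<forall>g'\<in>rgw (Suc a) (Suc a + 0) (Suc a). g = g'" by
      simp
  then show ?case using idw_rgw[of "Suc a" "Suc a"]
    by (intro exI[of _ "Suc a"] allI impI bexI[of _ "idw (Suc a)"]) auto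
next
  case (Suc d)
  let ?A = "Suc a"
  \<comment> \<open>The colour of the old part of a word has to record the outcome for every letter
    \<open>z\<close> that may be put into the new block, hence a vector indexed by the
    letters.\<close>
  obtain e :: "(nat \<Rightarrow> nat) \<Rightarrow> nat" and K
    where e: "\<forall>\<phi>. (\<forall>x. \<phi> x < k) \<longrightarrow> e \<phi> < K"
    "\<forall>\<phi> \<psi>. (\<forall>x. \<phi> x < k) \<longrightarrow> (\<forall>x. \<psi> x < k) \<longrightarrow> e \<phi> = e \<psi> \<longrightarrow> (\<forall>x\<in>{..<?A}. \<phi> x = \<psi> x)"
    using colour_vector[where X = "{..<?A}" and k = k, OF finite_lessThan] by (elim exE conjE)
  obtain N where N: "\<forall>\<chi>. (\<forall>w. \<chi> w < K) \<longrightarrow> (\<exists>u\<in>rgw ?A N (?A + d).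
    \<forall>g\<in>rgw ?A (?A + d) ?A. \<forall>g'\<in>rgw ?A (?A + d) ?A.
      (\<forall>i\<ge>?A. merge_last a (g i) = merge_last a (g' i)) \<longrightarrow> \<chi> (g \<circ> u) = \<chi> (g' \<circ> u))"
    using Suc.IH[of K] by (rule exE)
  let ?X = "rgw ?A N ?A"
  \<comment> \<open>The line in the new block is chosen before the cube in the old part, so it must
    work in the context of every word \<open>x\<close> of length \<open>N\<close>. With
    \<open>m\<close> possible colour patterns over all contexts, two of the \<open>m + 1\<close>
    breaks agree.\<close>
  define m where "m = card (?X \<rightarrow>\<^sub>E {..<k})"
  have finX: "finite (?X \<rightarrow>\<^sub>E {..<k})" using finite_rgw by (simp add: finite_PiE)
  have "\<exists>u\<in>rgw ?A (N + m) (?A + Suc d).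
    \<forall>g\<in>rgw ?A (?A + Suc d) ?A. \<forall>g'\<in>rgw ?A (?A + Suc d) ?A.
      (\<forall>i\<ge>?A. merge_last a (g i) = merge_last a (g' i)) \<longrightarrow> \<chi> (g \<circ> u) = \<chi> (g' \<circ> u)"
    if \<chi>: "\<forall>w. \<chi> w < k" for \<chi>
  proof -
    define f where "f j = restrict (\<lambda>x. \<chi> (append_word N m x (shelah_line a j j 0))) ?X" for j
    have "f ` {..m} \<subseteq> ?X \<rightarrow>\<^sub>E {..<k}" using \<chi> by (auto simp: f_def)
    then have "card (f ` {..m}) \<le> m" unfolding m_def by (rule card_mono[OF finX])
    then have "\<not> inj_on f {..m}" by (intro pigeonhole) simp
    then obtain j1 j2 where "j1 \<le> m" "j2 \<le> m" "j1 \<noteq> j2" "f j1 = f j2" by (auto simp: inj_on_def)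
    then obtain j j' where j: "j < j'" "j' \<le> m" "f j = f j'" by (metis linorder_neqE_nat)
    let ?l = "shelah_line a j j'"
    have l1: "?l a = shelah_line a j j 0" "?l (a - 1) = shelah_line a j' j' 0"
      using j by (auto simp: shelah_line_def fun_eq_iff)
    have swap: "\<chi> (append_word N m x (?l a)) = \<chi> (append_word N m x (?l (a - 1)))" if "x \<in> ?X" for x
      unfolding l1 using fun_cong[OF j(3), of x] that by (simp add: f_def)
    have "\<forall>w. e (\<lambda>z. \<chi> (append_word N m w (?l z))) < K"
      by (intro allI e(1)[rule_format] \<chi>[rule_format])
    then have "\<exists>u\<in>rgw ?A N (?A + d). \<forall>g\<in>rgw ?A (?A + d) ?A. \<forall>g'\<in>rgw ?A (?A + d) ?A.
      (\<forall>i\<ge>?A. merge_last a (g i) = merge_last a (g' i)) \<longrightarrow>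
        e (\<lambda>z. \<chi> (append_word N m (g \<circ> u) (?l z))) = e (\<lambda>z. \<chi> (append_word N m (g' \<circ> u) (?l z)))"
      by (rule N[THEN spec, THEN mp])
    then obtain u0 where u0: "u0 \<in> rgw ?A N (?A + d)"
      and inv: "\<And>g g'. g \<in> rgw ?A (?A + d) ?A \<Longrightarrow> g' \<in> rgw ?A (?A + d) ?A \<Longrightarrow>
        \<forall>i\<ge>?A. merge_last a (g i) = merge_last a (g' i) \<Longrightarrow>
        e (\<lambda>z. \<chi> (append_word N m (g \<circ> u0) (?l z))) = e (\<lambda>z. \<chi> (append_word N m (g' \<circ> u0) (?l z)))"
      by blast
    have AN: "?A + d \<le> N" using rgw_le[OF u0] .
    let ?u = "append_word N m u0 (?l (?A + d))"
    have u0lt: "u0 i < ?A + d" for i using rgw_less[OF u0] by simp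
    have ule: "?u i \<le> ?A + d" for i
      using u0lt[of i] by (auto simp: append_word_def shelah_line_def)
    have u: "?u \<in> rgw ?A (N + m) (?A + Suc d)"
    proof (rule rgwI)
      show "?u i = i" if "i < ?A" for i
        using that AN rgwD(1)[OF u0 that] by (simp add: append_word_def)
      show "?u i = 0" if "N + m \<le> i" for i using that by (simp add: append_word_def)
      show "?u i < ?A + Suc d" for i using ule[of i] by simp
      have old: "\<exists>i<N. ?u i = y" if "y < ?A + d" for y
        using rgwD(4)[OF u0 that] by (auto simp: append_word_def)
      show "\<exists>i<N + m. ?u i = y" if "y < ?A + Suc d" for y
      proof (cases "y < ?A + d")
        case True then show ?thesis using old[OF True] trans_less_add1 by blast
      next
        case False
        then have "?u (N + j) = y" "N + j < N + m" using that j by (auto simp: append_word_def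
            shelah_line_def)
        then show ?thesis by blast
      qed
      show "\<exists>j<i. ?u j = y" if y: "y < ?u i" for i y
      proof (cases "i < N")
        case True
        then obtain j where "j < i" "u0 j = y" using rgwD(5)[OF u0, of y i] y by (auto simp:
            append_word_def)
        then show ?thesis using True by (intro exI[of _ j]) (simp add: append_word_def)
      next
        case False
        have "y < ?A + d" using y ule[of i] by linarith
        then obtain j where "j < N" "?u j = y" using old by blast
        then show ?thesis using False by (intro exI[of _ j]) simp
      qed
    qed
    let ?cut = "cut_word (?A + d)"
    have cut: "?cut g \<in> rgw ?A (?A + d) ?A" if g: "g \<in> rgw ?A (?A + Suc d) ?A" for g
      using rgwD(1)[OF g] rgw_less[OF g] by (intro const_rgwI) (auto simp: cut_word_def)
    have comp: "g \<circ> ?u = append_word N m (?cut g \<circ> u0) (?l (g (?A + d)))"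
      if g: "g \<in> rgw ?A (?A + Suc d) ?A" for g
    proof
      fix i
      have "g a = a" "g (a - 1) = a - 1" using rgwD(1)[OF g] by auto
      then show "(g \<circ> ?u) i = append_word N m (?cut g \<circ> u0) (?l (g (?A + d))) i"
        using rgw_zero[OF g] u0lt[of i] by (simp add: append_word_def shelah_line_def cut_word_def)
    qed
    have "\<chi> (g \<circ> ?u) = \<chi> (g' \<circ> ?u)" if g: "g \<in> rgw ?A (?A + Suc d) ?A"
      and g': "g' \<in> rgw ?A (?A + Suc d) ?A"
      and eq: "\<forall>i\<ge>?A. merge_last a (g i) = merge_last a (g' i)" for g g'
    proof -
      \<comment> \<open>The two words are compared in two moves: \<open>inv\<close> exchanges the
        old part while the letter in the new block is kept, and \<open>swap\<close> then exchanges
        that letter in the fixed context \<open>?x'\<close>.\<close>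
      let ?x = "?cut g \<circ> u0" and ?x' = "?cut g' \<circ> u0"
      have "\<forall>i\<ge>?A. merge_last a (?cut g i) = merge_last a (?cut g' i)" using eq by (auto simp:
          cut_word_def)
      from inv[OF cut[OF g] cut[OF g'] this]
      have z: "\<chi> (append_word N m ?x (?l z)) = \<chi> (append_word N m ?x' (?l z))" if "z < ?A" for z
        using e(2)[rule_format, of "\<lambda>z. \<chi> (append_word N m ?x (?l z))"
            "\<lambda>z. \<chi> (append_word N m ?x' (?l z))" z] \<chi> that by simp
      have x': "?x' \<in> ?X" using rgw_comp[OF u0 cut[OF g']] .
      let ?z = "g (?A + d)" and ?z' = "g' (?A + d)"
      have "?z < ?A" "?z' < ?A" using rgw_less[OF g] rgw_less[OF g'] by auto
      have "merge_last a ?z = merge_last a ?z'" using eq by simp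
      then have "?z = ?z' \<or> ?z = a \<and> ?z' = a - 1 \<or> ?z = a - 1 \<and> ?z' = a"
        by (auto simp: merge_last_def split: if_splits)
      then have "\<chi> (append_word N m ?x' (?l ?z)) = \<chi> (append_word N m ?x' (?l ?z'))"
        using swap[OF x'] by auto
      then show ?thesis using z[OF \<open>?z < ?A\<close>] unfolding comp[OF g] comp[OF g'] by simp
    qed
    then show ?thesis using u by blast
  qed
  then show ?case by blast
qed

text \<open>On Shelah's cube the letters \<open>a\<close> and \<open>a - 1\<close> are
  interchangeable, so the colour sees only words over \<open>a\<close> letters and the induction
  hypothesis applies. Since one constant disappears while the number of parameters stays,
  \<open>t\<close> becomes \<open>t - 1\<close> there.\<close>

theorem hales_jewett:
  assumes "0 < a"
  shows "word_ramsey a a"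
  using assms
proof (induction a rule: nat_induct_non_zero)
  case 1
  have eq: "g = g'" if "g \<in> rgw 1 t 1" "g' \<in> rgw 1 t 1" for g g' t
    using rgw_less[OF that(1)] rgw_less[OF that(2)] by (auto simp: fun_eq_iff)
  show ?case unfolding word_ramsey_def
  proof (intro allI impI)
    fix k t :: nat assume "1 \<le> t"
    then show "\<exists>N. \<forall>\<chi>. (\<forall>w. \<chi> w < k) \<longrightarrow>
       (\<exists>u\<in>rgw 1 N t. \<forall>g\<in>rgw 1 t 1. \<forall>g'\<in>rgw 1 t 1. \<chi> (g \<circ> u) = \<chi> (g' \<circ> u))"
      using idw_rgw[of 1 t] eq by (intro exI[of _ t] allI impI bexI[of _ "idw t"] ballI) metis+
  qed
next
  case (Suc a)
  let ?A = "Suc a"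
  show ?case unfolding word_ramsey_def
  proof (intro allI impI)
    fix k t :: nat assume t: "?A \<le> t"
    then have "a \<le> t - 1" by simp
    obtain N' where N': "t - 1 \<le> N'"
      and hj: "\<forall>\<chi> :: unit \<Rightarrow> _. (\<forall>x w. \<chi> x w < k) \<longrightarrow> (\<exists>u\<in>rgw a N' (t - 1).
        \<forall>x\<in>{()}. \<forall>g\<in>rgw a (t - 1) a. \<forall>g'\<in>rgw a (t - 1) a. \<chi> x (g \<circ> u) = \<chi> x (g' \<circ> u))"
      using word_ramsey_simultaneous[OF Suc.IH \<open>a \<le> t - 1\<close>, where X = "{()}" and k = k] by auto
    have le_Suc_self: "a \<le> ?A" by simp
    define d where "d = N' - a"
    have N'': "N' - a + ?A = ?A + d" "t - 1 - a + ?A = t" using N' t by (auto simp: d_def)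
    obtain N where N: "\<forall>\<chi>. (\<forall>w. \<chi> w < k) \<longrightarrow> (\<exists>u\<in>rgw ?A N (?A + d).
      \<forall>g\<in>rgw ?A (?A + d) ?A. \<forall>g'\<in>rgw ?A (?A + d) ?A.
      (\<forall>i\<ge>?A. merge_last a (g i) = merge_last a (g' i)) \<longrightarrow> \<chi> (g \<circ> u) = \<chi> (g' \<circ> u))"
      using shelah_cube[OF Suc.hyps, of k d] by (rule exE)
    have "\<exists>u\<in>rgw ?A N t. \<forall>g\<in>rgw ?A t ?A. \<forall>g'\<in>rgw ?A t ?A. \<chi> (g \<circ> u) = \<chi> (g' \<circ> u)"
      if \<chi>: "\<forall>w. \<chi> w < k" for \<chi>
    proof -
      obtain u where u: "u \<in> rgw ?A N (?A + d)"
        and inv: "\<And>g g'. g \<in> rgw ?A (?A + d) ?A \<Longrightarrow> g' \<in> rgw ?A (?A + d) ?A \<Longrightarrow>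
           \<forall>i\<ge>?A. merge_last a (g i) = merge_last a (g' i) \<Longrightarrow> \<chi> (g \<circ> u) = \<chi> (g' \<circ> u)"
        using N[THEN spec, THEN mp, OF \<chi>] by blast
      let ?\<chi> = "\<lambda>(_::unit) h. \<chi> (lift_word a ?A h \<circ> u)"
      have "\<forall>x w. ?\<chi> x w < k" using \<chi> by simp
      from hj[THEN spec[of _ ?\<chi>], THEN mp, OF this] obtain u' where u': "u' \<in> rgw a N' (t - 1)"
        and mono: "\<And>h h'. h \<in> rgw a (t - 1) a \<Longrightarrow> h' \<in> rgw a (t - 1) a \<Longrightarrow>
          \<chi> (lift_word a ?A (h \<circ> u') \<circ> u) = \<chi> (lift_word a ?A (h' \<circ> u') \<circ> u)" by blast
      let ?v = "lift_word a ?A u'"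
      have v: "?v \<in> rgw ?A (?A + d) t"
        using lift_word_rgw[OF u' Suc.hyps le_Suc_self \<open>a \<le> t - 1\<close>] unfolding N'' .
      \<comment> \<open>\<open>h g\<close> lists the values of \<open>g\<close> on its parameters
        with \<open>a\<close> merged into \<open>a - 1\<close>. The shift by one in the index skips
        position \<open>a\<close>, which is a constant for \<open>g\<close> and a parameter position
        for \<open>h g\<close>.\<close>
      define h where "h g i = (if i < a then i else merge_last a (g (i - a + ?A)))" for g and i ::
          nat
      have h: "h g \<in> rgw a (t - 1) a" and col: "\<chi> (g \<circ> (?v \<circ> u)) = \<chi> (lift_word a ?A (h g \<circ> u') \<circ>
          u)"
        if g: "g \<in> rgw ?A t ?A" for g
      proof -
        have hlt: "h g i < a" for i
          using rgw_less[OF g, of "i - a + ?A"] Suc.hyps by (auto simp: h_def merge_last_def)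
        show hr: "h g \<in> rgw a (t - 1) a"
        proof (rule const_rgwI)
          show "h g i = 0" if "t - 1 \<le> i" for i
            using that t rgwD(2)[OF g, of "i - a + ?A"] Suc.hyps by (auto simp: h_def
                merge_last_def)
        qed (use hlt \<open>a \<le> t - 1\<close> in \<open>auto simp: h_def\<close>)
        have L: "lift_word a ?A (h g \<circ> u') \<in> rgw ?A (?A + d) ?A"
          using lift_word_rgw[OF rgw_comp[OF u' hr] Suc.hyps le_Suc_self le_refl]
          unfolding N'' diff_self_eq_0 add_0 .
        have "merge_last a ((g \<circ> ?v) i) = merge_last a (lift_word a ?A (h g \<circ> u') i)" if i: "i \<ge>
            ?A" for i
        proof -
          define l where "l = u' (i - ?A + a)"
          have 1: "?v i = lift_letter a ?A l" using i by (simp add: lift_word_def l_def)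
          have 2: "lift_word a ?A (h g \<circ> u') i = h g l"
            using i hlt[of l] by (simp add: lift_word_def l_def lift_letter_def)
          show ?thesis
          proof (cases "l < a")
            case True
            then show ?thesis using rgwD(1)[OF g, of l] unfolding comp_apply 1 2
              by (simp add: lift_letter_def h_def)
          next
            case False
            then show ?thesis unfolding comp_apply 1 2 by (simp add: lift_letter_def h_def
                merge_last_def)
          qed
        qed
        then show "\<chi> (g \<circ> (?v \<circ> u)) = \<chi> (lift_word a ?A (h g \<circ> u') \<circ> u)"
          using inv[OF rgw_comp[OF v g] L] by (simp add: o_assoc)
      qed
      have "\<chi> (g \<circ> (?v \<circ> u)) = \<chi> (g' \<circ> (?v \<circ> u))" if "g \<in> rgw ?A t ?A" "g' \<in> rgw ?A t ?A" for g g'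
        unfolding col[OF that(1)] col[OF that(2)] by (rule mono[OF h[OF that(1)] h[OF that(2)]])
      then show ?thesis using rgw_comp[OF u v] by blast
    qed
    then show "\<exists>N. \<forall>\<chi>. (\<forall>w. \<chi> w < k) \<longrightarrow>
       (\<exists>u\<in>rgw ?A N t. \<forall>g\<in>rgw ?A t ?A. \<forall>g'\<in>rgw ?A t ?A. \<chi> (g \<circ> u) = \<chi> (g' \<circ> u))" by blast
  qed
qed

section \<open>From Hales-Jewett to Graham-Rothschild by decreasing the number of constants\<close>

definition same_prefix :: "nat \<Rightarrow> nat \<Rightarrow> (nat \<Rightarrow> nat) \<Rightarrow> (nat \<Rightarrow> nat) \<Rightarrow> bool" where
  "same_prefix a q g g' \<longleftrightarrow> g q = a \<and> g' q = a \<and> (\<forall>i<q. g i = g' i \<and> g i < a)"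

text \<open>Positions \<open>a\<close> to \<open>p - 1\<close> carry only constants, which also
  stand at the beginning. Dropping them moves the first occurrence of \<open>a\<close> to position
  \<open>a\<close>, where it is one more fixed letter.\<close>

lemma comp_lift_letter_rgw:
  assumes g: "g \<in> rgw a L s" and a: "0 < a" "a \<le> p" "p < L"
    and p: "g p = a" "\<And>i. i < p \<Longrightarrow> g i < a"
  shows "g \<circ> lift_letter a p \<in> rgw (Suc a) (L - p + a) s"
proof (rule rgwI)
  let ?g = "g \<circ> lift_letter a p"
  have lo: "?g i = i" if "i < a" for i using rgwD(1)[OF g that] that by (simp add: lift_letter_def)
  have hi: "?g i = g (i - a + p)" if "a \<le> i" for i using that by (simp add: lift_letter_def)
  have late: "p \<le> i" if "a \<le> g i" for i using p(2)[of i] that by linarith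
  have s: "0 < s" using rgwD(3)[OF g \<open>p < L\<close>] by linarith
  show "?g i = i" if "i < Suc a" for i
    using lo[of i] hi[of i] p(1) that by (cases "i < a") (auto simp: less_Suc_eq)
  show "?g i = 0" if "L - p + a \<le> i" for i using hi[of i] rgwD(2)[OF g, of "i - a + p"] that a by
      auto
  show "?g i < s" for i using rgw_less[OF g s] by simp
  show "\<exists>i<L - p + a. ?g i = y" if y: "y < s" for y
  proof (cases "y < a")
    case True then show ?thesis using lo a by (intro exI[of _ y]) auto
  next
    case False
    obtain i where i: "i < L" "g i = y" using rgwD(4)[OF g y] by blast
    then have "p \<le> i" using late False by simp
    then show ?thesis using i hi[of "i - p + a"] by (intro exI[of _ "i - p + a"]) auto
  qed
  show "\<exists>j<i. ?g j = y" if y: "y < ?g i" for i y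
  proof (cases "y < a")
    case True
    then have "y < i" using y lo[of i] by (cases "i < a") auto
    then show ?thesis using lo[OF True] by blast
  next
    case False
    then have i: "a \<le> i" using y lo[of i] by (cases "i < a") auto
    then have "y < g (i - a + p)" using y hi by simp
    then obtain j where j: "j < i - a + p" "g j = y" using rgwD(5)[OF g] by blast
    then have "p \<le> j" using late False by simp
    then show ?thesis using j i hi[of "j - p + a"] by (intro exI[of _ "j - p + a"]) auto
  qed
qed

text \<open>
  The first occurrence of \<open>a\<close> turns it into one more constant, so once the prefix before it is
  fixed, \<open>word_ramsey (Suc a) s\<close> applies to the rest of the word; all prefixes are treated at once.
\<close>

lemma prefix_canonical_at:
  assumes wr: "word_ramsey (Suc a) s" and a: "0 < a" "a \<le> p" "p < L"
  shows "\<exists>N\<ge>L. \<forall>\<chi>. (\<forall>w. \<chi> w < (k::nat)) \<longrightarrow> (\<exists>u\<in>rgw (Suc p) N L.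
    \<forall>g\<in>rgw a L s. \<forall>g'\<in>rgw a L s. same_prefix a p g g' \<longrightarrow> \<chi> (g \<circ> u) = \<chi> (g' \<circ> u))"
proof -
  let ?t = "L - p + a"
  let ?X = "{x :: nat \<Rightarrow> nat. \<forall>i. (i \<in> {..<p} \<longrightarrow> x i \<in> {..<a}) \<and> (i \<notin> {..<p} \<longrightarrow> x i = 0)}"
  have X: "finite ?X" by (intro finite_set_of_finite_funs; simp)
  have "Suc a \<le> ?t" using a by simp
  then obtain N' where N': "?t \<le> N'"
    and ram: "\<forall>\<chi>. (\<forall>x w. \<chi> x w < k) \<longrightarrow> (\<exists>u\<in>rgw (Suc a) N' ?t. \<forall>x\<in>?X.
      \<forall>g\<in>rgw (Suc a) ?t s. \<forall>g'\<in>rgw (Suc a) ?t s. \<chi> x (g \<circ> u) = \<chi> x (g' \<circ> u))"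
    using word_ramsey_simultaneous[OF wr _ X, of ?t k] by (elim meta_impE exE conjE)
  let ?N = "N' - a + p"
  have "\<exists>u\<in>rgw (Suc p) ?N L. \<forall>g\<in>rgw a L s. \<forall>g'\<in>rgw a L s.
      same_prefix a p g g' \<longrightarrow> \<chi> (g \<circ> u) = \<chi> (g' \<circ> u)" if \<chi>: "\<forall>w. \<chi> w < k" for \<chi>
  proof -
    let ?\<chi> = "\<lambda>x w. \<chi> (\<lambda>i. if i < p then x i else w (i - p + a))"
    have "\<forall>x w. ?\<chi> x w < k" using \<chi> by simp
    from ram[THEN spec[of _ ?\<chi>], THEN mp, OF this] obtain u' where u': "u' \<in> rgw (Suc a) N' ?t"
      and mono: "\<And>x g g'. x \<in> ?X \<Longrightarrow> g \<in> rgw (Suc a) ?t s \<Longrightarrow> g' \<in> rgw (Suc a) ?t s \<Longrightarrow>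
        ?\<chi> x (g \<circ> u') = ?\<chi> x (g' \<circ> u')" by blast
    have u'a: "u' \<in> rgw a N' ?t" using rgw_anti[of a "Suc a"] u' by auto
    let ?u = "lift_word a p u'"
    have e: "?t - a + p = L" using a by simp
    have "a \<le> ?t" by simp
    then have up: "?u \<in> rgw p ?N L" using lift_word_rgw[OF u'a a(1,2)] unfolding e by blast
    have "?u p = p" using rgwD(1)[OF u', of a] by (simp add: lift_word_def lift_letter_def)
    then have u: "?u \<in> rgw (Suc p) ?N L" using up by (auto simp: rgw_def less_Suc_eq)
    have col: "\<chi> (g \<circ> ?u) = ?\<chi> (cut_word p g) ((g \<circ> lift_letter a p) \<circ> u')" for g
    proof -
      have "g \<circ> ?u = (\<lambda>i. if i < p then cut_word p g i else ((g \<circ> lift_letter a p) \<circ> u') (i - p +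
          a))"
        by (auto simp: fun_eq_iff cut_word_def lift_word_def)
      then show ?thesis by simp
    qed
    have "\<chi> (g \<circ> ?u) = \<chi> (g' \<circ> ?u)"
      if g: "g \<in> rgw a L s" and g': "g' \<in> rgw a L s" and eq: "same_prefix a p g g'" for g g'
    proof -
      have c: "cut_word p g = cut_word p g'" "cut_word p g \<in> ?X"
        using eq by (auto simp: same_prefix_def cut_word_def fun_eq_iff)
      have "g p = a" "g' p = a" "\<And>i. i < p \<Longrightarrow> g i < a" "\<And>i. i < p \<Longrightarrow> g' i < a"
        using eq unfolding same_prefix_def by auto
      then have "g \<circ> lift_letter a p \<in> rgw (Suc a) ?t s" "g' \<circ> lift_letter a p \<in> rgw (Suc a) ?t s"
        using comp_lift_letter_rgw[OF g a] comp_lift_letter_rgw[OF g' a] by blast+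
      from mono[OF c(2) this] show ?thesis unfolding col c(1)[symmetric] .
    qed
    then show ?thesis using u by blast
  qed
  moreover have "L \<le> ?N" using N' a by simp
  ultimately show ?thesis by blast
qed

text \<open>Positions can be treated one after another because the word that settles position
  \<open>p\<close> fixes the first \<open>p + 1\<close> positions, so substituting it leaves all
  shorter prefixes intact. The length changes on the way, hence the induction over arbitrary
  \<open>L\<close>.\<close>

lemma prefix_canonical:
  assumes wr: "word_ramsey (Suc a) s" and a: "0 < a" and p: "a \<le> p" "p \<le> L"
  shows "\<exists>N\<ge>L. \<forall>\<chi>. (\<forall>w. \<chi> w < (k::nat)) \<longrightarrow> (\<exists>u\<in>rgw a N L.
    \<forall>g\<in>rgw a L s. \<forall>g'\<in>rgw a L s. \<forall>q<p. same_prefix a q g g' \<longrightarrow> \<chi> (g \<circ> u) = \<chi> (g' \<circ> u))"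
  using p
proof (induction p arbitrary: L rule: dec_induct)
  case base
  have "\<not> same_prefix a q g g'" if "g \<in> rgw a L s" "q < a" for g g' q
    using rgwD(1)[OF that] that(2) by (simp add: same_prefix_def)
  then show ?case using idw_rgw[OF base] by (intro exI[of _ L]) auto
next
  case (step p)
  obtain n where n: "L \<le> n" and at: "\<forall>\<chi>. (\<forall>w. \<chi> w < k) \<longrightarrow> (\<exists>u\<in>rgw (Suc p) n L.
    \<forall>g\<in>rgw a L s. \<forall>g'\<in>rgw a L s. same_prefix a p g g' \<longrightarrow> \<chi> (g \<circ> u) = \<chi> (g' \<circ> u))"
    using prefix_canonical_at[OF wr a step.hyps(1), of L k] step.prems by auto
  have "p \<le> n" using n step.prems by simp
  then obtain N where N: "n \<le> N" and IH: "\<forall>\<chi>. (\<forall>w. \<chi> w < k) \<longrightarrow> (\<exists>u\<in>rgw a N n.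
    \<forall>g\<in>rgw a n s. \<forall>g'\<in>rgw a n s. \<forall>q<p. same_prefix a q g g' \<longrightarrow> \<chi> (g \<circ> u) = \<chi> (g' \<circ> u))"
    using step.IH by blast
  have "\<exists>u\<in>rgw a N L. \<forall>g\<in>rgw a L s. \<forall>g'\<in>rgw a L s. \<forall>q<Suc p.
      same_prefix a q g g' \<longrightarrow> \<chi> (g \<circ> u) = \<chi> (g' \<circ> u)" if \<chi>: "\<forall>w. \<chi> w < k" for \<chi>
  proof -
    obtain u1 where u1: "u1 \<in> rgw a N n" and m1: "\<And>g g' q. g \<in> rgw a n s \<Longrightarrow> g' \<in> rgw a n s \<Longrightarrow>
        q < p \<Longrightarrow> same_prefix a q g g' \<Longrightarrow> \<chi> (g \<circ> u1) = \<chi> (g' \<circ> u1)"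
      using IH[THEN spec, THEN mp, OF \<chi>] by blast
    have "\<forall>w. \<chi> (w \<circ> u1) < k" using \<chi> by simp
    from at[THEN spec[of _ "\<lambda>w. \<chi> (w \<circ> u1)"], THEN mp, OF this]
    obtain u2 where u2: "u2 \<in> rgw (Suc p) n L" and m2: "\<And>g g'. g \<in> rgw a L s \<Longrightarrow> g' \<in> rgw a L s \<Longrightarrow>
        same_prefix a p g g' \<Longrightarrow> \<chi> ((g \<circ> u2) \<circ> u1) = \<chi> ((g' \<circ> u2) \<circ> u1)" by blast
    have u2a: "u2 \<in> rgw a n L" using rgw_anti[of a "Suc p"] step.hyps u2 by auto
    have "\<chi> ((g \<circ> u2) \<circ> u1) = \<chi> ((g' \<circ> u2) \<circ> u1)"
      if g: "g \<in> rgw a L s" "g' \<in> rgw a L s" and q: "q < Suc p" "same_prefix a q g g'" for g g' q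
    proof (cases "q = p")
      case True then show ?thesis using m2 g q by blast
    next
      case False
      then have "same_prefix a q (g \<circ> u2) (g' \<circ> u2)"
        using q rgwD(1)[OF u2] by (auto simp: same_prefix_def)
      moreover have "q < p" using False q by simp
      ultimately show ?thesis by (intro m1[OF rgw_comp[OF u2a g(1)] rgw_comp[OF u2a g(2)]])
    qed
    then show ?thesis unfolding o_assoc[symmetric] using rgw_comp[OF u1 u2a] by blast
  qed
  moreover have "L \<le> N" using n N by simp
  ultimately show ?case by blast
qed

text \<open>
  The first occurrence of the last letter \<open>T\<close> is put right after a Hales--Jewett word for the
  prefixes before it; the earlier letters are handled inside that word.
\<close>

lemma prefix_ramsey:
  assumes a: "0 < a" and T: "a \<le> T"
  shows "\<exists>L\<ge>T. \<forall>\<psi>. (\<forall>d x. \<psi> d x < (k::nat)) \<longrightarrow> (\<exists>u\<in>rgw a L T. \<exists>c. \<forall>q g.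
    a \<le> u q \<longrightarrow> (\<forall>i<q. u i < u q) \<longrightarrow> (\<forall>i<a. g i = i) \<longrightarrow> (\<forall>i<u q. g i < a) \<longrightarrow>
    \<psi> q (cut_word q (g \<circ> u)) = c (u q))"
  using T
proof (induction T rule: dec_induct)
  case base
  have "\<not> a \<le> idw a q" for q using a by (simp add: idw_def)
  then show ?case using idw_rgw[of a a]
    by (intro exI[of _ a] conjI allI impI bexI[of _ "idw a"] exI[of _ "\<lambda>_. 0"]) auto
next
  case (step T)
  obtain L where L: "T \<le> L" and IH: "\<forall>\<psi>. (\<forall>d x. \<psi> d x < k) \<longrightarrow> (\<exists>u\<in>rgw a L T. \<exists>c. \<forall>q g.
    a \<le> u q \<longrightarrow> (\<forall>i<q. u i < u q) \<longrightarrow> (\<forall>i<a. g i = i) \<longrightarrow> (\<forall>i<u q. g i < a) \<longrightarrow>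
    \<psi> q (cut_word q (g \<circ> u)) = c (u q))"
    using step.IH by (elim exE conjE)
  have aL: "a \<le> L" using step.hyps L by simp
  obtain n where n: "\<forall>\<chi>. (\<forall>w. \<chi> w < k) \<longrightarrow>
     (\<exists>u\<in>rgw a n L. \<forall>g\<in>rgw a L a. \<forall>g'\<in>rgw a L a. \<chi> (g \<circ> u) = \<chi> (g' \<circ> u))" and Ln: "L \<le> n"
  proof -
    obtain n where "L \<le> n" "\<forall>\<chi> :: unit \<Rightarrow> _. (\<forall>x w. \<chi> x w < k) \<longrightarrow> (\<exists>u\<in>rgw a n L. \<forall>x\<in>{()}.
       \<forall>g\<in>rgw a L a. \<forall>g'\<in>rgw a L a. \<chi> x (g \<circ> u) = \<chi> x (g' \<circ> u))"
      using word_ramsey_simultaneous[OF hales_jewett[OF a] aL, of "{()}" k] by auto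
    moreover from this(2) have "\<forall>\<chi>. (\<forall>w. \<chi> w < k) \<longrightarrow>
     (\<exists>u\<in>rgw a n L. \<forall>g\<in>rgw a L a. \<forall>g'\<in>rgw a L a. \<chi> (g \<circ> u) = \<chi> (g' \<circ> u))"
      by (auto dest: spec[of _ "\<lambda>_. \<chi>" for \<chi>])
    ultimately show ?thesis using that by blast
  qed
  have "\<exists>u\<in>rgw a (Suc n) (Suc T). \<exists>c. \<forall>q g.
    a \<le> u q \<longrightarrow> (\<forall>i<q. u i < u q) \<longrightarrow> (\<forall>i<a. g i = i) \<longrightarrow> (\<forall>i<u q. g i < a) \<longrightarrow>
    \<psi> q (cut_word q (g \<circ> u)) = c (u q)" if \<psi>: "\<forall>d x. \<psi> d x < k" for \<psi>
  proof -
    have "\<forall>w. \<psi> n w < k" using \<psi> by simp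
    from n[THEN spec[of _ "\<psi> n"], THEN mp, OF this]
    obtain u1 where u1: "u1 \<in> rgw a n L"
      and mono: "\<And>g g'. g \<in> rgw a L a \<Longrightarrow> g' \<in> rgw a L a \<Longrightarrow> \<psi> n (g \<circ> u1) = \<psi> n (g' \<circ> u1)" by blast
    \<comment> \<open>Expanding a prefix that ends before position \<open>d\<close> through
      \<open>u1\<close> gives a prefix that ends before the first occurrence of the letter
      \<open>d\<close> in \<open>u1\<close>. The induction hypothesis is applied to the colouring
      pulled back in this way.\<close>
    define fo where "fo d = (LEAST i. u1 i = d)" for d
    let ?\<psi> = "\<lambda>d x. \<psi> (fo d) (cut_word (fo d) (x \<circ> u1))"
    have "\<forall>d x. ?\<psi> d x < k" using \<psi> by simp
    from IH[THEN spec[of _ ?\<psi>], THEN mp, OF this]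
    obtain u2 c where u2: "u2 \<in> rgw a L T"
      and c: "\<And>q g. a \<le> u2 q \<Longrightarrow> \<forall>i<q. u2 i < u2 q \<Longrightarrow> \<forall>i<a. g i = i \<Longrightarrow> \<forall>i<u2 q. g i < a \<Longrightarrow>
        \<psi> (fo q) (cut_word (fo q) (cut_word q (g \<circ> u2) \<circ> u1)) = c (u2 q)" by blast
    let ?v = "u2 \<circ> u1"
    have v: "?v \<in> rgw a n T" using rgw_comp[OF u1 u2] .
    have T0: "0 < T" using a step.hyps by simp
    have vlt: "?v i < T" for i using rgw_less[OF v T0] .
    define u where "u = ?v(n := T)"
    have u: "u \<in> rgw a (Suc n) (Suc T)"
    proof (rule rgwI)
      show "u i = i" if "i < a" for i using that rgwD(1)[OF v that] aL Ln by (simp add: u_def)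
      show "u i = 0" if "Suc n \<le> i" for i using that rgwD(2)[OF v, of i] by (simp add: u_def)
      show "u i < Suc T" for i using vlt[of i] by (auto simp: u_def)
      show "\<exists>i<Suc n. u i = y" if "y < Suc T" for y
      proof (cases "y = T")
        case False
        then obtain i where "i < n" "?v i = y" using rgwD(4)[OF v, of y] \<open>y < Suc T\<close> by auto
        then show ?thesis by (intro exI[of _ i]) (auto simp: u_def)
      qed (auto simp: u_def)
      show "\<exists>j<i. u j = y" if y: "y < u i" for i y
      proof (cases "i = n")
        case True
        then obtain l where "l < n" "?v l = y" using rgwD(4)[OF v, of y] y by (auto simp: u_def)
        then show ?thesis using True by (intro exI[of _ l]) (auto simp: u_def)
      next
        case False
        then have "u i = ?v i" "\<not> n \<le> i" using y rgwD(2)[OF v, of i] by (auto simp: u_def)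
        then have "u i = ?v i" "i < n" by auto
        then obtain j where "j < i" "?v j = y" using rgwD(5)[OF v, of y i] y by auto
        then show ?thesis using \<open>i < n\<close> by (intro exI[of _ j]) (auto simp: u_def)
      qed
    qed
    \<comment> \<open>The prefix before the new letter \<open>T\<close> is \<open>u1\<close> with
      constants substituted. By \<open>mono\<close> all of these have the same colour, and
      \<open>idw a\<close> serves as a sample.\<close>
    let ?c = "c(T := \<psi> n (idw a \<circ> u1))"
    have "\<psi> q (cut_word q (g \<circ> u)) = ?c (u q)"
      if q: "a \<le> u q" "\<forall>i<q. u i < u q" and g: "\<forall>i<a. g i = i" "\<forall>i<u q. g i < a" for q g
    proof -
      have "q \<le> n" using q(1) a rgwD(2)[OF u, of q] by (metis leD not_less_eq_eq)
      then consider "q = n" | "q < n" by linarith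
      then show ?thesis
      proof cases
        case 1
        have uq: "u q = T" using 1 by (simp add: u_def)
        have "cut_word T g \<in> rgw a T a"
        proof (rule const_rgwI)
          show "cut_word T g i < a" for i using g(2) uq a by (simp add: cut_word_def)
        qed (use g step.hyps in \<open>auto simp: cut_word_def\<close>)
        then have r: "cut_word T g \<circ> u2 \<in> rgw a L a" using rgw_comp[OF u2] by blast
        have "cut_word q (g \<circ> u) = (cut_word T g \<circ> u2) \<circ> u1"
        proof
          fix i show "cut_word q (g \<circ> u) i = ((cut_word T g \<circ> u2) \<circ> u1) i"
            using vlt[of i] 1 rgwD(2)[OF rgw_comp[OF u1 r], of i] by (auto simp: cut_word_def u_def)
        qed
        moreover have "idw a \<in> rgw a L a" using a aL by (intro const_rgwI) (auto simp: idw_def)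
        ultimately show ?thesis using mono[OF r] 1 uq by simp
      next
        case 2
        have ui: "u i = u2 (u1 i)" if "i \<le> q" for i using that 2 by (simp add: u_def)
        have ne: "u1 i \<noteq> u1 q" if "i < q" for i
        proof
          assume "u1 i = u1 q"
          then have "u i = u q" using ui[of i] ui[of q] that by simp
          then show False using q(2) that by force
        qed
        have lt: "u1 i < u1 q" if "i < q" for i using rgw_before_first[OF u1 ne that] by blast
        have fo: "fo (u1 q) = q" unfolding fo_def
          by (rule Least_equality) (use ne in \<open>auto intro: leI\<close>)
        have "u2 j < u2 (u1 q)" if j: "j < u1 q" for j
        proof -
          obtain i where "i < q" "u1 i = j" using rgwD(5)[OF u1 j] by blast
          then show ?thesis using q(2) ui[of i] ui[of q] by auto
        qed
        then have "\<psi> q (cut_word q (cut_word (u1 q) (g \<circ> u2) \<circ> u1)) = c (u2 (u1 q))"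
          using c[of "u1 q" g] q g ui[of q] fo by auto
        moreover have "cut_word q (cut_word (u1 q) (g \<circ> u2) \<circ> u1) = cut_word q (g \<circ> u)"
          using lt ui by (auto simp: cut_word_def fun_eq_iff)
        moreover have "u q \<noteq> T" using vlt[of q] ui[of q] by simp
        ultimately show ?thesis using ui[of q] by simp
      qed
    qed
    then show ?thesis using u by blast
  qed
  moreover have "Suc T \<le> Suc n" using L Ln by simp
  ultimately show ?case by blast
qed

text \<open>The parameters outside \<open>G\<close> are turned into constants and those in
  \<open>G\<close> are renumbered. Adding the largest element last gives it the next free letter, as
  the growth condition demands.\<close>

lemma select_letters:
  assumes "finite G" "0 < a" "a \<le> T" "G \<subseteq> {a..<T}"
  shows "\<exists>u\<in>rgw a T (a + card G). \<forall>i. a \<le> u i \<longrightarrow> i \<in> G"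
  using assms(1,4)
proof (induction G rule: finite_linorder_max_induct)
  case empty
  have "idw a \<in> rgw a T a" using assms by (intro const_rgwI) (auto simp: idw_def)
  then show ?case by (intro bexI[of _ "idw a"]) (auto simp: idw_def not_le \<open>0 < a\<close>)
next
  case (insert m G)
  then obtain u where u: "u \<in> rgw a T (a + card G)" and uG: "\<And>i. a \<le> u i \<Longrightarrow> i \<in> G" by auto
  have m: "a \<le> m" "m < T" "m \<notin> G" using insert by auto
  have card: "a + card (insert m G) = Suc (a + card G)" using insert m by simp
  let ?u = "u(m := a + card G)"
  have um: "u m < a" using uG[of m] m by (meson not_le)
  have ult: "u i < a + card G" for i using rgw_less[OF u] assms by simp
  have old: "\<exists>i<m. ?u i = y" if y: "y < a + card G" for y
  proof (cases "y < a")
    case True then show ?thesis using rgwD(1)[OF u True] m by (intro exI[of _ y]) auto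
  next
    case False
    then obtain i where "u i = y" "i \<in> G" using rgwD(4)[OF u y] uG by auto
    then show ?thesis using insert.hyps by (intro exI[of _ i]) auto
  qed
  have "?u \<in> rgw a T (Suc (a + card G))"
  proof (rule rgwI)
    show "?u i = i" if "i < a" for i using that m rgwD(1)[OF u that] by simp
    show "?u i = 0" if "T \<le> i" for i using that m rgwD(2)[OF u that] by simp
    show "?u i < Suc (a + card G)" for i using ult[of i] by auto
    show "\<exists>i<T. ?u i = y" if "y < Suc (a + card G)" for y
      using that old[of y] m by (cases "y = a + card G") (auto intro: less_trans)
    show "\<exists>j<i. ?u j = y" if y: "y < ?u i" for i y
    proof (cases "i = m")
      case True then show ?thesis using old y by simp
    next
      case False
      then obtain j where j: "j < i" "u j = y" using rgwD(5)[OF u, of y i] y by auto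
      show ?thesis
      proof (cases "j = m")
        case True
        then have "y < a" "y < i" using um j m by auto
        then show ?thesis using rgwD(1)[OF u, of y] m by (intro exI[of _ y]) auto
      next
        case False then show ?thesis using j by (intro exI[of _ j]) auto
      qed
    qed
  qed
  moreover have "i \<in> insert m G" if "a \<le> ?u i" for i using that uG[of i] by (auto split: if_splits)
  ultimately show ?case unfolding card by blast
qed

text \<open>The colour of a word is simplified by three substitutions: after \<open>u1\<close> it
  depends only on the prefix before the first occurrence of the letter \<open>a\<close>, after
  \<open>u2\<close> only on the parameter of \<open>u2\<close> before which this prefix ends, and
  \<open>u3\<close> keeps parameters of a single colour. Such a first occurrence exists because
  \<open>a < s\<close>.\<close>

lemma word_ramsey_step:
  assumes wr: "word_ramsey (Suc a) s" and a: "0 < a" "a < s"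
  shows "word_ramsey a s"
  unfolding word_ramsey_def
proof (intro allI impI)
  fix k t :: nat assume t: "a \<le> t"
  \<comment> \<open>Pigeonhole: among \<open>k * (t - a)\<close> parameters in \<open>k\<close>
    colours, some \<open>t - a\<close> share a colour.\<close>
  define T where "T = a + k * (t - a)"
  have "a \<le> T" by (simp add: T_def)
  obtain L where L: "T \<le> L" and Q: "\<forall>\<psi>. (\<forall>d x. \<psi> d x < k) \<longrightarrow> (\<exists>u\<in>rgw a L T. \<exists>c. \<forall>q g.
    a \<le> u q \<longrightarrow> (\<forall>i<q. u i < u q) \<longrightarrow> (\<forall>i<a. g i = i) \<longrightarrow> (\<forall>i<u q. g i < a) \<longrightarrow>
    \<psi> q (cut_word q (g \<circ> u)) = c (u q))"
    using prefix_ramsey[OF a(1) \<open>a \<le> T\<close>, of k] by (elim exE conjE)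
  have "a \<le> L" using \<open>a \<le> T\<close> L by simp
  obtain N where R: "\<forall>\<chi>. (\<forall>w. \<chi> w < k) \<longrightarrow> (\<exists>u\<in>rgw a N L.
    \<forall>g\<in>rgw a L s. \<forall>g'\<in>rgw a L s. \<forall>q<L. same_prefix a q g g' \<longrightarrow> \<chi> (g \<circ> u) = \<chi> (g' \<circ> u))"
    using prefix_canonical[OF wr a(1) \<open>a \<le> L\<close> order_refl, of k] by (elim exE conjE)
  have "\<exists>u\<in>rgw a N t. \<forall>g\<in>rgw a t s. \<forall>g'\<in>rgw a t s. \<chi> (g \<circ> u) = \<chi> (g' \<circ> u)"
    if \<chi>: "\<forall>w. \<chi> w < k" for \<chi>
  proof -
    obtain u1 where u1: "u1 \<in> rgw a N L" and m1: "\<And>g g' q. g \<in> rgw a L s \<Longrightarrow> g' \<in> rgw a L s \<Longrightarrow>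
        q < L \<Longrightarrow> same_prefix a q g g' \<Longrightarrow> \<chi> (g \<circ> u1) = \<chi> (g' \<circ> u1)"
      using R[THEN spec, THEN mp, OF \<chi>] by blast
    define extends where "extends q x h \<longleftrightarrow> h \<in> rgw a L s \<and> h q = a \<and> (\<forall>i<q. h i = x i \<and> h i < a)"
        for q x h
    \<comment> \<open>The colour of a prefix is that of an arbitrary extension; by \<open>m1\<close>
      the choice is irrelevant. A prefix without extension receives some colour below
      \<open>k\<close>, which is all that \<open>Q\<close> asks for.\<close>
    define ext where "ext q x = (SOME h. extends q x h)" for q x
    let ?\<psi> = "\<lambda>q x. \<chi> (ext q x \<circ> u1)"
    have "\<forall>d x. ?\<psi> d x < k" using \<chi> by simp
    from Q[THEN spec[of _ ?\<psi>], THEN mp, OF this]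
    obtain u2 c where u2: "u2 \<in> rgw a L T"
      and c: "\<And>q g. a \<le> u2 q \<Longrightarrow> \<forall>i<q. u2 i < u2 q \<Longrightarrow> \<forall>i<a. g i = i \<Longrightarrow> \<forall>i<u2 q. g i < a \<Longrightarrow>
        \<chi> (ext q (cut_word q (g \<circ> u2)) \<circ> u1) = c (u2 q)" by blast
    have ck: "c p < k" if "a \<le> p" "p < T" for p
    proof -
      obtain q where q: "u2 q = p" "\<And>i. i < q \<Longrightarrow> u2 i < p" using rgw_first[OF u2 \<open>p < T\<close>] by blast
      have "c p = \<chi> (ext q (cut_word q (idw a \<circ> u2)) \<circ> u1)"
        using c[of q "idw a"] q that a by (auto simp: idw_def)
      then show ?thesis using \<chi> by simp
    qed
    obtain \<kappa> where \<kappa>: "t - a \<le> card {p \<in> {a..<T}. c p = \<kappa>}"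
    proof (rule ccontr)
      assume "\<not> thesis"
      then have small: "card {p \<in> {a..<T}. c p = \<kappa>} < t - a" for \<kappa> using that by (meson not_le)
      have "0 < k" using \<chi> by (metis gr_zeroI not_less_zero)
      have "{a..<T} = (\<Union>\<kappa><k. {p \<in> {a..<T}. c p = \<kappa>})" using ck by auto
      then have "card {a..<T} = card (\<Union>\<kappa><k. {p \<in> {a..<T}. c p = \<kappa>})" by (rule arg_cong)
      also have "\<dots> \<le> (\<Sum>\<kappa><k. card {p \<in> {a..<T}. c p = \<kappa>})"
        by (rule card_UN_le) (rule finite_lessThan)
      also have "\<dots> < of_nat (card {..<k}) * (t - a)"
        using small \<open>0 < k\<close> by (intro sum_bounded_above_strict) auto
      finally show False by (simp add: T_def)
    qed
    then obtain G where G: "G \<subseteq> {p \<in> {a..<T}. c p = \<kappa>}" "card G = t - a" "finite G"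
      by (rule obtain_subset_with_card_n)
    have "G \<subseteq> {a..<T}" using G by auto
    from select_letters[OF G(3) a(1) \<open>a \<le> T\<close> this]
    obtain u3 where u3: "u3 \<in> rgw a T t" and uG: "\<And>i. a \<le> u3 i \<Longrightarrow> i \<in> G" using G(2) t by auto
    have "\<chi> (((g \<circ> u3) \<circ> u2) \<circ> u1) = \<kappa>" if g: "g \<in> rgw a t s" for g
    proof -
      let ?g3 = "g \<circ> u3"
      let ?h = "?g3 \<circ> u2"
      have g3: "?g3 \<in> rgw a T s" using rgw_comp[OF u3 g] .
      have h: "?h \<in> rgw a L s" using rgw_comp[OF u2 g3] .
      obtain q where q: "q < L" "?h q = a" "\<And>i. i < q \<Longrightarrow> ?h i < a" using rgw_first[OF h a(2)] by
          blast
      let ?p = "u2 q"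
      have ne: "u2 i \<noteq> u2 q" if "i < q" for i using q(2) q(3)[OF that] by auto
      have lt: "\<forall>i<q. u2 i < u2 q" using rgw_before_first[OF u2 ne] by blast
      have below: "\<forall>i<?p. ?g3 i < a"
      proof (intro allI impI)
        fix i assume "i < ?p"
        then obtain j where "j < q" "u2 j = i" using rgwD(5)[OF u2] by blast
        then show "?g3 i < a" using q(3)[of j] by auto
      qed
      \<comment> \<open>If \<open>u3\<close> turned \<open>?p\<close> into a constant,
        \<open>g\<close> would fix it and the value at \<open>q\<close> would be below
        \<open>a\<close>.\<close>
      have ap: "a \<le> u3 ?p"
      proof (rule ccontr)
        assume "\<not> a \<le> u3 ?p"
        then show False using q(2) rgwD(1)[OF g, of "u3 ?p"] by simp
      qed
      then have "?p \<in> G" using uG by blast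
      then have p: "a \<le> ?p" "c ?p = \<kappa>" using G by auto
      let ?e = "ext q (cut_word q ?h)"
      have "\<chi> (?e \<circ> u1) = \<kappa>" using c[of q ?g3] p lt below rgwD(1)[OF g3] by blast
      moreover have "extends q (cut_word q ?h) ?h" using h q by (simp add: cut_word_def extends_def)
      then have e: "extends q (cut_word q ?h) ?e" unfolding ext_def by (rule someI[of "extends q
          (cut_word q ?h)"])
      then have "same_prefix a q ?h ?e" "?e \<in> rgw a L s"
        using q unfolding same_prefix_def extends_def cut_word_def by auto
      then have "\<chi> (?h \<circ> u1) = \<chi> (?e \<circ> u1)" using m1[OF h _ q(1)] by blast
      ultimately show ?thesis by simp
    qed
    then have "\<chi> (g \<circ> (u3 \<circ> (u2 \<circ> u1))) = \<kappa>" if "g \<in> rgw a t s" for g using that by (simp add: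
        o_assoc)
    moreover have "u3 \<circ> (u2 \<circ> u1) \<in> rgw a N t" by (intro rgw_comp[OF _ u3] rgw_comp[OF u1 u2])
    ultimately show ?thesis by (intro bexI[of _ "u3 \<circ> (u2 \<circ> u1)"]) simp
  qed
  then show "\<exists>N. \<forall>\<chi>. (\<forall>w. \<chi> w < k) \<longrightarrow>
     (\<exists>u\<in>rgw a N t. \<forall>g\<in>rgw a t s. \<forall>g'\<in>rgw a t s. \<chi> (g \<circ> u) = \<chi> (g' \<circ> u))" by blast
qed

text \<open>Downward induction on the number of constants, starting at \<open>a = s\<close>, where
  there are no parameters left in \<open>g\<close>.\<close>

theorem graham_rothschild:
  assumes "0 < a" "a \<le> s"
  shows "word_ramsey a s"
  using assms(2,1)
proof (induction rule: inc_induct)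
  case base
  then show ?case by (rule hales_jewett)
next
  case (step n)
  show ?case by (rule word_ramsey_step[OF step.IH step.prems step.hyps(2)]) simp
qed


section \<open>Ranks in finite chains\<close>

definition rank :: "'a rel \<Rightarrow> 'a set \<Rightarrow> 'a \<Rightarrow> nat" where
  "rank L e x = card {y\<in>e. (y, x) \<in> L}"

definition nth_elt :: "'a rel \<Rightarrow> 'a set \<Rightarrow> nat \<Rightarrow> 'a" where
  "nth_elt L e = inv_into e (rank L e)"

lemma chain_asym: "fin_chain A L \<Longrightarrow> (x, y) \<in> L \<Longrightarrow> (y, x) \<notin> L"
  using fin_chainD(3,4) by (metis irreflD transD)

lemma chain_irrefl: "fin_chain A L \<Longrightarrow> (x, x) \<notin> L"
  using fin_chainD(4) by (metis irreflD)

lemma rank_less_iff: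
  assumes L: "fin_chain A L" "e \<subseteq> A" and xy: "x \<in> e" "y \<in> e"
  shows "rank L e x < rank L e y \<longleftrightarrow> (x, y) \<in> L"
proof -
  have fin: "finite e" using fin_chainD(1)[OF L(1)] L(2) finite_subset by blast
  have mono: "rank L e x < rank L e y" if "x \<in> e" "(x, y) \<in> L" for x y
  proof -
    have "{z\<in>e. (z, x) \<in> L} \<subset> {z\<in>e. (z, y) \<in> L}"
      using that transD[OF fin_chainD(3)[OF L(1)], of _ x y] chain_irrefl[OF L(1)] by blast
    then show ?thesis unfolding rank_def using fin by (intro psubset_card_mono) auto
  qed
  show ?thesis
  proof
    assume less: "rank L e x < rank L e y"
    show "(x, y) \<in> L"
    proof (rule ccontr)
      assume "(x, y) \<notin> L"
      moreover have "x \<noteq> y" using less by auto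
      ultimately have "(y, x) \<in> L" using fin_chainD(5)[OF L(1)] L(2) xy unfolding total_on_def by
          blast
      then show False using mono[OF xy(2)] less by fastforce
    qed
  qed (use mono xy in blast)
qed

lemma rank_bij:
  assumes L: "fin_chain A L" "e \<subseteq> A"
  shows "bij_betw (rank L e) e {..<card e}"
proof -
  have fin: "finite e" using fin_chainD(1)[OF L(1)] L(2) finite_subset by blast
  have inj: "inj_on (rank L e) e"
  proof (rule inj_onI, rule ccontr)
    fix x y assume xy: "x \<in> e" "y \<in> e" "rank L e x = rank L e y" "x \<noteq> y"
    then have "(x, y) \<in> L \<or> (y, x) \<in> L" using fin_chainD(5)[OF L(1)] L(2) unfolding total_on_def
        by blast
    then show False using rank_less_iff[OF L] xy by fastforce
  qed
  have "rank L e x < card e" if "x \<in> e" for x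
  proof -
    have "{y\<in>e. (y, x) \<in> L} \<subset> e" using that chain_irrefl[OF L(1)] by blast
    then show ?thesis unfolding rank_def using fin by (intro psubset_card_mono)
  qed
  then have "rank L e ` e \<subseteq> {..<card e}" by auto
  then have "rank L e ` e = {..<card e}" using card_image[OF inj] by (intro card_subset_eq) auto
  then show ?thesis using inj by (simp add: bij_betw_def)
qed

lemma rank_lt: "fin_chain A L \<Longrightarrow> e \<subseteq> A \<Longrightarrow> x \<in> e \<Longrightarrow> rank L e x < card e"
  using bij_betwE[OF rank_bij] by fastforce

lemma
  assumes L: "fin_chain A L" "e \<subseteq> A"
  shows nth_elt_in: "\<And>j. j < card e \<Longrightarrow> nth_elt L e j \<in> e"
    and rank_nth_elt: "\<And>j. j < card e \<Longrightarrow> rank L e (nth_elt L e j) = j"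
    and nth_elt_rank: "\<And>x. x \<in> e \<Longrightarrow> nth_elt L e (rank L e x) = x"
proof -
  note b = rank_bij[OF L]
  have im: "rank L e ` e = {..<card e}" using b by (rule bij_betw_imp_surj_on)
  show "nth_elt L e j \<in> e" "rank L e (nth_elt L e j) = j" if "j < card e" for j
    unfolding nth_elt_def using inv_into_into[of j "rank L e" e] f_inv_into_f[of j "rank L e" e]
        that im
    by auto
  show "nth_elt L e (rank L e x) = x" if "x \<in> e" for x
    unfolding nth_elt_def using bij_betw_imp_inj_on[OF b] that by (rule inv_into_f_f)
qed

lemma nth_elt_less:
  assumes L: "fin_chain A L" "e \<subseteq> A" and "i < card e" "j < card e"
  shows "(nth_elt L e i, nth_elt L e j) \<in> L \<longleftrightarrow> i < j"
  using rank_less_iff[OF L nth_elt_in[OF L assms(3)] nth_elt_in[OF L assms(4)]]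
    rank_nth_elt[OF L assms(3)] rank_nth_elt[OF L assms(4)] by simp

lemma nth_elt_singleton: "fin_chain A L \<Longrightarrow> a \<in> A \<Longrightarrow> nth_elt L {a} 0 = a"
  using nth_elt_in[of A L "{a}" 0] by simp

text \<open>A strictly increasing map is injective and carries the elements of \<open>e\<close>
  below \<open>x\<close> exactly onto those of the image below \<open>f x\<close>, so ranks are
  preserved.\<close>

lemma strict_mono_image:
  assumes L: "fin_chain A L" "e \<subseteq> A" and M: "fin_chain B M" "f ` e \<subseteq> B"
    and mono: "\<And>x y. x \<in> e \<Longrightarrow> y \<in> e \<Longrightarrow> (x, y) \<in> L \<Longrightarrow> (f x, f y) \<in> M"
  shows "card (f ` e) = card e"
    and "\<And>x. x \<in> e \<Longrightarrow> rank M (f ` e) (f x) = rank L e x"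
    and "\<And>j. j < card e \<Longrightarrow> nth_elt M (f ` e) j = f (nth_elt L e j)"
proof -
  have tot: "(x, y) \<in> L \<or> (y, x) \<in> L" if "x \<in> e" "y \<in> e" "x \<noteq> y" for x y
    using fin_chainD(5)[OF L(1)] L(2) that unfolding total_on_def by blast
  have inj: "inj_on f e"
  proof (rule inj_onI, rule ccontr)
    fix x y assume xy: "x \<in> e" "y \<in> e" "f x = f y" "x \<noteq> y"
    then have "(f x, f y) \<in> M \<or> (f y, f x) \<in> M" using mono tot by blast
    then show False using xy(3) chain_irrefl[OF M(1)] by simp
  qed
  then show "card (f ` e) = card e" by (rule card_image)
  show rank: "rank M (f ` e) (f x) = rank L e x" if x: "x \<in> e" for x
  proof -
    have "{y \<in> f ` e. (y, f x) \<in> M} = f ` {y\<in>e. (y, x) \<in> L}"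
    proof (intro equalityI subsetI)
      fix z assume "z \<in> {y \<in> f ` e. (y, f x) \<in> M}"
      then obtain y where y: "y \<in> e" "z = f y" "(f y, f x) \<in> M" by blast
      have "y \<noteq> x" using y(3) chain_irrefl[OF M(1)] by auto
      moreover have "(x, y) \<notin> L" using mono[OF x y(1)] chain_asym[OF M(1) y(3)] by blast
      ultimately have "(y, x) \<in> L" using tot[OF y(1) x] by blast
      then show "z \<in> f ` {y\<in>e. (y, x) \<in> L}" using y by blast
    qed (use mono x in blast)
    moreover have "inj_on f {y\<in>e. (y, x) \<in> L}" using inj by (rule inj_on_subset) auto
    ultimately show ?thesis unfolding rank_def by (simp add: card_image)
  qed
  show "nth_elt M (f ` e) j = f (nth_elt L e j)" if "j < card e" for j
    using nth_elt_rank[OF M, of "f (nth_elt L e j)"] rank[OF nth_elt_in[OF L that]]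
      rank_nth_elt[OF L that] nth_elt_in[OF L that] by simp
qed


section \<open>The dual Ramsey theorem for finite chains\<close>

text \<open>The growth condition of words for arbitrary relations. Unlike \<open>rigid_surj\<close>
  it mentions no minima, so it composes without further assumptions; if the domain is a finite
  chain, the two notions agree.\<close>

definition chain_surj :: "'a set \<Rightarrow> 'a rel \<Rightarrow> 'b set \<Rightarrow> 'b rel \<Rightarrow> ('a \<Rightarrow> 'b) \<Rightarrow> bool" where
  "chain_surj X L Y M f \<longleftrightarrow> f ` X = Y \<and>
     (\<forall>x\<in>X. \<forall>y\<in>Y. (y, f x) \<in> M \<longrightarrow> (\<exists>x'\<in>X. (x', x) \<in> L \<and> f x' = y))"

lemma chain_surj_comp:
  assumes f: "chain_surj X L Y M f" and g: "chain_surj Y M Z N g"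
  shows "chain_surj X L Z N (g \<circ> f)"
  unfolding chain_surj_def
proof (intro conjI ballI impI)
  show "(g \<circ> f) ` X = Z" using f g unfolding chain_surj_def image_comp[symmetric] by simp
  fix x z assume "x \<in> X" "z \<in> Z" "(z, (g \<circ> f) x) \<in> N"
  moreover then have "f x \<in> Y" using f unfolding chain_surj_def by blast
  ultimately obtain y where "y \<in> Y" "(y, f x) \<in> M" "g y = z"
    using g unfolding chain_surj_def by (metis comp_apply)
  then obtain x' where "x' \<in> X" "(x', x) \<in> L" "f x' = y"
    using f \<open>x \<in> X\<close> unfolding chain_surj_def by blast
  then show "\<exists>x'\<in>X. (x', x) \<in> L \<and> (g \<circ> f) x' = z" using \<open>g y = z\<close> by auto
qed

lemma rigid_surj_imp_chain_surj:
  assumes f: "rigid_surj X L Y M f" and L: "trans L" "irrefl L"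
    and min: "\<And>y. y \<in> Y \<Longrightarrow> \<exists>m\<in>fibre X f y. \<forall>x\<in>fibre X f y. x \<noteq> m \<longrightarrow> (m, x) \<in> L"
  shows "chain_surj X L Y M f"
  unfolding chain_surj_def
proof (intro conjI ballI impI)
  show im: "f ` X = Y" using f by (simp add: rigid_surj_def)
  fix x y assume x: "x \<in> X" and y: "y \<in> Y" "(y, f x) \<in> M"
  have fx: "f x \<in> Y" using im x by blast
  obtain m where m: "m \<in> fibre X f y" "\<And>x. x \<in> fibre X f y \<Longrightarrow> x \<noteq> m \<Longrightarrow> (m, x) \<in> L"
    using min[OF y(1)] by blast
  obtain n where n: "n \<in> fibre X f (f x)" "\<And>z. z \<in> fibre X f (f x) \<Longrightarrow> z \<noteq> n \<Longrightarrow> (n, z) \<in> L"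
    using min[OF fx] by blast
  have "rel_min L (fibre X f y) = m" "rel_min L (fibre X f (f x)) = n"
    using rel_min_eq[OF L m] rel_min_eq[OF L n] by auto
  then have "(m, n) \<in> L" using f y fx unfolding rigid_surj_def by blast
  moreover have "x = n \<or> (n, x) \<in> L" using n(2)[of x] x by (auto simp: fibre_def)
  ultimately have "(m, x) \<in> L" using transD[OF L(1)] by blast
  then show "\<exists>x'\<in>X. (x', x) \<in> L \<and> f x' = y" using m(1) by (auto simp: fibre_def)
qed

lemma chain_surj_imp_rigid_surj:
  assumes L: "fin_chain X L" and f: "chain_surj X L Y M f"
  shows "rigid_surj X L Y M f"
  unfolding rigid_surj_def
proof (intro conjI ballI impI)
  show im: "f ` X = Y" using f by (simp add: chain_surj_def)
  fix x y assume xy: "x \<in> Y" "y \<in> Y" "(x, y) \<in> M"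
  note tr = fin_chainD(3)[OF L] and ir = fin_chainD(4)[OF L]
  obtain m where m: "m \<in> fibre X f x" "\<And>z. z \<in> fibre X f x \<Longrightarrow> z \<noteq> m \<Longrightarrow> (m, z) \<in> L"
    using fibre_min[OF L im xy(1)] by blast
  obtain n where n: "n \<in> fibre X f y" "\<And>z. z \<in> fibre X f y \<Longrightarrow> z \<noteq> n \<Longrightarrow> (n, z) \<in> L"
    using fibre_min[OF L im xy(2)] by blast
  have "n \<in> X" "f n = y" using n by (auto simp: fibre_def)
  then obtain x' where x': "x' \<in> X" "(x', n) \<in> L" "f x' = x" using f xy unfolding chain_surj_def
      by blast
  then have "x' = m \<or> (m, x') \<in> L" using m(2)[of x'] by (auto simp: fibre_def)
  then have "(m, n) \<in> L" using x'(2) transD[OF tr] by blast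
  then show "(rel_min L (fibre X f x), rel_min L (fibre X f y)) \<in> L"
    using rel_min_eq[OF tr ir m] rel_min_eq[OF tr ir n] by simp
qed

text \<open>Ranks translate surjections of chains into words. Taking one constant is no restriction,
  because a word of restricted growth starts with \<open>0\<close> anyway.\<close>

theorem chain_ramsey:
  assumes X: "fin_chain X L" "X \<noteq> {}" and Y: "fin_chain Y M" "Y \<noteq> {}"
  shows "\<exists>N::nat. 0 < N \<and> (\<forall>\<chi>. (\<forall>w. \<chi> w < (k::nat)) \<longrightarrow>
    (\<exists>u. chain_surj {..<N} {(i, j). i < j} Y M u \<and>
      (\<forall>g g'. chain_surj Y M X L g \<longrightarrow> chain_surj Y M X L g' \<longrightarrow> \<chi> (g \<circ> u) = \<chi> (g' \<circ> u))))"
proof -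
  let ?s = "card X" and ?t = "card Y"
  have pos: "0 < ?s" "0 < ?t" using X Y fin_chainD(1) by (auto simp: card_gt_0_iff)
  have "word_ramsey 1 ?s" using pos by (intro graham_rothschild) auto
  moreover have "1 \<le> ?t" using pos by simp
  ultimately obtain N where N: "?t \<le> N" "\<forall>\<chi> :: unit \<Rightarrow> _. (\<forall>x w. \<chi> x w < k) \<longrightarrow> (\<exists>u\<in>rgw 1 N ?t.
       \<forall>x\<in>{()}. \<forall>g\<in>rgw 1 ?t ?s. \<forall>g'\<in>rgw 1 ?t ?s. \<chi> x (g \<circ> u) = \<chi> x (g' \<circ> u))"
    using word_ramsey_simultaneous[of 1 ?s ?t "{()}" k] by auto
  let ?eX = "nth_elt L X" and ?eY = "nth_elt M Y"
  have main: "\<exists>u. chain_surj {..<N} {(i, j). i < j} Y M u \<and>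
      (\<forall>g g'. chain_surj Y M X L g \<longrightarrow> chain_surj Y M X L g' \<longrightarrow> \<chi> (g \<circ> u) = \<chi> (g' \<circ> u))"
    if \<chi>: "\<forall>w. \<chi> w < k" for \<chi>
  proof -
    let ?\<chi> = "\<lambda>(_::unit) w. \<chi> (?eX \<circ> w)"
    have "\<forall>x w. ?\<chi> x w < k" using \<chi> by simp
    from N(2)[THEN spec[of _ ?\<chi>], THEN mp, OF this]
    obtain v where v: "v \<in> rgw 1 N ?t" and mono: "\<And>g g'. g \<in> rgw 1 ?t ?s \<Longrightarrow> g' \<in> rgw 1 ?t ?s \<Longrightarrow>
      \<chi> (?eX \<circ> (g \<circ> v)) = \<chi> (?eX \<circ> (g' \<circ> v))" by blast
    have vlt: "v i < ?t" for i using rgw_less[OF v pos(2)] .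
    let ?u = "?eY \<circ> v"
    have u: "chain_surj {..<N} {(i, j). i < j} Y M ?u" unfolding chain_surj_def
    proof (intro conjI ballI impI)
      show "?u ` {..<N} = Y"
      proof (intro equalityI subsetI)
        fix y assume y: "y \<in> Y"
        obtain i where "i < N" "v i = rank M Y y"
          using rgwD(4)[OF v rank_lt[OF Y(1) order_refl y]] by blast
        then show "y \<in> ?u ` {..<N}"
          using nth_elt_rank[OF Y(1) order_refl y] by (intro image_eqI[of _ _ i]) auto
      qed (use nth_elt_in[OF Y(1) order_refl vlt] in auto)
      fix n y assume n: "n \<in> {..<N}" and y: "y \<in> Y" "(y, ?u n) \<in> M"
      have "rank M Y y < v n"
        using rank_less_iff[OF Y(1) order_refl y(1) nth_elt_in[OF Y(1) order_refl vlt]]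
          rank_nth_elt[OF Y(1) order_refl vlt] y(2) by simp
      then obtain j where "j < n" "v j = rank M Y y" using rgwD(5)[OF v] by blast
      then show "\<exists>n'\<in>{..<N}. (n', n) \<in> {(i, j). i < j} \<and> ?u n' = y"
        using n nth_elt_rank[OF Y(1) order_refl y(1)] by (intro bexI[of _ j]) auto
    qed
    define wd where "wd g i = (if i < ?t then rank L X (g (?eY i)) else 0)" for g i
    have wd: "wd g \<in> rgw 1 ?t ?s" "g \<circ> ?u = ?eX \<circ> (wd g \<circ> v)" if g: "chain_surj Y M X L g" for g
    proof -
      have gX: "g (?eY i) \<in> X" if "i < ?t" for i
        using g nth_elt_in[OF Y(1) order_refl that] unfolding chain_surj_def by blast
      have "wd g \<in> rgw 0 ?t ?s"
      proof (rule rgwI)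
        show "wd g i < ?s" if "i < ?t" for i using that rank_lt[OF X(1) order_refl gX[OF that]] by
            (simp add: wd_def)
        show "\<exists>i<?t. wd g i = x" if x: "x < ?s" for x
        proof -
          have "?eX x \<in> X" using nth_elt_in[OF X(1) order_refl x] .
          then obtain y where y: "y \<in> Y" "g y = ?eX x" using g unfolding chain_surj_def by (metis
              imageE)
          then show ?thesis
            using rank_lt[OF Y(1) order_refl y(1)] nth_elt_rank[OF Y(1) order_refl y(1)]
              rank_nth_elt[OF X(1) order_refl x]
            by (intro exI[of _ "rank M Y y"]) (simp add: wd_def)
        qed
        show "\<exists>j<i. wd g j = x" if x: "x < wd g i" for i x
        proof -
          have i: "i < ?t" "x < rank L X (g (?eY i))" using x by (auto simp: wd_def split:
              if_splits)
          have xs: "x < ?s" using i(2) rank_lt[OF X(1) order_refl gX[OF i(1)]] by simp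
          have eX: "?eX x \<in> X" using nth_elt_in[OF X(1) order_refl xs] .
          then have "(?eX x, g (?eY i)) \<in> L"
            using rank_less_iff[OF X(1) order_refl eX gX[OF i(1)]] rank_nth_elt[OF X(1) order_refl
                xs] i(2) by simp
          then obtain y where y: "y \<in> Y" "(y, ?eY i) \<in> M" "g y = ?eX x"
            using g eX nth_elt_in[OF Y(1) order_refl i(1)] unfolding chain_surj_def by blast
          have "rank M Y y < i"
            using rank_less_iff[OF Y(1) order_refl y(1) nth_elt_in[OF Y(1) order_refl i(1)]] y(2)
              rank_nth_elt[OF Y(1) order_refl i(1)] by simp
          then show ?thesis
            using rank_lt[OF Y(1) order_refl y(1)] nth_elt_rank[OF Y(1) order_refl y(1)]
              rank_nth_elt[OF X(1) order_refl xs] y(3)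
            by (intro exI[of _ "rank M Y y"]) (simp add: wd_def)
        qed
      qed (simp_all add: wd_def)
      then show "wd g \<in> rgw 1 ?t ?s" using rgw_zero[of "wd g" 0] by (auto simp: rgw_def)
      show "g \<circ> ?u = ?eX \<circ> (wd g \<circ> v)"
        using vlt nth_elt_rank[OF X(1) order_refl gX[OF vlt]] by (auto simp: wd_def fun_eq_iff)
    qed
    have "\<chi> (g \<circ> ?u) = \<chi> (g' \<circ> ?u)" if "chain_surj Y M X L g" "chain_surj Y M X L g'" for g g'
      unfolding wd(2)[OF that(1)] wd(2)[OF that(2)] by (rule mono[OF wd(1)[OF that(1)] wd(1)[OF
          that(2)]])
    then show ?thesis using u by blast
  qed
  have "0 < N" using N(1) pos(2) by simp
  then show ?thesis using main by blast
qed


section \<open>Patterns of tuples\<close>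

text \<open>A list with the same information as \<open>tp\<close>. Its entries are ranks, so they
  can serve as vertex numbers when an edge is built from scratch.\<close>

definition pat :: "'a rel \<Rightarrow> 'a list \<Rightarrow> nat list" where
  "pat L a = map (rank L (set a)) a"

lemma tuplesD:
  assumes "a \<in> tuples A r"
  shows "length a = r" "set a \<subseteq> A" "\<And>i. i < r \<Longrightarrow> a ! i \<in> A" "\<And>i. i < r \<Longrightarrow> a ! i \<in> set a"
  using assms nth_mem[of _ a] by (auto simp: tuples_def)

lemma tp_iff:
  assumes L: "fin_chain A L" and a: "a \<in> tuples A r"
  shows "(i, j) \<in> tp L a \<longleftrightarrow> i < r \<and> j < r \<and> (a ! j, a ! i) \<notin> L"
proof (cases "i < r \<and> j < r")
  case True
  then have "a ! i \<in> A" "a ! j \<in> A" using tuplesD(3)[OF a] by auto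
  then have "a ! i = a ! j \<or> (a ! i, a ! j) \<in> L \<or> (a ! j, a ! i) \<in> L"
    using fin_chainD(5)[OF L] unfolding total_on_def by blast
  then show ?thesis
    using chain_asym[OF L, of "a ! i" "a ! j"] chain_irrefl[OF L, of "a ! j"] tuplesD(1)[OF a] True
    by (auto simp: tp_def)
qed (auto simp: tp_def tuplesD(1)[OF a])

lemma pat_nth: "i < length a \<Longrightarrow> pat L a ! i = rank L (set a) (a ! i)"
  by (simp add: pat_def)

lemma pat_length [simp]: "length (pat L a) = length a"
  by (simp add: pat_def)

lemma set_pat:
  assumes "fin_chain A L" "set a \<subseteq> A"
  shows "set (pat L a) = {..<card (set a)}"
  using bij_betw_imp_surj_on[OF rank_bij[OF assms]] by (simp add: pat_def)

lemma map_nth_elt_pat: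
  assumes "fin_chain A L" "set a \<subseteq> A"
  shows "map (nth_elt L (set a)) (pat L a) = a"
  using nth_elt_rank[OF assms] by (auto simp: pat_def o_def intro: map_idI)

text \<open>Two maps with the same kernel have images in bijection. Ranks count distinct entries,
  whereas a type speaks about indices, and this lemma passes between the two.\<close>

lemma card_image_kernel_eq:
  assumes "\<And>x y. x \<in> J \<Longrightarrow> y \<in> J \<Longrightarrow> f x = f y \<longleftrightarrow> g x = g y"
  shows "card (f ` J) = card (g ` J)"
proof -
  let ?h = "\<lambda>z. g (inv_into J f z)"
  have h: "?h (f x) = g x" if "x \<in> J" for x
    using assms[of "inv_into J f (f x)" x] that f_inv_into_f[of "f x" f J] inv_into_into[of "f x"
        f J] by auto
  have "inj_on ?h (f ` J)" using h assms by (auto simp: inj_on_def)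
  moreover have "?h ` f ` J = g ` J" using h by force
  ultimately show ?thesis using card_image by metis
qed

lemma pat_eq_iff_tp:
  assumes L: "fin_chain A L" and a: "a \<in> tuples A r" and M: "fin_chain B M" and b: "b \<in> tuples B r"
  shows "pat L a = pat M b \<longleftrightarrow> tp L a = tp M b"
proof
  have len: "length a = r" "length b = r" using tuplesD(1) a b by auto
  assume eq: "pat L a = pat M b"
  have "(a ! j, a ! i) \<in> L \<longleftrightarrow> (b ! j, b ! i) \<in> M" if ij: "i < r" "j < r" for i j
  proof -
    have "(a ! j, a ! i) \<in> L \<longleftrightarrow> pat L a ! j < pat L a ! i"
      using rank_less_iff[OF L tuplesD(2)[OF a] tuplesD(4)[OF a] tuplesD(4)[OF a], of j i] ij len
      by (simp add: pat_nth)
    also have "\<dots> \<longleftrightarrow> (b ! j, b ! i) \<in> M"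
      using rank_less_iff[OF M tuplesD(2)[OF b] tuplesD(4)[OF b] tuplesD(4)[OF b], of j i] ij len eq
      by (simp add: pat_nth)
    finally show ?thesis .
  qed
  then have "(i, j) \<in> tp L a \<longleftrightarrow> (i, j) \<in> tp M b" for i j
    unfolding tp_iff[OF L a] tp_iff[OF M b] by blast
  then show "tp L a = tp M b" by auto
next
  have len: "length a = r" "length b = r" using tuplesD(1) a b by auto
  assume eq: "tp L a = tp M b"
  have less: "(a ! j, a ! i) \<in> L \<longleftrightarrow> (b ! j, b ! i) \<in> M" if "i < r" "j < r" for i j
    using eq tp_iff[OF L a, of i j] tp_iff[OF M b, of i j] that by blast
  have same: "a ! i = a ! j \<longleftrightarrow> b ! i = b ! j" if ij: "i < r" "j < r" for i j
  proof -
    have "a ! i = a ! j \<longleftrightarrow> (a ! i, a ! j) \<notin> L \<and> (a ! j, a ! i) \<notin> L"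
      using fin_chainD(5)[OF L] chain_irrefl[OF L] tuplesD(3)[OF a] ij unfolding total_on_def by
          metis
    moreover have "b ! i = b ! j \<longleftrightarrow> (b ! i, b ! j) \<notin> M \<and> (b ! j, b ! i) \<notin> M"
      using fin_chainD(5)[OF M] chain_irrefl[OF M] tuplesD(3)[OF b] ij unfolding total_on_def by
          metis
    ultimately show ?thesis using less ij by blast
  qed
  show "pat L a = pat M b"
  proof (rule nth_equalityI)
    show "length (pat L a) = length (pat M b)" using len by simp
    fix i assume "i < length (pat L a)"
    then have i: "i < r" using len by simp
    let ?J = "{j. j < r \<and> (a ! j, a ! i) \<in> L}"
    have "{y \<in> set a. (y, a ! i) \<in> L} = (!) a ` ?J" using len by (auto simp: set_conv_nth)
    moreover have "{y \<in> set b. (y, b ! i) \<in> M} = (!) b ` ?J" using len less[OF i] by (auto simp: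
        set_conv_nth)
    moreover have "card ((!) a ` ?J) = card ((!) b ` ?J)"
      by (rule card_image_kernel_eq) (use same in auto)
    ultimately show "pat L a ! i = pat M b ! i" using i len by (simp add: pat_nth rank_def)
  qed
qed

lemma nonconst_iff: "\<not> (\<exists>d. set a \<subseteq> {d}) \<longleftrightarrow> 2 \<le> card (set a)"
proof
  assume n: "\<not> (\<exists>d. set a \<subseteq> {d})"
  show "2 \<le> card (set a)"
  proof (rule ccontr)
    assume "\<not> 2 \<le> card (set a)"
    then have "card (set a) = 0 \<or> card (set a) = 1" by linarith
    then show False using n by (auto simp: card_1_singleton_iff)
  qed
next
  assume c: "2 \<le> card (set a)"
  show "\<not> (\<exists>d. set a \<subseteq> {d})"
  proof
    assume "\<exists>d. set a \<subseteq> {d}"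
    then obtain d where "set a \<subseteq> {d}" ..
    then have "card (set a) \<le> card {d}" by (intro card_mono) auto
    then show False using c by simp
  qed
qed

text \<open>For arity \<open>0\<close> the tuple is empty and any \<open>d\<close> will do, provided
  that \<open>A\<close> has an element.\<close>

lemma const_tuple:
  assumes a: "a \<in> tuples A r" and A: "A \<noteq> {}" and c: "\<not> 2 \<le> card (set a)"
  obtains d where "d \<in> A" "a = replicate r d"
proof -
  obtain d where d: "set a \<subseteq> {d}" using c nonconst_iff by blast
  have e: "a = replicate r d" using d tuplesD(1)[OF a] by (intro replicate_eqI) auto
  show ?thesis
  proof (cases "r = 0")
    case True
    then show ?thesis using that A tuplesD(1)[OF a] by auto
  next
    case False
    then have "d \<in> A" using e tuplesD(2)[OF a] by auto
    then show ?thesis using that e by blast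
  qed
qed


section \<open>Comparing tuples\<close>

lemma alex_if_below:
  assumes L: "fin_chain A L" and "X \<subseteq> A" "Y \<subseteq> A" "Y \<noteq> {}"
    and less: "\<And>x y. x \<in> X \<Longrightarrow> y \<in> Y \<Longrightarrow> (x, y) \<in> L"
  shows "(X, Y) \<in> alex A L"
proof -
  have m: "rel_max L Y \<in> Y" "\<And>y. y \<in> Y \<Longrightarrow> y \<noteq> rel_max L Y \<Longrightarrow> (y, rel_max L Y) \<in> L"
    using rel_max[OF L assms(3,4)] by auto
  let ?m = "rel_max L Y"
  have "?m \<notin> X" using less[of ?m ?m] m(1) chain_irrefl[OF L] by blast
  moreover have "x \<notin> X" "x \<notin> Y" if "(?m, x) \<in> L" for x
    using less[of x ?m] m chain_asym[OF L that] chain_irrefl[OF L] that by metis+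
  ultimately show ?thesis unfolding alex_iff[OF L] using assms(2,3) m(1) by blast
qed

lemma alex_singleton:
  assumes L: "fin_chain A L" and "x \<in> A" "y \<in> A"
  shows "({x}, {y}) \<in> alex A L \<longleftrightarrow> (x, y) \<in> L"
proof
  assume l: "({x}, {y}) \<in> alex A L"
  have "(y, x) \<notin> L"
  proof
    assume "(y, x) \<in> L"
    then have "({y}, {x}) \<in> alex A L" using assms by (intro alex_if_below[OF L]) auto
    then show False using l transD[OF trans_alex[OF L]] irreflD[OF irrefl_alex[OF L]] by blast
  qed
  moreover have "x \<noteq> y" using l irreflD[OF irrefl_alex[OF L]] by auto
  ultimately show "(x, y) \<in> L" using fin_chainD(5)[OF L] assms unfolding total_on_def by blast
qed (use assms in \<open>auto intro!: alex_if_below[OF L]\<close>)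

text \<open>The situation of two copies of an edge in different blocks, and of two constant
  tuples.\<close>

lemma sal_if_below:
  assumes L: "fin_chain A L" and a: "a \<in> tuples A r" and b: "b \<in> tuples A r" and "0 < r"
    and tp: "tp L a = tp L b" and less: "\<And>x y. x \<in> set a \<Longrightarrow> y \<in> set b \<Longrightarrow> (x, y) \<in> L"
  shows "(a, b) \<in> sal A L r"
proof -
  have "set b \<noteq> {}" using tuplesD(1)[OF b] \<open>0 < r\<close> by auto
  then have "(set a, set b) \<in> alex A L"
    using less tuplesD(2)[OF a] tuplesD(2)[OF b] by (intro alex_if_below[OF L])
  then show ?thesis using a b tp irreflD[OF irrefl_alex[OF L]] unfolding sal_def by force
qed

lemma tp_replicate: "tp L (replicate r c) = {..<r} \<times> {..<r}"
  by (auto simp: tp_def)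

lemma sal_same_tp:
  assumes "(a, b) \<in> sal A L r" "tp L a = tp L b"
  shows "(set a, set b) \<in> alex A L"
  using assms irreflD[OF irrefl_qo_less] by (auto simp: sal_def)

text \<open>Between different types \<open>sal\<close> looks at the types alone, so the comparison
  carries over to any other chain in which these types occur.\<close>

lemma sal_other_tp:
  assumes "(a, b) \<in> sal A L r" "tp L a \<noteq> tp L b" "tp M c = tp L a" "tp M d = tp L b"
    and "c \<in> tuples B r" "d \<in> tuples B r"
  shows "(c, d) \<in> sal B M r"
  using assms by (auto simp: sal_def)

text \<open>Constant tuples precede all others, so a tuple below one of them cannot be non-constant
  without being below itself.\<close>

lemma sal_transfer_const:
  assumes L: "fin_chain A L" and a: "a \<in> tuples A r" and c: "c \<in> A" and s: "(a, replicate r c) \<in>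
      sal A L r"
  shows "\<not> 2 \<le> card (set a)"
proof
  assume "2 \<le> card (set a)"
  then have "(replicate r c, a) \<in> sal A L r" by (intro sal_const_less[OF L a c] nonconst_iff[THEN
      iffD2])
  then have "(a, a) \<in> sal A L r" by (rule transD[OF trans_sal[OF L] s])
  then show False by (rule irreflD[OF irrefl_sal, THEN notE])
qed


section \<open>The chain of points and edges\<close>

definition edges :: "('a, 's) lo_structure \<Rightarrow> 's \<Rightarrow> nat list \<Rightarrow> 'a set set" where
  "edges A \<theta> \<pi> = {set a |a. a \<in> interp A \<theta> \<and> pat (lin A) a = \<pi> \<and> 2 \<le> card (set a)}"

text \<open>Label \<open>0\<close> is reserved for the points.\<close>

definition cells :: "'s set \<Rightarrow> ('s \<Rightarrow> nat list \<Rightarrow> nat) \<Rightarrow> ('a, 's) lo_structure \<Rightarrow> (nat \<times> 'a set) set"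
    where
  "cells \<Theta> lab A = {(0, {a}) |a. a \<in> universe A} \<union> {(lab \<theta> \<pi>, e) |\<theta> \<pi> e. \<theta> \<in> \<Theta> \<and> e \<in> edges A \<theta> \<pi>}"

definition cell_less :: "'s set \<Rightarrow> ('s \<Rightarrow> nat list \<Rightarrow> nat) \<Rightarrow> ('a, 's) lo_structure \<Rightarrow> (nat \<times> 'a set)
    rel" where
  "cell_less \<Theta> lab A = {(p, q). p \<in> cells \<Theta> lab A \<and> q \<in> cells \<Theta> lab A \<and>
     (fst p < fst q \<or> fst p = fst q \<and> (snd p, snd q) \<in> alex (universe A) (lin A))}"

definition cell_map :: "('a \<Rightarrow> 'b) \<Rightarrow> nat \<times> 'a set \<Rightarrow> nat \<times> 'b set" where
  "cell_map f s = (if 2 \<le> card (f ` snd s) then fst s else 0, f ` snd s)"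

text \<open>Rank \<open>0\<close> is the default because every cell has a least vertex. It is taken
  if the label does not match or the cell has no vertex of rank \<open>j\<close>; the latter makes
  the function meaningful for all vertex numbers below a common bound.\<close>

definition place :: "'a rel \<Rightarrow> nat \<Rightarrow> nat \<Rightarrow> nat \<times> 'a set \<Rightarrow> 'a" where
  "place L m j s = nth_elt L (snd s) (if m = fst s \<and> j < card (snd s) then j else 0)"

text \<open>
  Only finitely many labels are allowed although \<open>\<Theta>\<close> may be infinite; different pairs of a symbol
  and a pattern may share a label if they have the same edges.
\<close>

definition labelled ::
  "'s set \<Rightarrow> ('s \<Rightarrow> nat) \<Rightarrow> ('s \<Rightarrow> nat list \<Rightarrow> nat) \<Rightarrow> nat \<Rightarrow> ('a, 's) lo_structure \<Rightarrow> bool" where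
  "labelled \<Theta> ar lab M A \<longleftrightarrow> fin_lo_refl_structure \<Theta> ar A \<and>
     (\<forall>\<theta> \<pi>. 0 < lab \<theta> \<pi> \<and> lab \<theta> \<pi> < M) \<and>
     (\<forall>\<theta> \<pi> \<theta>' \<pi>'. lab \<theta> \<pi> = lab \<theta>' \<pi>' \<longrightarrow> edges A \<theta> \<pi> = edges A \<theta>' \<pi>')"

lemma labelledD:
  assumes "labelled \<Theta> ar lab M A"
  shows "fin_lo_refl_structure \<Theta> ar A" "0 < lab \<theta> \<pi>" "lab \<theta> \<pi> < M"
    and "lab \<theta> \<pi> = lab \<theta>' \<pi>' \<Longrightarrow> edges A \<theta> \<pi> = edges A \<theta>' \<pi>'"
  using assms unfolding labelled_def by blast+

lemma edgesE:
  assumes A: "fin_lo_refl_structure \<Theta> ar A" and t: "\<theta> \<in> \<Theta>" and e: "e \<in> edges A \<theta> \<pi>"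
  obtains a where "a \<in> interp A \<theta>" "a \<in> tuples (universe A) (ar \<theta>)" "pat (lin A) a = \<pi>"
    "2 \<le> card (set a)" "e = set a" "e \<subseteq> universe A"
proof -
  obtain a where a: "a \<in> interp A \<theta>" "pat (lin A) a = \<pi>" "2 \<le> card (set a)" "e = set a"
    using e by (auto simp: edges_def)
  then have "a \<in> tuples (universe A) (ar \<theta>)" using interp_tuples[OF A t] by blast
  then show ?thesis using that a tuplesD(2) by metis
qed

lemma cells_cases:
  assumes A: "labelled \<Theta> ar lab M A" and s: "s \<in> cells \<Theta> lab A"
  obtains (point) a where "a \<in> universe A" "s = (0, {a})"
  | (edge) \<theta> \<pi> e where "\<theta> \<in> \<Theta>" "e \<in> edges A \<theta> \<pi>" "s = (lab \<theta> \<pi>, e)" "e \<subseteq> universe A"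
      "2 \<le> card e" "0 < fst s" "fst s < M"
proof -
  note st = labelledD(1)[OF A] and lab = labelledD(2,3)[OF A]
  consider a where "a \<in> universe A" "s = (0, {a})"
    | \<theta> \<pi> e where "\<theta> \<in> \<Theta>" "e \<in> edges A \<theta> \<pi>" "s = (lab \<theta> \<pi>, e)"
    using s by (auto simp: cells_def)
  then show ?thesis
  proof cases
    case 1 then show ?thesis by (rule point)
  next
    case (2 \<theta> \<pi> e)
    from st 2(1,2) obtain a where "2 \<le> card (set a)" "e = set a" "e \<subseteq> universe A" by (rule edgesE)
    then show ?thesis using 2 lab[where \<theta> = \<theta> and \<pi> = \<pi>] by (intro edge[of \<theta> e \<pi>]) auto
  qed
qed

text \<open>A cell shows only its label, which several pairs of symbol and pattern may share. As
  they have the same edges, membership may be read for whichever pair is at hand.\<close>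

lemma cell_edge:
  assumes A: "labelled \<Theta> ar lab M A" and s: "(lab \<theta> \<pi>, e) \<in> cells \<Theta> lab A"
  shows "e \<in> edges A \<theta> \<pi>"
proof -
  from A s show ?thesis
  proof (cases rule: cells_cases)
    case (edge \<theta>' \<pi>' e')
    then have "lab \<theta> \<pi> = lab \<theta>' \<pi>'" "e \<in> edges A \<theta>' \<pi>'" by auto
    then show ?thesis using labelledD(4)[OF A] by blast
  next
    case (point a)
    then show ?thesis using labelledD(2)[OF A, of \<theta> \<pi>] by simp
  qed
qed

text \<open>Labels separate what \<open>sal\<close> may leave incomparable, namely tuples of
  different types with the same classes; within one label \<open>alex\<close> is linear. Finiteness
  comes from the bound \<open>M\<close> on labels.\<close>

lemma fin_chain_cells:
  assumes A: "labelled \<Theta> ar lab M A"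
  shows "fin_chain (cells \<Theta> lab A) (cell_less \<Theta> lab A)"
proof -
  note c = fin_chain_lin[OF labelledD(1)[OF A]]
  have sub: "fst s < Suc M \<and> snd s \<subseteq> universe A" if "s \<in> cells \<Theta> lab A" for s
    using A that by (cases rule: cells_cases) auto
  then have "cells \<Theta> lab A \<subseteq> {..<Suc M} \<times> Pow (universe A)"
    by (intro subsetI) (simp add: mem_Times_iff)
  then have "finite (cells \<Theta> lab A)" by (rule finite_subset) (use fin_chainD(1)[OF c] in simp)
  moreover have "trans (cell_less \<Theta> lab A)"
  proof (rule transI)
    fix p q r assume "(p, q) \<in> cell_less \<Theta> lab A" "(q, r) \<in> cell_less \<Theta> lab A"
    then show "(p, r) \<in> cell_less \<Theta> lab A"
      using transD[OF trans_alex[OF c], of "snd p" "snd q" "snd r"] by (auto simp: cell_less_def)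
  qed
  moreover have "irrefl (cell_less \<Theta> lab A)"
    using irreflD[OF irrefl_alex[OF c]] by (auto simp: irrefl_def cell_less_def)
  moreover have "total_on (cells \<Theta> lab A) (cell_less \<Theta> lab A)"
  proof (rule total_onI)
    fix p q assume pq: "p \<in> cells \<Theta> lab A" "q \<in> cells \<Theta> lab A" "p \<noteq> q"
    then have "fst p = fst q \<Longrightarrow> snd p \<noteq> snd q" by (simp add: prod_eq_iff)
    then show "(p, q) \<in> cell_less \<Theta> lab A \<or> (q, p) \<in> cell_less \<Theta> lab A"
      using pq total_alex[OF c, of "snd p" "snd q"] sub by (auto simp: cell_less_def)
  qed
  ultimately show ?thesis unfolding fin_chain_def strict_linear_order_on_def by (auto simp:
      cell_less_def)
qed

lemma finite_cell:
  assumes A: "labelled \<Theta> ar lab M A" and s: "s \<in> cells \<Theta> lab A"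
  shows "snd s \<subseteq> universe A" "finite (snd s)" "0 < card (snd s)"
proof -
  from A s have "snd s \<subseteq> universe A \<and> 0 < card (snd s)" by (cases rule: cells_cases) auto
  then show "snd s \<subseteq> universe A" "finite (snd s)" "0 < card (snd s)" by (auto intro:
      card_ge_0_finite)
qed

section \<open>Vertices of cells and the action of morphisms on cells\<close>

lemma place_in:
  assumes A: "labelled \<Theta> ar lab M A" and s: "s \<in> cells \<Theta> lab A"
  shows "place (lin A) m j s \<in> snd s"
proof -
  from nth_elt_in[OF fin_chain_lin[OF labelledD(1)[OF A]] finite_cell(1)[OF A s]]
      finite_cell(3)[OF A s]
  show ?thesis by (simp add: place_def)
qed

text \<open>Condition (ii) makes \<open>f\<close> strictly increasing on a tuple that it does not
  collapse, so the type, and with it the pattern, is preserved.\<close>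

lemma srq_edge:
  assumes X: "fin_lo_refl_structure \<Theta> ar X" and Y: "fin_lo_refl_structure \<Theta> ar Y"
    and f: "strong_rigid_quotient \<Theta> ar X Y f" and t: "\<theta> \<in> \<Theta>" and a: "a \<in> interp X \<theta>"
    and c: "2 \<le> card (f ` set a)"
  shows "map f a \<in> interp Y \<theta>" "pat (lin Y) (map f a) = pat (lin X) a"
    and "\<And>x y. x \<in> set a \<Longrightarrow> y \<in> set a \<Longrightarrow> (x, y) \<in> lin X \<Longrightarrow> (f x, f y) \<in> lin Y"
    and "2 \<le> card (set a)"
proof -
  show fa: "map f a \<in> interp Y \<theta>" using f t a by (auto simp: strong_rigid_quotient_def
      homomorphism_def)
  have n: "\<not> (\<exists>d. set (map f a) \<subseteq> {d})" using c unfolding nonconst_iff by simp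
  have tup: "a \<in> tuples (universe X) (ar \<theta>)" "map f a \<in> tuples (universe Y) (ar \<theta>)"
    using interp_tuples[OF X t] interp_tuples[OF Y t] a fa by auto
  show "pat (lin Y) (map f a) = pat (lin X) a"
    using srq_tp[OF X Y f t a n] pat_eq_iff_tp[OF fin_chain_lin[OF X] tup(1) fin_chain_lin[OF Y]
        tup(2)] by simp
  have n': "\<not> (\<exists>c. \<forall>u\<in>set a. f u = c)" using n by auto
  have "\<forall>i<length a. \<forall>j<length a. (a ! i, a ! j) \<in> lin X \<longrightarrow> (f (a ! i), f (a ! j)) \<in> lin Y"
    using f t a n' unfolding strong_rigid_quotient_def by blast
  then show "(f x, f y) \<in> lin Y" if "x \<in> set a" "y \<in> set a" "(x, y) \<in> lin X" for x y
    using that by (metis in_set_conv_nth)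
  show "2 \<le> card (set a)" using c card_image_le[of "set a" f] by simp
qed

lemma singleton_if_small:
  assumes "finite e" "e \<noteq> {}" "\<not> 2 \<le> card e"
  obtains d where "e = {d}"
proof -
  have "card e \<noteq> 0" using assms by simp
  then have "card e = 1" using assms(3) by linarith
  then show ?thesis using that card_1_singletonE by metis
qed

text \<open>If \<open>f\<close> collapses the cell, both sides are its only image point. Otherwise
  \<open>f\<close> is strictly increasing on it, so label, cardinality and ranks of vertices all
  survive.\<close>

lemma place_natural:
  assumes X: "labelled \<Theta> ar lab M X" and Y: "labelled \<Theta> ar lab M Y"
    and f: "strong_rigid_quotient \<Theta> ar X Y f" and s: "s \<in> cells \<Theta> lab X"
  shows "f (place (lin X) m j s) = place (lin Y) m j (cell_map f s)"
proof -
  note sX = labelledD(1)[OF X] and sY = labelledD(1)[OF Y]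
  note cX = fin_chain_lin[OF sX] and cY = fin_chain_lin[OF sY]
  have fU: "f ` universe X \<subseteq> universe Y"
    using f by (auto simp: strong_rigid_quotient_def homomorphism_def)
  note fc = finite_cell[OF X s]
  have in': "f (place (lin X) m j s) \<in> f ` snd s" using place_in[OF X s] by blast
  show ?thesis
  proof (cases "2 \<le> card (f ` snd s)")
    case False
    have "snd s \<noteq> {}" using fc(3) by auto
    then obtain d where d: "f ` snd s = {d}" using singleton_if_small[of "f ` snd s"] fc(2) False
        by blast
    have "d \<in> universe Y" using d fc(1) fU by blast
    then have "place (lin Y) m j (cell_map f s) = d"
      using nth_elt_singleton[OF cY] by (simp add: place_def cell_map_def d)
    then show ?thesis using in' d by auto
  next
    case True
    from X s show ?thesis
    proof (cases rule: cells_cases)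
      case (point a)
      then show ?thesis using True by simp
    next
      case (edge \<theta> \<pi> e)
      obtain a where a: "a \<in> interp X \<theta>" "e = set a" using edgesE[OF sX edge(1,2)] by metis
      have c2: "2 \<le> card (f ` set a)" using True edge a by simp
      note m = strict_mono_image[OF cX edge(4) cY, of f]
      have fe: "f ` e \<subseteq> universe Y" using edge(4) fU by blast
      have mono: "\<And>x y. x \<in> e \<Longrightarrow> y \<in> e \<Longrightarrow> (x, y) \<in> lin X \<Longrightarrow> (f x, f y) \<in> lin Y"
        using srq_edge(3)[OF sX sY f edge(1) a(1) c2] a(2) by blast
      note m' = m(1,3)[OF fe mono]
      have s': "fst s = lab \<theta> \<pi>" "snd s = e" using edge by auto
      have "cell_map f s = (lab \<theta> \<pi>, f ` e)" using True s' by (simp add: cell_map_def)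
      then show ?thesis using m' s' edge(5) by (simp add: place_def)
    qed
  qed
qed

text \<open>A point lifts to a point, which precedes every edge, and an edge lifts to an edge with
  the same label. Hence only equal labels need the rigidity of \<open>f\<close>: for two points it
  is rigidity on the universe, and for two edges rigidity on tuples of one type, where
  \<open>sal\<close> compares nothing but the sets of entries.\<close>

lemma chain_surj_cell_map:
  assumes X: "labelled \<Theta> ar lab M X" and Y: "labelled \<Theta> ar lab M Y"
    and f: "strong_rigid_quotient \<Theta> ar X Y f"
  shows "chain_surj (cells \<Theta> lab X) (cell_less \<Theta> lab X) (cells \<Theta> lab Y) (cell_less \<Theta> lab Y)
      (cell_map f)"
  unfolding chain_surj_def
proof (intro conjI ballI impI)
  note sX = labelledD(1)[OF X] and sY = labelledD(1)[OF Y]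
  note cX = fin_chain_lin[OF sX] and cY = fin_chain_lin[OF sY]
  have fX: "f ` universe X = universe Y" using f by (simp add: strong_rigid_quotient_def
      rigid_surj_def)
  have fr: "chain_surj (universe X) (lin X) (universe Y) (lin Y) f"
    using f fibre_min[OF cX fX]
    by (intro rigid_surj_imp_chain_surj[OF _ fin_chainD(3,4)[OF cX]]) (auto simp:
        strong_rigid_quotient_def)
  have fe: "chain_surj (interp X \<theta>) (sal (universe X) (lin X) (ar \<theta>))
      (interp Y \<theta>) (sal (universe Y) (lin Y) (ar \<theta>)) (map f)" if "\<theta> \<in> \<Theta>" for \<theta>
    using f srq_fibre_min[OF sX sY f that] that
    by (intro rigid_surj_imp_chain_surj[OF _ trans_sal[OF cX] irrefl_sal]) (auto simp:
        strong_rigid_quotient_def)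
  have hit: "\<exists>b\<in>universe X. f b = a" if "a \<in> universe Y" for a
    using that unfolding fX[symmetric] by blast
  have lift: "\<exists>b\<in>interp X \<theta>. map f b = a" if "\<theta> \<in> \<Theta>" "a \<in> interp Y \<theta>" for \<theta> a
    using fe[OF that(1)] that(2) unfolding chain_surj_def by (metis imageE)
  have up: "(lab \<theta> (pat (lin Y) a), set b) \<in> cells \<Theta> lab X"
      "cell_map f (lab \<theta> (pat (lin Y) a), set b) = (lab \<theta> (pat (lin Y) a), set a)"
      "pat (lin X) b = pat (lin Y) a"
    if t: "\<theta> \<in> \<Theta>" and a: "2 \<le> card (set a)" and b: "b \<in> interp X \<theta>" "map f b = a" for \<theta> a b
  proof -
    have c2: "2 \<le> card (f ` set b)" using a b(2) by auto
    note e = srq_edge[OF sX sY f t b(1) c2]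
    show p: "pat (lin X) b = pat (lin Y) a" using e(2) b(2) by simp
    then have "set b \<in> edges X \<theta> (pat (lin Y) a)" using b(1) e(4) by (auto simp: edges_def)
    then show "(lab \<theta> (pat (lin Y) a), set b) \<in> cells \<Theta> lab X" using t by (auto simp: cells_def)
    show "cell_map f (lab \<theta> (pat (lin Y) a), set b) = (lab \<theta> (pat (lin Y) a), set a)"
      using c2 b(2) by (auto simp: cell_map_def)
  qed
  have maps: "cell_map f s \<in> cells \<Theta> lab Y" if s: "s \<in> cells \<Theta> lab X" for s
  proof (cases "2 \<le> card (f ` snd s)")
    case False
    note fc = finite_cell[OF X s]
    have "snd s \<noteq> {}" using fc(3) by auto
    then obtain d where d: "f ` snd s = {d}" using singleton_if_small[of "f ` snd s"] fc(2) False
        by blast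
    have "d \<in> universe Y" using d fc(1) fX by blast
    then show ?thesis using d by (auto simp: cell_map_def cells_def)
  next
    case True
    from X s show ?thesis
    proof (cases rule: cells_cases)
      case (point a)
      then show ?thesis using True by simp
    next
      case (edge \<theta> \<pi> e)
      obtain a where a: "a \<in> interp X \<theta>" "pat (lin X) a = \<pi>" "e = set a" using edgesE[OF sX
          edge(1,2)] by metis
      have c2: "2 \<le> card (f ` set a)" using True edge a by simp
      note e = srq_edge[OF sX sY f edge(1) a(1) c2]
      have "f ` e \<in> edges Y \<theta> \<pi>" unfolding edges_def using e(1,2) a c2
        by (intro CollectI exI[of _ "map f a"]) simp
      then show ?thesis using True edge by (auto simp: cell_map_def cells_def)
    qed
  qed
  show "cell_map f ` cells \<Theta> lab X = cells \<Theta> lab Y"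
  proof (intro equalityI subsetI)
    fix s assume s: "s \<in> cells \<Theta> lab Y"
    from Y s show "s \<in> cell_map f ` cells \<Theta> lab X"
    proof (cases rule: cells_cases)
      case (point a)
      obtain b where "b \<in> universe X" "f b = a" using hit[OF point(1)] by blast
      then show ?thesis using point(2) by (intro image_eqI[of _ _ "(0, {b})"]) (simp_all add:
          cell_map_def cells_def)
    next
      case (edge \<theta> \<pi> e)
      obtain a where a: "a \<in> interp Y \<theta>" "pat (lin Y) a = \<pi>" "2 \<le> card (set a)" "e = set a"
        using edgesE[OF sY edge(1,2)] by metis
      obtain b where b: "b \<in> interp X \<theta>" "map f b = a"
        using lift[OF edge(1) a(1)] by blast
      show ?thesis using up[OF edge(1) a(3) b] a(2,4) edge(3) by (metis image_eqI)
    qed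
  qed (use maps in auto)
  fix q p assume q: "q \<in> cells \<Theta> lab X" and p: "p \<in> cells \<Theta> lab Y" and less: "(p, cell_map f q) \<in>
      cell_less \<Theta> lab Y"
  from less have l: "fst p < fst (cell_map f q) \<or>
      fst p = fst (cell_map f q) \<and> (snd p, snd (cell_map f q)) \<in> alex (universe Y) (lin Y)"
    by (simp add: cell_less_def)
  have goal: "\<exists>q'\<in>cells \<Theta> lab X. (q', q) \<in> cell_less \<Theta> lab X \<and> cell_map f q' = p"
    if "q' \<in> cells \<Theta> lab X" "cell_map f q' = p"
      "fst q' < fst q \<or> fst q' = fst q \<and> (snd q', snd q) \<in> alex (universe X) (lin X)" for q'
    using that q by (intro bexI[of _ q']) (auto simp: cell_less_def)
  from Y p show "\<exists>q'\<in>cells \<Theta> lab X. (q', q) \<in> cell_less \<Theta> lab X \<and> cell_map f q' = p"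
  proof (cases rule: cells_cases)
    case pp: (point a)
    from X q show ?thesis
    proof (cases rule: cells_cases)
      case (point b)
      have fb: "f b \<in> universe Y" using point fX by blast
      have "({a}, {f b}) \<in> alex (universe Y) (lin Y)" using l pp point by (simp add: cell_map_def)
      then have "(a, f b) \<in> lin Y" using alex_singleton[OF cY pp(1) fb] by simp
      then obtain b' where b': "b' \<in> universe X" "(b', b) \<in> lin X" "f b' = a"
        using fr point(1) pp(1) unfolding chain_surj_def by blast
      then have "({b'}, {b}) \<in> alex (universe X) (lin X)" using alex_singleton[OF cX b'(1)
          point(1)] by simp
      then show ?thesis using b' point(2) pp(2)
        by (intro goal[of "(0, {b'})"]) (simp_all add: cell_map_def cells_def)
    next
      case (edge \<theta> \<pi> e)
      obtain b' where "b' \<in> universe X" "f b' = a" using hit[OF pp(1)] by blast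
      then show ?thesis using edge(6) pp(2)
        by (intro goal[of "(0, {b'})"]) (simp_all add: cell_map_def cells_def)
    qed
  next
    case (edge \<theta> \<pi> e)
    \<comment> \<open>The positive label of \<open>p\<close> is at most the label of
      \<open>cell_map f q\<close>; a collapsed cell would have label \<open>0\<close>.\<close>
    have c2: "2 \<le> card (f ` snd q)" using l edge(6) by (auto simp: cell_map_def split: if_splits)
    then have fq: "cell_map f q = (fst q, f ` snd q)" by (simp add: cell_map_def)
    obtain a where a: "a \<in> interp Y \<theta>" "a \<in> tuples (universe Y) (ar \<theta>)" "pat (lin Y) a = \<pi>" "2 \<le>
        card (set a)" "e = set a"
      using edgesE[OF sY edge(1,2)] by metis
    show ?thesis
    proof (cases "fst p < fst q")
      case True
      obtain b where b: "b \<in> interp X \<theta>" "map f b = a"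
        using lift[OF edge(1) a(1)] by blast
      show ?thesis using up[OF edge(1) a(4) b] a(3,5) edge(3) True
        by (intro goal[of "(lab \<theta> \<pi>, set b)"]) auto
    next
      case False
      then have eq: "fst q = lab \<theta> \<pi>" and al: "(e, f ` snd q) \<in> alex (universe Y) (lin Y)"
        using l fq edge(3) by auto
      \<comment> \<open>The cell \<open>q\<close> may stem from another symbol with the same label;
        it is reinterpreted as an edge for \<theta> and \<pi>, so that both tuples belong to the
        same relation.\<close>
      then have "(lab \<theta> \<pi>, snd q) \<in> cells \<Theta> lab X" using q by (metis prod.collapse)
      then have "snd q \<in> edges X \<theta> \<pi>" by (rule cell_edge[OF X])
      then obtain b' where b': "b' \<in> interp X \<theta>" "b' \<in> tuples (universe X) (ar \<theta>)" "pat (lin X) b'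
          = \<pi>" "snd q = set b'"
        using edgesE[OF sX edge(1)] by metis
      have c2': "2 \<le> card (f ` set b')" using c2 b' by simp
      note e' = srq_edge[OF sX sY f edge(1) b'(1) c2']
      have tY: "map f b' \<in> tuples (universe Y) (ar \<theta>)" using interp_tuples[OF sY edge(1)] e'(1) by
          blast
      have "tp (lin Y) a = tp (lin Y) (map f b')"
        using pat_eq_iff_tp[OF cY a(2) cY tY] a(3) e'(2) b'(3) by simp
      moreover have "set a \<noteq> set (map f b')" using al a(5) b'(4) irreflD[OF irrefl_alex[OF cY]] by
          auto
      ultimately have "(a, map f b') \<in> sal (universe Y) (lin Y) (ar \<theta>)"
        using al a(2,5) b'(4) tY by (simp add: sal_def)
      then obtain b where b: "b \<in> interp X \<theta>" "(b, b') \<in> sal (universe X) (lin X) (ar \<theta>)" "map f b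
          = a"
        using fe[OF edge(1)] b'(1) a(1) unfolding chain_surj_def by blast
      note u = up[OF edge(1) a(4) b(1,3), unfolded a(3), folded a(5)]
      have bt: "b \<in> tuples (universe X) (ar \<theta>)" using interp_tuples[OF sX edge(1)] b(1) by blast
      have "tp (lin X) b = tp (lin X) b'" using pat_eq_iff_tp[OF cX bt cX b'(2)] b'(3) u(3) by simp
      then have "(set b, snd q) \<in> alex (universe X) (lin X)" using sal_same_tp[OF b(2)] b'(4) by
          simp
      moreover have "cell_map f (lab \<theta> \<pi>, set b) = p" using u(2) edge(3) by simp
      moreover note u(1)
      ultimately show ?thesis using eq by (intro goal[of "(lab \<theta> \<pi>, set b)"]) auto
    qed
  qed
qed


section \<open>Disjoint unions of edges\<close>

text \<open>Mixed radix notation with the block \<open>n\<close> as leading digit, then the label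
  \<open>m\<close> and the vertex number \<open>j\<close>. All points of an earlier block thus lie
  below all points of a later one.\<close>

definition code :: "nat \<Rightarrow> nat \<Rightarrow> nat \<Rightarrow> nat \<Rightarrow> nat \<Rightarrow> nat" where
  "code M K n m j = (n * M + m) * K + j"

lemma code_decode:
  assumes "m < M" "j < K"
  shows "code M K n m j mod K = j" "code M K n m j div K mod M = m" "code M K n m j div K div M = n"
  using assms by (simp_all add: code_def)

lemma code_less:
  assumes "n < n'" "m < M" "j < K"
  shows "code M K n m j < code M K n' m' j'"
proof -
  have "n * M + m < Suc n * M" using assms(2) by simp
  also have "\<dots> \<le> n' * M" using assms(1) by (intro mult_le_mono1) simp
  finally have "Suc (n * M + m) \<le> n' * M + m'" by simp
  then have "Suc (n * M + m) * K \<le> (n' * M + m') * K" by (rule mult_le_mono1)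
  then show ?thesis using assms(3) by (simp add: code_def)
qed

lemma code_bound:
  assumes "n < N" "m < M" "j < K" shows "code M K n m j < N * M * K"
  using code_less[OF assms, of 0 0] by (simp add: code_def)

text \<open>Every block has \<open>M * K\<close> points, whatever cell it will represent; those on
  no edge occur in constant tuples only. Pairs of symbol and pattern with equal labels use the same
  vertices. The injection \<iota> merely moves the natural numbers into the type of
  elements.\<close>

definition edge_sum ::
  "(nat \<Rightarrow> 'a) \<Rightarrow> 's set \<Rightarrow> ('s \<Rightarrow> nat) \<Rightarrow> ('s \<Rightarrow> nat list \<Rightarrow> nat) \<Rightarrow> nat \<Rightarrow> nat \<Rightarrow> nat \<Rightarrow>
   ('s \<Rightarrow> nat list set) \<Rightarrow> ('a, 's) lo_structure" where
  "edge_sum \<iota> \<Theta> ar lab M K N P =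
     \<lparr>universe = \<iota> ` {..<N * M * K},
      interp = (\<lambda>\<theta>. if \<theta> \<in> \<Theta> then
         {replicate (ar \<theta>) p |p. p \<in> \<iota> ` {..<N * M * K}} \<union>
         {map (\<lambda>j. \<iota> (code M K n (lab \<theta> \<pi>) j)) \<pi> |n \<pi>. n < N \<and> \<pi> \<in> P \<theta>} else {}),
      lin = {(\<iota> x, \<iota> y) |x y. x < y \<and> y < N * M * K}\<rparr>"

definition realise ::
  "(nat \<Rightarrow> 'a) \<Rightarrow> nat \<Rightarrow> nat \<Rightarrow> nat \<Rightarrow> ('b, 's) lo_structure \<Rightarrow> (nat \<Rightarrow> nat \<times> 'b set) \<Rightarrow> 'a \<Rightarrow> 'b" where
  "realise \<iota> M K N X w = (\<lambda>p\<in>\<iota> ` {..<N * M * K}.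
     let x = inv \<iota> p in place (lin X) (x div K mod M) (x mod K) (w (x div K div M)))"

locale edge_sums =
  fixes \<iota> :: "nat \<Rightarrow> 'a" and \<Theta> :: "'s set" and ar :: "'s \<Rightarrow> nat"
    and lab :: "'s \<Rightarrow> nat list \<Rightarrow> nat" and M K N :: nat and P :: "'s \<Rightarrow> nat list set"
  assumes inj: "inj \<iota>"
    and N: "0 < N" and M: "0 < M" and K: "0 < K"
    and lab: "\<And>\<theta> \<pi>. lab \<theta> \<pi> < M"
    and patterns: "\<And>\<theta> \<pi>. \<theta> \<in> \<Theta> \<Longrightarrow> \<pi> \<in> P \<theta> \<Longrightarrow>
      length \<pi> = ar \<theta> \<and> (\<exists>\<kappa>. set \<pi> = {..<\<kappa>} \<and> 2 \<le> \<kappa> \<and> \<kappa> \<le> K)"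
begin

definition C :: "('a, 's) lo_structure" where "C = edge_sum \<iota> \<Theta> ar lab M K N P"

definition pt :: "nat \<Rightarrow> nat \<Rightarrow> nat \<Rightarrow> 'a" where "pt n m j = \<iota> (code M K n m j)"

lemma universe_C: "universe C = \<iota> ` {..<N * M * K}"
  and lin_C: "lin C = {(\<iota> x, \<iota> y) |x y. x < y \<and> y < N * M * K}"
  by (simp_all add: C_def edge_sum_def)

lemma interp_C: "\<theta> \<in> \<Theta> \<Longrightarrow> interp C \<theta> =
    {replicate (ar \<theta>) p |p. p \<in> universe C} \<union> {map (pt n (lab \<theta> \<pi>)) \<pi> |n \<pi>. n < N \<and> \<pi> \<in> P \<theta>}"
  unfolding pt_def by (simp add: C_def edge_sum_def)

lemma pt_in: "n < N \<Longrightarrow> m < M \<Longrightarrow> j < K \<Longrightarrow> pt n m j \<in> universe C"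
  using code_bound by (simp add: universe_C pt_def)

lemma ptE:
  assumes "p \<in> universe C"
  obtains n m j where "n < N" "m < M" "j < K" "p = pt n m j"
proof -
  obtain x where x: "x < N * M * K" "p = \<iota> x" using assms by (auto simp: universe_C)
  have "code M K (x div K div M) (x div K mod M) (x mod K) = x" by (simp add: code_def)
  moreover have "x div K div M < N" using x(1) by (simp add: less_mult_imp_div_less mult.assoc
      mult.commute)
  ultimately show ?thesis using that[of "x div K div M" "x div K mod M" "x mod K"] x(2) M K by
      (simp add: pt_def)
qed

lemma lin_iff: "(\<iota> x, \<iota> y) \<in> lin C \<longleftrightarrow> x < y \<and> y < N * M * K"
  using injD[OF inj] by (auto simp: lin_C)

lemma pt_less: "n < n' \<Longrightarrow> n' < N \<Longrightarrow> m < M \<Longrightarrow> j < K \<Longrightarrow> m' < M \<Longrightarrow> j' < K \<Longrightarrow> (pt n m j, pt n' m' j') \<in> lin C"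
  using code_less[of n n' m M j K m' j'] code_bound[of n' N m' M j' K] by (simp add: pt_def lin_iff)

lemma pt_less_same: "n < N \<Longrightarrow> m < M \<Longrightarrow> j < K \<Longrightarrow> j' < K \<Longrightarrow> (pt n m j, pt n m j') \<in> lin C \<longleftrightarrow> j < j'"
  using code_bound[of n N m M j' K] by (simp add: pt_def lin_iff) (simp add: code_def)

lemma fin_chain_C: "fin_chain (universe C) (lin C)"
  unfolding fin_chain_def strict_linear_order_on_def
proof (intro conjI)
  show "lin C \<subseteq> universe C \<times> universe C" by (auto simp: universe_C lin_C)
  show "trans (lin C)" using injD[OF inj] by (auto simp: lin_C intro!: transI) (metis less_trans)
  show "irrefl (lin C)" using injD[OF inj] by (auto simp: lin_C irrefl_def)
  show "total_on (universe C) (lin C)"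
  proof (rule total_onI)
    fix p q assume "p \<in> universe C" "q \<in> universe C" "p \<noteq> q"
    then obtain x y where "p = \<iota> x" "q = \<iota> y" "x < N * M * K" "y < N * M * K" "x \<noteq> y" by (auto
        simp: universe_C)
    then show "(p, q) \<in> lin C \<or> (q, p) \<in> lin C" by (auto simp: lin_iff)
  qed
qed (simp add: universe_C)

text \<open>The entries of \<pi> fill an initial segment, and vertices of one edge are ordered by
  number, so the vertex with number \<open>j\<close> has rank \<open>j\<close> in the tuple.\<close>

lemma edge_tuple:
  assumes t: "\<theta> \<in> \<Theta>" and \<pi>: "\<pi> \<in> P \<theta>" and n: "n < N"
  defines "T \<equiv> map (pt n (lab \<theta> \<pi>)) \<pi>"
  shows "T \<in> tuples (universe C) (ar \<theta>)" "pat (lin C) T = \<pi>"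
    and "\<And>j. j \<in> set \<pi> \<Longrightarrow> j < K" "0 < ar \<theta>"
proof -
  obtain \<kappa> where \<kappa>: "length \<pi> = ar \<theta>" "set \<pi> = {..<\<kappa>}" "2 \<le> \<kappa>" "\<kappa> \<le> K" using patterns[OF t \<pi>] by
      blast
  show jK: "j < K" if "j \<in> set \<pi>" for j using that \<kappa> by auto
  show "T \<in> tuples (universe C) (ar \<theta>)"
    using \<kappa>(1) jK pt_in[OF n lab] by (auto simp: tuples_def T_def)
  have "0 \<in> set \<pi>" unfolding \<kappa>(2) using \<kappa>(3) by simp
  then have "\<pi> \<noteq> []" by auto
  then show "0 < ar \<theta>" unfolding \<kappa>(1)[symmetric] by simp
  have img: "pt n (lab \<theta> \<pi>) ` {..<\<kappa>} \<subseteq> universe C" using \<kappa>(4) pt_in[OF n lab] by auto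
  have mono: "\<And>x y. x \<in> {..<\<kappa>} \<Longrightarrow> y \<in> {..<\<kappa>} \<Longrightarrow> (x, y) \<in> {(i, j). i < j \<and> j < \<kappa>} \<Longrightarrow>
      (pt n (lab \<theta> \<pi>) x, pt n (lab \<theta> \<pi>) y) \<in> lin C"
    using pt_less_same[OF n lab] \<kappa>(4) by auto
  note m = strict_mono_image(2)[OF fin_chain_idx[of \<kappa>] order_refl fin_chain_C img mono]
  have sT: "set T = pt n (lab \<theta> \<pi>) ` {..<\<kappa>}" by (simp add: T_def \<kappa>(2))
  have r: "rank (lin C) (set T) (pt n (lab \<theta> \<pi>) j) = j" if "j < \<kappa>" for j
  proof -
    have "{y \<in> {..<\<kappa>}. (y, j) \<in> {(i, j). i < j \<and> j < \<kappa>}} = {..<j}" using that by auto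
    then show ?thesis using m[of j] that unfolding sT by (simp add: rank_def)
  qed
  then show "pat (lin C) T = \<pi>" using \<kappa>(2) unfolding pat_def by (auto simp: T_def o_def intro!:
      map_idI)
qed

lemma structure_C: "fin_lo_refl_structure \<Theta> ar C"
proof -
  have "interp C \<theta> \<subseteq> tuples (universe C) (ar \<theta>)" if t: "\<theta> \<in> \<Theta>" for \<theta>
  proof
    fix x assume "x \<in> interp C \<theta>"
    then consider p where "p \<in> universe C" "x = replicate (ar \<theta>) p"
      | n \<pi> where "n < N" "\<pi> \<in> P \<theta>" "x = map (pt n (lab \<theta> \<pi>)) \<pi>"
      unfolding interp_C[OF t] by blast
    then show "x \<in> tuples (universe C) (ar \<theta>)"
      by cases (use edge_tuple(1)[OF t] in \<open>auto simp: tuples_def\<close>)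
  qed
  moreover have "replicate (ar \<theta>) a \<in> interp C \<theta>" if "\<theta> \<in> \<Theta>" "a \<in> universe C" for \<theta> a
    unfolding interp_C[OF that(1)] using that(2) by blast
  moreover have "interp C \<theta> = {}" if "\<theta> \<notin> \<Theta>" for \<theta> using that by (simp add: C_def edge_sum_def)
  ultimately show ?thesis using fin_chain_C
    unfolding fin_lo_refl_structure_def fin_chain_def by blast
qed

lemma universe_C_ne: "universe C \<noteq> {}"
  using pt_in[OF N M K] by auto

end

lemma rigid_surj_by_minima:
  assumes L: "trans L" "irrefl L" and im: "f ` X = Y"
    and ex: "\<And>y. y \<in> Y \<Longrightarrow> \<exists>m. G y m"
    and min: "\<And>y m. y \<in> Y \<Longrightarrow> G y m \<Longrightarrow> m \<in> X \<and> f m = y"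
    and least: "\<And>y m x. y \<in> Y \<Longrightarrow> G y m \<Longrightarrow> x \<in> X \<Longrightarrow> f x = y \<Longrightarrow> x \<noteq> m \<Longrightarrow> (m, x) \<in> L"
    and mono: "\<And>y y' m m'. y \<in> Y \<Longrightarrow> y' \<in> Y \<Longrightarrow> (y, y') \<in> Q \<Longrightarrow> G y m \<Longrightarrow> G y' m' \<Longrightarrow> (m, m') \<in> L"
  shows "rigid_surj X L Y Q f"
  unfolding rigid_surj_def
proof (intro conjI ballI impI)
  have eq: "rel_min L (fibre X f y) = m" if "y \<in> Y" "G y m" for y m
    using min[OF that] least[OF that] by (intro rel_min_eq[OF L]) (auto simp: fibre_def)
  fix x y assume xy: "x \<in> Y" "y \<in> Y" "(x, y) \<in> Q"
  obtain m n where mn: "G x m" "G y n" using ex xy by blast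
  show "(rel_min L (fibre X f x), rel_min L (fibre X f y)) \<in> L"
    unfolding eq[OF xy(1) mn(1)] eq[OF xy(2) mn(2)] by (rule mono[OF xy mn])
qed (rule im)

section \<open>The morphism realised by a surjection onto the cells\<close>

context edge_sums
begin

context
  fixes X :: "('b, 's) lo_structure" and w :: "nat \<Rightarrow> nat \<times> 'b set"
  assumes X: "labelled \<Theta> ar lab M X"
    and P: "\<And>\<theta> \<pi>. \<theta> \<in> \<Theta> \<Longrightarrow> edges X \<theta> \<pi> \<noteq> {} \<Longrightarrow> \<pi> \<in> P \<theta>"
    and w: "chain_surj {..<N} {(i, j). i < j} (cells \<Theta> lab X) (cell_less \<Theta> lab X) w"
    and ne: "universe X \<noteq> {}"
begin

abbreviation "h \<equiv> realise \<iota> M K N X w"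

lemmas sX = labelledD(1)[OF X]
lemmas cX = fin_chain_lin[OF sX]

lemma w_in: "n < N \<Longrightarrow> w n \<in> cells \<Theta> lab X"
  using w unfolding chain_surj_def by blast

lemma w_hit: "s \<in> cells \<Theta> lab X \<Longrightarrow> \<exists>n<N. w n = s"
  using w unfolding chain_surj_def by (metis imageE lessThan_iff)

lemma w_lift: "n < N \<Longrightarrow> (s, w n) \<in> cell_less \<Theta> lab X \<Longrightarrow> \<exists>n'<n. w n' = s"
proof -
  assume a: "n < N" "(s, w n) \<in> cell_less \<Theta> lab X"
  then have "s \<in> cells \<Theta> lab X" by (simp add: cell_less_def)
  then show ?thesis using a w unfolding chain_surj_def by fastforce
qed

lemma h_pt: "n < N \<Longrightarrow> m < M \<Longrightarrow> j < K \<Longrightarrow> h (pt n m j) = place (lin X) m j (w n)"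
  using pt_in[of n m j] code_decode[of m M j K n] inv_f_f[OF inj]
  by (simp add: realise_def universe_C pt_def)

lemma h_in: "p \<in> universe C \<Longrightarrow> h p \<in> universe X"
proof -
  assume "p \<in> universe C"
  then obtain n m j where p: "n < N" "m < M" "j < K" "p = pt n m j" by (rule ptE)
  have "h p = place (lin X) m j (w n)" unfolding p(4) by (rule h_pt[OF p(1-3)])
  then show ?thesis using place_in[OF X w_in[OF p(1)]] finite_cell(1)[OF X w_in[OF p(1)]] by auto
qed

text \<open>A point \<open>a\<close> below \<open>h p\<close>, for \<open>p\<close> in block
  \<open>n\<close>, is a cell below \<open>w n\<close>: either \<open>w n\<close> is the point
  \<open>h p\<close>, or it is an edge and has a positive label. So \<open>a\<close> is the value of
  \<open>w\<close> at an earlier block, all of whose vertices are sent to it.\<close>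

lemma points: "chain_surj (universe C) (lin C) (universe X) (lin X) h"
  unfolding chain_surj_def
proof (intro conjI ballI impI)
  have point: "(0, {a}) \<in> cells \<Theta> lab X" if "a \<in> universe X" for a using that by (auto simp:
      cells_def)
  have hp: "h (pt n 0 0) = a" if "n < N" "w n = (0, {a})" "a \<in> universe X" for n a
    using h_pt[OF that(1) M K] nth_elt_singleton[OF cX that(3)] that(2) by (simp add: place_def)
  show "h ` universe C = universe X"
  proof (intro equalityI subsetI)
    fix a assume a: "a \<in> universe X"
    then obtain n where "n < N" "w n = (0, {a})" using w_hit[OF point] by blast
    then show "a \<in> h ` universe C" using hp[OF _ _ a] pt_in[OF _ M K] by (metis image_eqI)
  qed (use h_in in auto)
  fix p a assume p: "p \<in> universe C" and a: "a \<in> universe X" "(a, h p) \<in> lin X"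
  obtain n m j where nmj: "n < N" "m < M" "j < K" "p = pt n m j" using p by (rule ptE)
  have "((0, {a}), w n) \<in> cell_less \<Theta> lab X"
    using X w_in[OF nmj(1)]
  proof (cases rule: cells_cases)
    case (point b)
    have "h p \<in> snd (w n)" using place_in[OF X w_in[OF nmj(1)]] h_pt[OF nmj(1-3)] nmj(4) by simp
    then have "h p = b" using point by simp
    then have "({a}, {b}) \<in> alex (universe X) (lin X)" using alex_singleton[OF cX a(1) point(1)]
        a(2) by simp
    then show ?thesis using point w_in[OF nmj(1)] \<open>\<And>a. a \<in> universe X \<Longrightarrow> (0, {a}) \<in> cells \<Theta> lab
        X\<close>[OF a(1)]
      by (simp add: cell_less_def)
  next
    case (edge \<theta> \<pi> e)
    then show ?thesis using w_in[OF nmj(1)] point[OF a(1)] by (simp add: cell_less_def)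
  qed
  then obtain n' where n': "n' < n" "w n' = (0, {a})" using w_lift[OF nmj(1)] by blast
  then have "(pt n' 0 0, p) \<in> lin C" using nmj M K by (simp add: pt_less)
  moreover have "n' < N" using n'(1) nmj(1) by simp
  ultimately show "\<exists>p'\<in>universe C. (p', p) \<in> lin C \<and> h p' = a"
    using hp[OF _ n'(2) a(1)] pt_in[OF _ M K] by blast
qed

lemma h_replicate:
  assumes "\<theta> \<in> \<Theta>" "p \<in> universe C"
  shows "map h (replicate r p) = replicate r (h p)" "replicate (ar \<theta>) (h p) \<in> interp X \<theta>"
  using h_in[OF assms(2)] sX assms(1) by (auto simp: fin_lo_refl_structure_def)

lemma h_edge:
  assumes t: "\<theta> \<in> \<Theta>" and \<pi>: "\<pi> \<in> P \<theta>" and n: "n < N" and wn: "w n = (lab \<theta> \<pi>, e)"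
  shows "map h (map (pt n (lab \<theta> \<pi>)) \<pi>) \<in> interp X \<theta>"
    and "pat (lin X) (map h (map (pt n (lab \<theta> \<pi>)) \<pi>)) = \<pi>"
    and "set (map h (map (pt n (lab \<theta> \<pi>)) \<pi>)) = e"
    and "\<And>j. j \<in> set \<pi> \<Longrightarrow> h (pt n (lab \<theta> \<pi>) j) = nth_elt (lin X) e j \<and> j < card e" "e \<subseteq> universe X"
proof -
  have "e \<in> edges X \<theta> \<pi>" using cell_edge[OF X] w_in[OF n] wn by metis
  then obtain a where a: "a \<in> interp X \<theta>" "pat (lin X) a = \<pi>" "2 \<le> card (set a)" "e = set a" "e \<subseteq>
      universe X"
    using edgesE[OF sX t] by metis
  have sub: "set a \<subseteq> universe X" using a by simp
  have jc: "j < card e" if "j \<in> set \<pi>" for j using set_pat[OF cX sub] that a by auto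
  have hj: "h (pt n (lab \<theta> \<pi>) j) = nth_elt (lin X) e j" if "j \<in> set \<pi>" for j
    using h_pt[OF n lab edge_tuple(3)[OF t \<pi> n that]] wn jc[OF that] by (simp add: place_def)
  have "map h (map (pt n (lab \<theta> \<pi>)) \<pi>) = map (nth_elt (lin X) e) \<pi>" using hj by simp
  also have "\<dots> = a" using map_nth_elt_pat[OF cX sub] a by simp
  finally have "map h (map (pt n (lab \<theta> \<pi>)) \<pi>) = a" .
  then show "map h (map (pt n (lab \<theta> \<pi>)) \<pi>) \<in> interp X \<theta>"
    "pat (lin X) (map h (map (pt n (lab \<theta> \<pi>)) \<pi>)) = \<pi>"
    "set (map h (map (pt n (lab \<theta> \<pi>)) \<pi>)) = e" using a by simp_all
  show "e \<subseteq> universe X" using a by simp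
  show "h (pt n (lab \<theta> \<pi>) j) = nth_elt (lin X) e j \<and> j < card e" if "j \<in> set \<pi>" for j
    using hj jc that by blast
qed

lemma h_other:
  assumes t: "\<theta> \<in> \<Theta>" and \<pi>: "\<pi> \<in> P \<theta>" and n: "n < N" and wn: "fst (w n) \<noteq> lab \<theta> \<pi>"
  obtains p where "p \<in> universe C" "\<And>u. u \<in> set (map (pt n (lab \<theta> \<pi>)) \<pi>) \<Longrightarrow> h u = h p"
    "map h (map (pt n (lab \<theta> \<pi>)) \<pi>) = replicate (ar \<theta>) (h p)"
proof -
  let ?p = "pt n (lab \<theta> \<pi>) 0"
  have hj: "h (pt n (lab \<theta> \<pi>) j) = h ?p" if "j \<in> set \<pi>" for j
    using h_pt[OF n lab edge_tuple(3)[OF t \<pi> n that]] h_pt[OF n lab K] wn by (simp add: place_def)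
  moreover have "length \<pi> = ar \<theta>" using patterns[OF t \<pi>] by blast
  then have "map h (map (pt n (lab \<theta> \<pi>)) \<pi>) = replicate (ar \<theta>) (h ?p)"
    using hj by (intro replicate_eqI) auto
  ultimately show ?thesis using that[of ?p] pt_in[OF n lab K] by auto
qed

lemma h_interp:
  assumes t: "\<theta> \<in> \<Theta>" and x: "x \<in> interp C \<theta>"
  obtains (const) p where "p \<in> universe C" "\<And>u. u \<in> set x \<Longrightarrow> h u = h p" "map h x = replicate (ar \<theta>)
      (h p)"
  | (edge) n \<pi> e where "\<pi> \<in> P \<theta>" "n < N" "x = map (pt n (lab \<theta> \<pi>)) \<pi>" "w n = (lab \<theta> \<pi>, e)"
proof -
  consider p where "p \<in> universe C" "x = replicate (ar \<theta>) p"
    | n \<pi> where "n < N" "\<pi> \<in> P \<theta>" "x = map (pt n (lab \<theta> \<pi>)) \<pi>"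
    using x unfolding interp_C[OF t] by blast
  then show ?thesis
  proof cases
    case 1
    then show ?thesis using const[OF 1(1)] by simp
  next
    case (2 n \<pi>)
    show ?thesis
    proof (cases "fst (w n) = lab \<theta> \<pi>")
      case True
      then show ?thesis using edge[OF 2(2,1,3), of "snd (w n)"] by (metis prod.collapse)
    next
      case False
      from h_other[OF t 2(2,1) False] const 2(3) show ?thesis by metis
    qed
  qed
qed

lemma h_hom: "homomorphism \<Theta> C X h"
  unfolding homomorphism_def
proof (intro conjI ballI)
  show "h \<in> universe C \<rightarrow>\<^sub>E universe X" using h_in by (auto simp: realise_def universe_C)
  fix \<theta> x assume t: "\<theta> \<in> \<Theta>" and x: "x \<in> interp C \<theta>"
  from t x show "map h x \<in> interp X \<theta>"
  proof (cases rule: h_interp)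
    case (const p) then show ?thesis using h_replicate(2)[OF t] by simp
  next
    case (edge n \<pi> e) then show ?thesis using h_edge(1)[OF t] by simp
  qed
qed

lemma h_order:
  assumes t: "\<theta> \<in> \<Theta>" and x: "x \<in> interp C \<theta>" and n: "\<not> (\<exists>c. \<forall>u\<in>set x. h u = c)"
    and ij: "i < length x" "j < length x" "(x ! i, x ! j) \<in> lin C"
  shows "(h (x ! i), h (x ! j)) \<in> lin X"
  using t x
proof (cases rule: h_interp)
  case (const p) then show ?thesis using n by blast
next
  case (edge n \<pi> e)
  have mem: "\<pi> ! i \<in> set \<pi>" "\<pi> ! j \<in> set \<pi>" using ij edge(3) by auto
  note K' = edge_tuple(3)[OF t edge(1,2)] and he = h_edge(4,5)[OF t edge(1,2,4)]
  have "(pt n (lab \<theta> \<pi>) (\<pi> ! i), pt n (lab \<theta> \<pi>) (\<pi> ! j)) \<in> lin C" using ij edge(3) by simp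
  then have "\<pi> ! i < \<pi> ! j" using pt_less_same[OF edge(2) lab K'[OF mem(1)] K'[OF mem(2)]] by simp
  then show ?thesis using he(1)[OF mem(1)] he(1)[OF mem(2)] nth_elt_less[OF cX he(2)] ij edge(3)
      by simp
qed

text \<open>The least preimage of a constant tuple is the constant tuple at the first preimage of
  its entry; that of a non-constant \<open>x\<close> is the copy of \<open>x\<close> in the first
  block \<open>n\<close> with \<open>w n = cell x\<close>. Copies of one type are ordered like their
  blocks, and copies of different types like their types.\<close>

lemma h_tuples:
  assumes t: "\<theta> \<in> \<Theta>"
  shows "rigid_surj (interp C \<theta>) (sal (universe C) (lin C) (ar \<theta>))
    (interp X \<theta>) (sal (universe X) (lin X) (ar \<theta>)) (map h)"
proof -
  let ?r = "ar \<theta>"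
  note cC = fin_chain_C
  let ?S = "sal (universe C) (lin C) ?r" and ?SX = "sal (universe X) (lin X) ?r"
  have tC: "z \<in> tuples (universe C) ?r" if "z \<in> interp C \<theta>" for z using interp_tuples[OF
      structure_C t] that by blast
  have tX: "x \<in> tuples (universe X) ?r" if "x \<in> interp X \<theta>" for x using interp_tuples[OF sX t]
      that by blast
  define first where "first d p \<longleftrightarrow> p \<in> universe C \<and> h p = d \<and>
    (\<forall>q\<in>universe C. h q = d \<longrightarrow> q \<noteq> p \<longrightarrow> (p, q) \<in> lin C)" for d p
  define T where "T n x = map (pt n (lab \<theta> (pat (lin X) x))) (pat (lin X) x)" for n x
  define cell where "cell x = (lab \<theta> (pat (lin X) x), set x)" for x
  \<comment> \<open>\<open>G x z\<close>: \<open>z\<close> is the least preimage of \<open>x\<close>\<close>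
  define G where "G x z \<longleftrightarrow> (\<exists>d p. d \<in> universe X \<and> x = replicate ?r d \<and> first d p \<and> z = replicate
      ?r p) \<or>
    2 \<le> card (set x) \<and> (\<exists>n<N. w n = cell x \<and> (\<forall>n'<n. w n' \<noteq> cell x) \<and> z = T n x)" for x z
  have im: "h ` universe C = universe X" using points by (simp add: chain_surj_def)
  have firstE: "\<exists>p. first d p" if "d \<in> universe X" for d
    using fibre_min[OF cC im that] by (auto simp: first_def fibre_def)
  have cell_in: "cell x \<in> cells \<Theta> lab X" "pat (lin X) x \<in> P \<theta>"
    if "x \<in> interp X \<theta>" "2 \<le> card (set x)" for x
  proof -
    have e: "set x \<in> edges X \<theta> (pat (lin X) x)" using that by (auto simp: edges_def)
    then show "cell x \<in> cells \<Theta> lab X" using t by (auto simp: cells_def cell_def)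
    show "pat (lin X) x \<in> P \<theta>" using P[OF t] e by blast
  qed
  have T: "T n x \<in> interp C \<theta>" "map h (T n x) = x" "tp (lin C) (T n x) = tp (lin X) x"
      "pat (lin C) (T n x) = pat (lin X) x" "0 < ?r"
    if x: "x \<in> interp X \<theta>" "2 \<le> card (set x)" and n: "n < N" "w n = cell x" for n x
  proof -
    note p = cell_in(2)[OF x] and wn = n(2)[unfolded cell_def]
    show TC: "T n x \<in> interp C \<theta>" unfolding interp_C[OF t] T_def using p n by blast
    note e = h_edge[OF t p n(1) wn, folded T_def]
    have "tp (lin X) (map h (T n x)) = tp (lin X) x"
      using e(2) pat_eq_iff_tp[OF cX tX[OF e(1)] cX tX[OF x(1)]] by simp
    then show "map h (T n x) = x" using tp_set_inj[OF cX tX[OF e(1)] tX[OF x(1)]] e(3) by simp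
    show pt: "pat (lin C) (T n x) = pat (lin X) x" using edge_tuple(2)[OF t p n(1)] by (simp add:
        T_def)
    then show "tp (lin C) (T n x) = tp (lin X) x" using pat_eq_iff_tp[OF cC tC[OF TC] cX tX[OF
        x(1)]] by simp
    show "0 < ?r" using edge_tuple(4)[OF t p n(1)] .
  qed
  have rep: "replicate ?r p \<in> interp C \<theta>" if "p \<in> universe C" for p unfolding interp_C[OF t] using
      that by blast
  have Tless: "(T n x, T n' x') \<in> ?S"
    if x: "x \<in> interp X \<theta>" "2 \<le> card (set x)" "w n = cell x" and x': "x' \<in> interp X \<theta>" "2 \<le> card
        (set x')" "w n' = cell x'"
      and nn: "n < n'" "n' < N" and tp: "tp (lin X) x = tp (lin X) x'" for n n' x x'
  proof -
    have nN: "n < N" using nn by simp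
    note a = T[OF x(1,2) nN x(3)] and b = T[OF x'(1,2) nn(2) x'(3)]
    have "(u, v) \<in> lin C" if uv: "u \<in> set (T n x)" "v \<in> set (T n' x')" for u v
    proof -
      obtain i j where "u = pt n (lab \<theta> (pat (lin X) x)) i" "i \<in> set (pat (lin X) x)"
        "v = pt n' (lab \<theta> (pat (lin X) x')) j" "j \<in> set (pat (lin X) x')" using uv by (auto simp:
            T_def)
      then show ?thesis
        using pt_less[OF nn lab edge_tuple(3)[OF t cell_in(2)[OF x(1,2)] nN] lab edge_tuple(3)[OF
            t cell_in(2)[OF x'(1,2)] nn(2)]]
        by simp
    qed
    then show ?thesis using a b tp by (intro sal_if_below[OF cC tC tC]) auto
  qed
  have const_or: "(\<exists>d\<in>universe X. x = replicate ?r d) \<or> 2 \<le> card (set x)" if "x \<in> interp X \<theta>" for x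
    using const_tuple[OF tX[OF that] ne] by metis
  have not_both: "\<not> 2 \<le> card (set (replicate ?r d))" for d :: 'b
    by (simp add: set_replicate_conv_if)
  have Gex: "\<exists>z. G x z" if x: "x \<in> interp X \<theta>" for x
  proof (cases "2 \<le> card (set x)")
    case True
    have "\<exists>n. n < N \<and> w n = cell x" using w_hit[OF cell_in(1)[OF x True]] by blast
    then obtain n where n: "n < N \<and> w n = cell x" "\<forall>n'<n. \<not> (n' < N \<and> w n' = cell x)"
      using exists_least_iff[of "\<lambda>n. n < N \<and> w n = cell x"] by blast
    then have "\<forall>n'<n. w n' \<noteq> cell x" using less_trans by blast
    then show ?thesis using n(1) True unfolding G_def by blast
  next
    case False
    then obtain d where d: "d \<in> universe X" "x = replicate ?r d" using const_or[OF x] by blast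
    then obtain p where "first d p" using firstE by blast
    then have "G x (replicate ?r p)"
      unfolding G_def using d by (intro disjI1 exI[of _ d] exI[of _ p] conjI refl)
    then show ?thesis ..
  qed
  have Gmin: "z \<in> interp C \<theta> \<and> map h z = x" if x: "x \<in> interp X \<theta>" and G: "G x z" for x z
    using G unfolding G_def
  proof (elim disjE exE conjE)
    fix d p assume "x = replicate ?r d" "first d p" "z = replicate ?r p"
    then show ?thesis using rep by (simp add: first_def)
  next
    fix n assume "2 \<le> card (set x)" "n < N" "w n = cell x" "z = T n x"
    then show ?thesis using T(1,2)[OF x] by blast
  qed
  \<comment> \<open>A tuple of \<open>C\<close> that is not collapsed is the edge with the matching
    label in its block, so the preimages of \<open>x\<close> correspond to the occurrences of
    \<open>cell x\<close> in \<open>w\<close>.\<close>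
  have pre: "\<exists>n<N. w n = cell x \<and> z = T n x"
    if x: "2 \<le> card (set x)" and z: "z \<in> interp C \<theta>" "map h z = x" for x z
    using t z(1)
  proof (cases rule: h_interp)
    case (const p) then show ?thesis using x z(2) not_both by simp
  next
    case (edge n \<pi> e)
    have "pat (lin X) x = \<pi>" "set x = e" using h_edge(2,3)[OF t edge(1,2,4)] unfolding
        edge(3)[symmetric] z(2) .
    then have "w n = cell x \<and> z = T n x" using edge(3,4) by (simp add: cell_def T_def)
    then show ?thesis using edge(2) by blast
  qed
  have Gleast: "(m, z) \<in> ?S" if x: "x \<in> interp X \<theta>" and G: "G x m" and z: "z \<in> interp C \<theta>" "map h
      z = x" "z \<noteq> m" for x m z
    using G unfolding G_def
  proof (elim disjE exE conjE)
    fix d p assume d: "d \<in> universe X" "x = replicate ?r d" "first d p" "m = replicate ?r p"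
    have p: "p \<in> universe C" using d(3) by (simp add: first_def)
    show ?thesis
    proof (cases "2 \<le> card (set z)")
      case True
      then show ?thesis unfolding d(4) by (intro sal_const_less[OF cC tC[OF z(1)] p]
          nonconst_iff[THEN iffD2])
    next
      case False
      then obtain q where q: "q \<in> universe C" "z = replicate ?r q" using const_tuple[OF tC[OF
          z(1)] universe_C_ne] by blast
      have r: "0 < ?r" using z(3) q(2) d(4) by (cases ?r) auto
      then have "h q = d" "q \<noteq> p" using z(2,3) q d(2,4) by (auto simp: replicate_eq_replicate)
      then have "(p, q) \<in> lin C" using d(3) q(1) by (simp add: first_def)
      then show ?thesis using r tC[OF rep[OF p]] tC[OF z(1)] unfolding d(4) q(2)
        by (intro sal_if_below[OF cC]) (auto simp: tp_replicate)
    qed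
  next
    fix n assume n: "2 \<le> card (set x)" "n < N" "w n = cell x" "\<forall>n'<n. w n' \<noteq> cell x" "m = T n x"
    obtain n' where n': "n' < N" "w n' = cell x" "z = T n' x" using pre[OF n(1) z(1,2)] by blast
    have "n < n'" using n(4,5) n'(2,3) z(3) by (metis linorder_neqE_nat)
    then show ?thesis unfolding n(5) n'(3) using x n n' by (intro Tless) auto
  qed
  have Gmono: "(m, m') \<in> ?S"
    if x: "x \<in> interp X \<theta>" "x' \<in> interp X \<theta>" and less: "(x, x') \<in> ?SX" and G: "G x m" "G x' m'"
        for x x' m m'
  proof -
    note mC = Gmin[OF x(1) G(1)] and mC' = Gmin[OF x(2) G(2)]
    consider (cc) d p d' p' where "d \<in> universe X" "x = replicate ?r d" "first d p" "m = replicate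
        ?r p"
        "d' \<in> universe X" "x' = replicate ?r d'" "first d' p'" "m' = replicate ?r p'"
      | (ce) d p n where "first d p" "m = replicate ?r p" "2 \<le> card (set x')" "n < N" "w n = cell
          x'" "m' = T n x'"
      | (ec) d where "2 \<le> card (set x)" "d \<in> universe X" "x' = replicate ?r d"
      | (ee) n n' where "2 \<le> card (set x)" "n < N" "w n = cell x" "\<forall>k<n. w k \<noteq> cell x" "m = T n x"
         "2 \<le> card (set x')" "n' < N" "w n' = cell x'" "m' = T n' x'"
      using G unfolding G_def by blast
    then show ?thesis
    proof cases
      case cc
      have "set x \<noteq> set x'" "(set x, set x') \<in> alex (universe X) (lin X)"
        using sal_same_tp[OF less] irreflD[OF irrefl_alex[OF cX]] cc by (auto simp: tp_replicate)
      \<comment> \<open>With arity \<open>0\<close> both tuples would be empty and their sets of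
        entries equal.\<close>
      moreover then have r: "0 < ?r" using cc by (cases ?r) auto
      ultimately have "({d}, {d'}) \<in> alex (universe X) (lin X)" using cc by simp
      then have "(d, d') \<in> lin X" using alex_singleton[OF cX cc(1,5)] by simp
      moreover have p: "p \<in> universe C" "p' \<in> universe C" "h p' = d'" using cc by (auto simp:
          first_def)
      ultimately obtain q where q: "q \<in> universe C" "(q, p') \<in> lin C" "h q = d"
        using points cc(1) unfolding chain_surj_def by blast
      then have "q = p \<or> (p, q) \<in> lin C" using cc(3) by (auto simp: first_def)
      then have "(p, p') \<in> lin C" using q(2) transD[OF fin_chainD(3)[OF cC]] by blast
      then show ?thesis using r tC mC mC' unfolding cc(4,8)
        by (intro sal_if_below[OF cC]) (auto simp: tp_replicate)
    next
      case ce
      have p: "p \<in> universe C" using ce(1) by (simp add: first_def)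
      \<comment> \<open>Equal patterns have equally many distinct letters, so the copy
        \<open>m'\<close> is as little constant as \<open>x'\<close>.\<close>
      have "pat (lin C) m' = pat (lin X) x'" using T(4)[OF x(2) ce(3-5)] ce(6) by simp
      moreover have "set (pat (lin C) m') = {..<card (set m')}" using set_pat[OF cC] tuplesD(2)[OF
          tC] mC' by blast
      moreover have "set (pat (lin X) x') = {..<card (set x')}" using set_pat[OF cX] tuplesD(2)[OF
          tX[OF x(2)]] by blast
      ultimately have "2 \<le> card (set m')" using ce(3) by simp
      then show ?thesis unfolding ce(2) using mC'
        by (intro sal_const_less[OF cC tC p] nonconst_iff[THEN iffD2]) auto
    next
      case ec
      have "\<not> 2 \<le> card (set x)" using sal_transfer_const[OF cX tX[OF x(1)] ec(2)] less ec(3) by simp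
      then show ?thesis using ec(1) by simp
    next
      case ee
      note a = T[OF x(1) ee(1-3)] and b = T[OF x(2) ee(6-8)]
      show ?thesis
      proof (cases "tp (lin X) x = tp (lin X) x'")
        case False
        then show ?thesis using sal_other_tp[OF less False, of "lin C" m m'] a(3) b(3) ee(5,9) tC
            mC mC' by simp
      next
        case True
        have "pat (lin X) x = pat (lin X) x'" using True pat_eq_iff_tp[OF cX tX[OF x(1)] cX tX[OF
            x(2)]] by simp
        \<comment> \<open>Equal patterns give equal labels, so the cells are compared by their sets
          alone. Hence \<open>cell x\<close> occurs before block \<open>n'\<close>, and its first
          occurrence \<open>n\<close> is earlier still or the same block.\<close>
        then have "(cell x, w n') \<in> cell_less \<Theta> lab X"
          using sal_same_tp[OF less True] cell_in(1)[OF x(1) ee(1)] cell_in(1)[OF x(2) ee(6)] ee(8)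
          by (simp add: cell_less_def cell_def)
        then obtain k where "k < n'" "w k = cell x" using w_lift[OF ee(7)] by blast
        then have "n < n'" using ee(4) by (meson le_less_trans not_le)
        then show ?thesis unfolding ee(5,9) using Tless[OF x(1) ee(1,3) x(2) ee(6,8) _ ee(7) True]
            by blast
      qed
    qed
  qed
  have img: "map h ` interp C \<theta> = interp X \<theta>"
  proof (intro equalityI subsetI)
    fix x assume x: "x \<in> interp X \<theta>"
    then obtain z where "G x z" using Gex by blast
    then show "x \<in> map h ` interp C \<theta>" using Gmin[OF x] by (metis image_eqI)
  qed (use h_hom t in \<open>auto simp: homomorphism_def\<close>)
  show ?thesis
    by (rule rigid_surj_by_minima[where G = G, OF trans_sal[OF cC] irrefl_sal img Gex Gmin Gleast
        Gmono])
qed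

lemma srq_realise: "strong_rigid_quotient \<Theta> ar C X h"
  unfolding strong_rigid_quotient_def
  using h_hom chain_surj_imp_rigid_surj[OF fin_chain_C points] h_tuples h_order by blast

end

end

section \<open>From chains to structures\<close>

text \<open>The label of a symbol with a pattern is a number for the pair of its edge families in
  both structures. Only finitely many such pairs exist, however large \<Theta> is, and equal labels
  give equal families in \<open>A\<close> and in \<open>B\<close> at once. The \<open>Suc\<close>
  keeps \<open>0\<close> free for points.\<close>

lemma exists_labelling:
  fixes A B :: "('a, 's) lo_structure"
  assumes A: "fin_lo_refl_structure \<Theta> ar A" and B: "fin_lo_refl_structure \<Theta> ar B"
    and outside: "\<And>\<theta> \<pi>. \<theta> \<notin> \<Theta> \<Longrightarrow> edges A \<theta> \<pi> = {} \<and> edges B \<theta> \<pi> = {}"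
  obtains lab M where "labelled \<Theta> ar lab M A" "labelled \<Theta> ar lab M B" "0 < M"
proof -
  let ?E = "Pow (Pow (universe A)) \<times> Pow (Pow (universe B))"
  have "finite ?E" using fin_chainD(1)[OF fin_chain_lin[OF A]] fin_chainD(1)[OF fin_chain_lin[OF
      B]] by simp
  then obtain h where h: "bij_betw h ?E {0..<card ?E}" using ex_bij_betw_finite_nat by blast
  let ?lab = "\<lambda>\<theta> \<pi>. Suc (h (edges A \<theta> \<pi>, edges B \<theta> \<pi>))"
  have mem: "(edges A \<theta> \<pi>, edges B \<theta> \<pi>) \<in> ?E" for \<theta> \<pi>
  proof (cases "\<theta> \<in> \<Theta>")
    case True
    have "e \<subseteq> universe A" if "e \<in> edges A \<theta> \<pi>" for e using edgesE[OF A True that] by blast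
    moreover have "e \<subseteq> universe B" if "e \<in> edges B \<theta> \<pi>" for e using edgesE[OF B True that] by blast
    ultimately show ?thesis by blast
  next
    case False then show ?thesis using outside by simp
  qed
  have lt: "?lab \<theta> \<pi> < Suc (card ?E)" for \<theta> \<pi> using bij_betwE[OF h] mem by fastforce
  have inj: "edges A \<theta> \<pi> = edges A \<theta>' \<pi>' \<and> edges B \<theta> \<pi> = edges B \<theta>' \<pi>'" if "?lab \<theta> \<pi> = ?lab \<theta>' \<pi>'"
      for \<theta> \<pi> \<theta>' \<pi>'
    using inj_onD[OF bij_betw_imp_inj_on[OF h] _ mem mem] that by blast
  have "labelled \<Theta> ar ?lab (Suc (card ?E)) A" "labelled \<Theta> ar ?lab (Suc (card ?E)) B"
    unfolding labelled_def using A B lt inj by blast+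
  then show ?thesis using that by blast
qed

text \<open>Composing a realised morphism with \<open>f\<close> amounts to composing the underlying
  surjection with \<open>cell_map f\<close>; this turns a colouring of morphisms into one of
  surjections of chains.\<close>

lemma realise_natural:
  assumes X: "labelled \<Theta> ar lab M X" and Y: "labelled \<Theta> ar lab M Y"
    and f: "strong_rigid_quotient \<Theta> ar X Y f" and \<iota>: "inj \<iota>"
    and u: "\<And>n. n < N \<Longrightarrow> u n \<in> cells \<Theta> lab X"
  shows "compose (\<iota> ` {..<N * M * K}) f (realise \<iota> M K N X u) = realise \<iota> M K N Y (cell_map f \<circ> u)"
proof
  fix p
  show "compose (\<iota> ` {..<N * M * K}) f (realise \<iota> M K N X u) p = realise \<iota> M K N Y (cell_map f \<circ>
      u) p"
  proof (cases "p \<in> \<iota> ` {..<N * M * K}")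
    case True
    then obtain x where x: "x < N * M * K" "p = \<iota> x" by auto
    have "x div K div M < N" using x(1) by (simp add: less_mult_imp_div_less mult.assoc
        mult.commute)
    then have "u (x div K div M) \<in> cells \<Theta> lab X" by (rule u)
    from place_natural[OF X Y f this] show ?thesis
      using x True inv_f_f[OF \<iota>] by (simp add: compose_def realise_def)
  qed (simp add: compose_def realise_def)
qed

lemma dual_ramsey_srq:
  fixes A B :: "('a, 's) lo_structure"
  assumes inf: "infinite (UNIV :: 'a set)"
    and A: "fin_lo_refl_structure \<Theta> ar A" and B: "fin_lo_refl_structure \<Theta> ar B"
    and f0: "strong_rigid_quotient \<Theta> ar B A f0" and ne: "universe A \<noteq> {}"
  shows "\<exists>D :: ('a, 's) lo_structure. fin_lo_refl_structure \<Theta> ar D \<and>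
    (\<forall>\<chi> :: ('a \<Rightarrow> 'a) \<Rightarrow> nat. (\<forall>g. strong_rigid_quotient \<Theta> ar D A g \<longrightarrow> \<chi> g \<le> k) \<longrightarrow>
      (\<exists>w. strong_rigid_quotient \<Theta> ar D B w \<and> (\<exists>c. \<forall>f. strong_rigid_quotient \<Theta> ar B A f \<longrightarrow>
        \<chi> (compose (universe D) f w) = c)))"
proof -
  obtain \<iota> :: "nat \<Rightarrow> 'a" where \<iota>: "inj \<iota>" using inf infinite_countable_subset by blast
  have "edges A \<theta> \<pi> = {} \<and> edges B \<theta> \<pi> = {}" if "\<theta> \<notin> \<Theta>" for \<theta> \<pi>
    using A B that by (simp add: edges_def fin_lo_refl_structure_def)
  then obtain lab M where lA: "labelled \<Theta> ar lab M A" and lB: "labelled \<Theta> ar lab M B" and M: "0 < M"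
    using exists_labelling[OF A B] by blast
  have im: "f0 ` universe B = universe A" using f0 by (simp add: strong_rigid_quotient_def
      rigid_surj_def)
  then have neB: "universe B \<noteq> {}" using ne by auto
  note finB = fin_chainD(1)[OF fin_chain_lin[OF B]]
  \<comment> \<open>No edge of \<open>B\<close> has more vertices than \<open>B\<close> has
    points.\<close>
  let ?K = "card (universe B)"
  have K: "0 < ?K" using neB finB by (simp add: card_gt_0_iff)
  \<comment> \<open>The patterns of \<open>B\<close> suffice: \<open>f0\<close> is onto on tuples
    and preserves the patterns of those it does not collapse, so every pattern of an edge of
    \<open>A\<close> occurs in \<open>B\<close>.\<close>
  define P where "P \<theta> = {\<pi>. edges B \<theta> \<pi> \<noteq> {}}" for \<theta>
  have PA: "\<pi> \<in> P \<theta>" if t: "\<theta> \<in> \<Theta>" and e: "edges A \<theta> \<pi> \<noteq> {}" for \<theta> \<pi>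
  proof -
    obtain a where a: "a \<in> interp A \<theta>" "pat (lin A) a = \<pi>" "2 \<le> card (set a)" using e by (auto
        simp: edges_def)
    have "map f0 ` interp B \<theta> = interp A \<theta>" using f0 t by (simp add: strong_rigid_quotient_def
        rigid_surj_def)
    then obtain b where b: "b \<in> interp B \<theta>" "map f0 b = a" using a(1) by (metis imageE)
    have c: "2 \<le> card (f0 ` set b)" using a(3) b(2) by auto
    show ?thesis using srq_edge(2,4)[OF B A f0 t b(1) c] a(2) b by (auto simp: P_def edges_def)
  qed
  have patterns: "length \<pi> = ar \<theta> \<and> (\<exists>\<kappa>. set \<pi> = {..<\<kappa>} \<and> 2 \<le> \<kappa> \<and> \<kappa> \<le> ?K)" if t: "\<theta> \<in> \<Theta>" and p: "\<pi>
      \<in> P \<theta>" for \<theta> \<pi>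
  proof -
    obtain e where "e \<in> edges B \<theta> \<pi>" using p by (auto simp: P_def)
    then obtain b where b: "b \<in> tuples (universe B) (ar \<theta>)" "pat (lin B) b = \<pi>" "2 \<le> card (set b)"
        "set b \<subseteq> universe B"
      using edgesE[OF B t] by metis
    have "length \<pi> = ar \<theta>" using b(2) tuplesD(1)[OF b(1)] by auto
    moreover have "set \<pi> = {..<card (set b)}" using set_pat[OF fin_chain_lin[OF B] b(4)] b(2) by
        simp
    moreover have "card (set b) \<le> ?K" using card_mono[OF finB b(4)] .
    ultimately show ?thesis using b(3) by blast
  qed
  let ?cA = "cells \<Theta> lab A" and ?cB = "cells \<Theta> lab B"
  have ne': "?cA \<noteq> {}" "?cB \<noteq> {}" using ne neB by (auto simp: cells_def)
  obtain N :: nat where N: "0 < N" and ram: "\<forall>\<chi>. (\<forall>v. \<chi> v < Suc k) \<longrightarrow>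
    (\<exists>u. chain_surj {..<N} {(i, j). i < j} ?cB (cell_less \<Theta> lab B) u \<and>
      (\<forall>g g'. chain_surj ?cB (cell_less \<Theta> lab B) ?cA (cell_less \<Theta> lab A) g \<longrightarrow>
        chain_surj ?cB (cell_less \<Theta> lab B) ?cA (cell_less \<Theta> lab A) g' \<longrightarrow> \<chi> (g \<circ> u) = \<chi> (g' \<circ> u)))"
    using chain_ramsey[OF fin_chain_cells[OF lA] ne'(1) fin_chain_cells[OF lB] ne'(2), of "Suc k"]
    by (elim exE conjE)
  interpret edge_sums \<iota> \<Theta> ar lab M ?K N P
    by unfold_locales (use \<iota> N M K labelledD(3)[OF lA] patterns in auto)
  have "\<exists>w. strong_rigid_quotient \<Theta> ar C B w \<and> (\<exists>c. \<forall>f. strong_rigid_quotient \<Theta> ar B A f \<longrightarrow>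
        \<chi> (compose (universe C) f w) = c)"
    if \<chi>: "\<forall>g. strong_rigid_quotient \<Theta> ar C A g \<longrightarrow> \<chi> g \<le> k" for \<chi>
  proof -
    \<comment> \<open>\<open>\<chi>\<close> is bounded on morphisms only, whereas the chain theorem
      colours all functions. Truncating at \<open>k\<close> changes nothing on realised
      morphisms.\<close>
    let ?\<chi> = "\<lambda>v. min k (\<chi> (realise \<iota> M ?K N A v))"
    have "\<forall>v. ?\<chi> v < Suc k" by (simp add: less_Suc_eq_le)
    from ram[THEN spec[of _ ?\<chi>], THEN mp, OF this]
    obtain u where u: "chain_surj {..<N} {(i, j). i < j} ?cB (cell_less \<Theta> lab B) u"
      and mono: "\<And>g g'. chain_surj ?cB (cell_less \<Theta> lab B) ?cA (cell_less \<Theta> lab A) g \<Longrightarrow>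
        chain_surj ?cB (cell_less \<Theta> lab B) ?cA (cell_less \<Theta> lab A) g' \<Longrightarrow> ?\<chi> (g \<circ> u) = ?\<chi> (g' \<circ> u)"
            by blast
    let ?w = "realise \<iota> M ?K N B u"
    have w: "strong_rigid_quotient \<Theta> ar C B ?w" by (rule srq_realise[OF lB _ u neB]) (simp add:
        P_def)
    have uc: "u n \<in> ?cB" if "n < N" for n using u that unfolding chain_surj_def by blast
    have comp: "compose (universe C) f ?w = realise \<iota> M ?K N A (cell_map f \<circ> u)"
      and col: "\<chi> (realise \<iota> M ?K N A (cell_map f \<circ> u)) = ?\<chi> (cell_map f \<circ> u)"
      and surj: "chain_surj ?cB (cell_less \<Theta> lab B) ?cA (cell_less \<Theta> lab A) (cell_map f)"
      if f: "strong_rigid_quotient \<Theta> ar B A f" for f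
    proof -
      show "compose (universe C) f ?w = realise \<iota> M ?K N A (cell_map f \<circ> u)"
        unfolding universe_C by (rule realise_natural[OF lB lA f \<iota> uc])
      show s: "chain_surj ?cB (cell_less \<Theta> lab B) ?cA (cell_less \<Theta> lab A) (cell_map f)"
        by (rule chain_surj_cell_map[OF lB lA f])
      have "strong_rigid_quotient \<Theta> ar C A (realise \<iota> M ?K N A (cell_map f \<circ> u))"
        by (rule srq_realise[OF lA PA chain_surj_comp[OF u s] ne])
      then show "\<chi> (realise \<iota> M ?K N A (cell_map f \<circ> u)) = ?\<chi> (cell_map f \<circ> u)" using \<chi> by simp
    qed
    have "\<chi> (compose (universe C) f ?w) = ?\<chi> (cell_map f0 \<circ> u)" if f: "strong_rigid_quotient \<Theta> ar
        B A f" for f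
      unfolding comp[OF f] using col[OF f] mono[OF surj[OF f] surj[OF f0]] by (rule trans)
    then show ?thesis using w by blast
  qed
  then show ?thesis using structure_C by blast
qed

theorem theorem6p6:
  fixes \<Theta> :: "'s set" and ar :: "'s \<Rightarrow> nat"
  assumes "infinite (UNIV :: 'a set)"
  shows "dual_ramsey_property (Rel_srq \<Theta> ar :: (('a, 's) lo_structure, 'a \<Rightarrow> 'a) category)"
  unfolding dual_ramsey_property_def
proof (intro allI impI ballI)
  let ?C = "Rel_srq \<Theta> ar :: (('a, 's) lo_structure, 'a \<Rightarrow> 'a) category"
  have Obj: "D \<in> Obj ?C \<longleftrightarrow> fin_lo_refl_structure \<Theta> ar D"
    and Hom: "f \<in> Hom ?C D E \<longleftrightarrow> strong_rigid_quotient \<Theta> ar D E f"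
    and Cmp: "Cmp ?C D E F g f = compose (universe D) g f" for D E F f g by (simp_all add:
        Rel_srq_def)
  fix k :: nat and A B assume "A \<in> Obj ?C" "B \<in> Obj ?C" "Hom ?C B A \<noteq> {}"
  then obtain f0 where A: "fin_lo_refl_structure \<Theta> ar A" and B: "fin_lo_refl_structure \<Theta> ar B"
    and f0: "strong_rigid_quotient \<Theta> ar B A f0" by (auto simp: Obj Hom)
  show "\<exists>D\<in>Obj ?C. \<forall>\<chi> \<in> Hom ?C D A \<rightarrow> {1..k}.
      \<exists>w\<in>Hom ?C D B. \<exists>c. \<forall>f\<in>Hom ?C B A. \<chi> (Cmp ?C D B A f w) = c"
  proof (cases "universe A = {}")
    \<comment> \<open>\<open>B\<close> maps into an empty set, so it is empty as well and
      \<open>f0\<close> is the only morphism to \<open>A\<close>. Then \<open>B\<close> itself with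
      its identity is a witness.\<close>
    case True
    have PiE: "f \<in> universe B \<rightarrow>\<^sub>E universe A" if "strong_rigid_quotient \<Theta> ar B A f" for f
      using that by (simp add: strong_rigid_quotient_def homomorphism_def)
    then have "universe B = {}" using f0 True by (auto simp: PiE_eq_empty_iff)
    then have "f = f0" if "strong_rigid_quotient \<Theta> ar B A f" for f using PiE[OF that] PiE[OF f0]
        by simp
    then show ?thesis using B srq_ident[OF B] unfolding Obj Ball_def Bex_def Hom Cmp by metis
  next
    case False
    from dual_ramsey_srq[OF assms A B f0 False, of k] obtain D :: "('a, 's) lo_structure"
      where D: "fin_lo_refl_structure \<Theta> ar D"
        and ram: "\<forall>\<chi> :: ('a \<Rightarrow> 'a) \<Rightarrow> nat. (\<forall>g. strong_rigid_quotient \<Theta> ar D A g \<longrightarrow> \<chi> g \<le> k) \<longrightarrow>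
      (\<exists>w. strong_rigid_quotient \<Theta> ar D B w \<and> (\<exists>c. \<forall>f. strong_rigid_quotient \<Theta> ar B A f \<longrightarrow>
        \<chi> (compose (universe D) f w) = c))" by (elim exE conjE)
    have "\<exists>w\<in>Hom ?C D B. \<exists>c. \<forall>f\<in>Hom ?C B A. \<chi> (Cmp ?C D B A f w) = c"
      if \<chi>: "\<chi> \<in> Hom ?C D A \<rightarrow> {1..k}" for \<chi>
    proof -
      have "\<forall>g. strong_rigid_quotient \<Theta> ar D A g \<longrightarrow> \<chi> g \<le> k" using \<chi> by (auto simp: Hom Pi_iff)
      from ram[THEN spec[of _ \<chi>], THEN mp, OF this] show ?thesis unfolding Bex_def Ball_def Hom
          Cmp .
    qed
    then show ?thesis using D by (intro bexI[of _ D] ballI) (simp_all add: Obj)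
  qed
qed

end
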